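(* Let $k\ge -\tfrac12$ and $M=(a,b;c,d)\in SL(2,\mathbb{R})$ with $b\ne 0$. Let $1<p_1<p_2\le2$, with $q_1$ and $q_2$ the conjugate exponents of $p_1$ and $p_2$ respectively, and let $s>0$. If $f\in L_k^{p_1}(\mathbb{R})\cap L_k^{p_2}(\mathbb{R})$, then $$\|D_k^M(f)\|_{L_k^{q_2}(\mathbb{R})} \le C(q_1,q_2,k,b)\, \|f\|^{\frac{sq_1q_2}{(2k+2)(q_1-q_2)+sq_1q_2}}_{L_k^{p_1}(\mathbb{R})}\;\big\||x|^s D_k^M(f)\big\|_{L_k^{q_2}(\mathbb{R})}^{\frac{(2k+2)(q_1-q_2)}{(2k+2)(q_1-q_2)+sq_1q_2}},$$ where $$C(q_1,q_2,k,b) = \left\{ 1+\left(\frac{1}{2^{k+1}\,\Gamma(k+2) }\right)^{\frac{q_1-q_2}{q_1}} C_{k,b}^{\left(1-\frac{2}{q_1}\right)q_2}\right\} ^{\frac{1}{q_{2}}},\qquad C_{k,b}=\frac{1}{|b|^{k+1}}.$$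
   Context: For $k\ge-\frac12$ let $d\mu_k(x)=\frac{|x|^{2k+1}}{2^{k+1}\Gamma(k+1)}\,dx$ on $\mathbb{R}$, and let $L^p_k(\mathbb{R})=L^p(\mathbb{R},\mu_k)$ (complex-valued functions) with its usual norm, $1\le p\le\infty$. Norms of functions not in the space are $+\infty$. The Dunkl kernel is $E_k(-i\lambda,x)=j_k(\lambda x)-\frac{i\lambda x}{2(k+1)}j_{k+1}(\lambda x)$, where $j_k(u)=\Gamma(k+1)\sum_{n\ge0}\frac{(-1)^n(u/2)^{2n}}{n!\,\Gamma(n+k+1)}$. For $M=(a,b;c,d)$, meaning the matrix $\begin{bmatrix}a&b\\c&d\end{bmatrix}\in SL(2,\mathbb{R})$, with $b\neq0$, the linear canonical Dunkl transform of $f\in L^1_k(\mathbb{R})$ is $$D_k^M(f)(\lambda)=\frac{1}{(ib)^{k+1}}\int_{\mathbb{R}}f(x)\,e^{\frac i2\left(\frac db\lambda^2+\frac ab x^2\right)}E_k(-i\lambda/b,x)\,d\mu_k(x),$$ with $(ib)^{k+1}$ the principal branch. For $1<p\le2$ with conjugate exponent $q$, $D_k^M$ on $L^p_k(\mathbb{R})$ denotes the unique bounded extension $L^p_k(\mathbb{R})\to L^q_k(\mathbb{R})$ of this integral transform from $L^1_k(\mathbb{R})\cap L^p_k(\mathbb{R})$. *)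

theory Defs
  imports "HOL-Analysis.Analysis"
begin

definition SL2 :: "(real^2^2) set" where
  "SL2 = {M. det M = 1}"

definition dunkl_measure :: "real \<Rightarrow> real measure" where
  "dunkl_measure k =
     density lborel (\<lambda>x. ennreal (\<bar>x\<bar> powr (2*k + 1) / (2 powr (k + 1) * Gamma (k + 1))))"

text \<open>Real powers on \<open>[0, \<infinity>]\<close>, intended for exponents \<open>a > 0\<close> only.\<close>

definition ennpowr :: "ennreal \<Rightarrow> real \<Rightarrow> ennreal" where
  "ennpowr x a = (if x = \<infinity> then \<infinity> else ennreal (enn2real x powr a))"

text \<open>The norm of \<open>L\<^sup>p\<^sub>k\<close> for \<open>1 \<le> p < \<infinity>\<close>; it is \<open>\<infinity>\<close> for every function outside the space,
  in particular for non-measurable ones. Elements of \<open>L\<^sup>p\<^sub>k\<close> are represented by functions,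
  not by classes modulo equality almost everywhere.\<close>

definition Lk_norm :: "real \<Rightarrow> real \<Rightarrow> (real \<Rightarrow> complex) \<Rightarrow> ennreal" where
  "Lk_norm k p f =
     (if f \<in> borel_measurable (dunkl_measure k)
      then ennpowr (\<integral>\<^sup>+ x. ennreal (norm (f x) powr p) \<partial>dunkl_measure k) (1 / p)
      else \<infinity>)"

definition Lk_space :: "real \<Rightarrow> real \<Rightarrow> (real \<Rightarrow> complex) set" where
  "Lk_space k p = {f. Lk_norm k p f < \<infinity>}"

definition bessel_j :: "real \<Rightarrow> real \<Rightarrow> real" where
  "bessel_j k u =
     Gamma (k + 1) * (\<Sum>n. (-1)^n * (u / 2)^(2*n) / (fact n * Gamma (real n + k + 1)))"

text \<open>\<open>dunkl_kernel k \<xi> x\<close> stands for \<open>E\<^sub>k(-i\<xi>, x)\<close>: the factor \<open>-i\<close> is part of the definition.\<close>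

definition dunkl_kernel :: "real \<Rightarrow> real \<Rightarrow> real \<Rightarrow> complex" where
  "dunkl_kernel k \<xi> x =
     of_real (bessel_j k (\<xi> * x))
       - \<i> * of_real (\<xi> * x) / of_real (2 * (k + 1)) * of_real (bessel_j (k + 1) (\<xi> * x))"

definition lcdt_integral ::
  "real \<Rightarrow> real^2^2 \<Rightarrow> (real \<Rightarrow> complex) \<Rightarrow> real \<Rightarrow> complex" where
  "lcdt_integral k M f \<xi> =
     (let a = M$1$1; b = M$1$2; d = M$2$2 in
      1 / (\<i> * of_real b) powr of_real (k + 1) *
      (LINT x|dunkl_measure k.
         f x * exp (\<i> / 2 * of_real (d / b * \<xi>\<^sup>2 + a / b * x\<^sup>2)) * dunkl_kernel k (\<xi> / b) x))"

text \<open>\<open>T\<close> is a bounded linear operator from \<open>L\<^sup>p\<^sub>k\<close> to \<open>L\<^sup>q\<^sub>k\<close>, \<open>q = p / (p - 1)\<close>, extending the integral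
  transform from \<open>L\<^sup>1\<^sub>k \<inter> L\<^sup>p\<^sub>k\<close>. All identities hold almost everywhere; linearity together
  with the bound makes \<open>T\<close> compatible with equality almost everywhere.\<close>

definition is_lcdt_extension ::
  "real \<Rightarrow> real^2^2 \<Rightarrow> real \<Rightarrow> ((real \<Rightarrow> complex) \<Rightarrow> real \<Rightarrow> complex) \<Rightarrow> bool" where
  "is_lcdt_extension k M p T \<longleftrightarrow>
     (\<forall>f\<in>Lk_space k p. \<forall>g\<in>Lk_space k p.
        AE x in dunkl_measure k. T (\<lambda>y. f y + g y) x = T f x + T g x) \<and>
     (\<forall>f\<in>Lk_space k p. \<forall>c.
        AE x in dunkl_measure k. T (\<lambda>y. c * f y) x = c * T f x) \<and>
     (\<exists>B::real. B \<ge> 0 \<and>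
        (\<forall>f\<in>Lk_space k p. Lk_norm k (p / (p - 1)) (T f) \<le> ennreal B * Lk_norm k p f)) \<and>
     (\<forall>f\<in>Lk_space k 1 \<inter> Lk_space k p.
        AE x in dunkl_measure k. T f x = lcdt_integral k M f x)"

text \<open>The extension is unique up to equality almost everywhere, so the choice of representatives
  is immaterial.\<close>

definition lcdt ::
  "real \<Rightarrow> real^2^2 \<Rightarrow> real \<Rightarrow> (real \<Rightarrow> complex) \<Rightarrow> real \<Rightarrow> complex" where
  "lcdt k M p = (SOME T. is_lcdt_extension k M p T)"

definition C_kb :: "real \<Rightarrow> real \<Rightarrow> real" where
  "C_kb k b = 1 / \<bar>b\<bar> powr (k + 1)"

definition C_const :: "real \<Rightarrow> real \<Rightarrow> real \<Rightarrow> real \<Rightarrow> real" where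
  "C_const q1 q2 k b =
     (1 + (1 / (2 powr (k + 1) * Gamma (k + 2))) powr ((q1 - q2) / q1)
          * C_kb k b powr ((1 - 2 / q1) * q2)) powr (1 / q2)"

end

theory Submission
  imports Defs "HOL-Complex_Analysis.Conformal_Mappings"
begin

text \<open>
  On a ball of radius \<open>r\<close>, Hoelder's inequality bounds the \<open>L\<^sup>q\<^sup>2\<close> mass of the transform by its
  \<open>L\<^sup>q\<^sup>1\<close> norm, hence, by the Hausdorff--Young inequality, by the \<open>L\<^sup>p\<^sup>1\<close> norm of \<open>f\<close>; outside the ball
  the weight \<open>|x|\<^sup>s\<close> gains a factor \<open>r\<^sup>-\<^sup>s\<close>. The radius that equalizes the two norm factors
  gives the inequality.

  The Hausdorff--Young inequality is needed with its sharp interpolation constant. It comes from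
  the three lines theorem, between the bound \<open>|E\<^sub>k| \<le> 1\<close> and the \<open>L\<^sup>2\<close> contraction property.
  For the latter no inversion theory is needed: the Dunkl transform maps \<open>exp (- t x\<^sup>2 / 2)\<close> and
  \<open>x exp (- t x\<^sup>2 / 2)\<close> to multiples of the same functions with \<open>t\<close> replaced by \<open>1 / t\<close>, the Gram
  matrices of these families agree before and after the transform, and the families are dense.
\<close>


section \<open>The Dunkl kernel\<close>

text \<open>\<open>lcdt\<close> is a choice among possible extensions, so nothing is known about it
  before an extension has been built. The Hausdorff-Young inequality on L^1 therefore serves twice:
  to construct an extension, and later to bound the chosen one.

  The obstacle is that two exponents meet: the transform is the extension at p2, while its L^q1
  bound must come from p1, and the specification of \<open>lcdt\<close> only promises some bound at
  p2. Truncations of f lie in L^1, where every extension is the integral, and they carry the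
  constant for p1 over.

  Origin of \<open>C_const\<close>: the prefactor of the transform contributes the q-th power of
  \<open>C_kb\<close>, and the dilation by b contributes |b|^(2k+2), its power -2; together this is
  the power q - 2. The other factor is the measure of the unit ball. The leading 1 is the share of
  the exterior of the ball.

  Interpolation is run on a bilinear form and for functions with finite range: there the analytic
  family is a finite sum of exponentials, and holomorphy is immediate. Duality then returns the norm
  inequality.\<close>

definition bessel_coeff :: "real \<Rightarrow> nat \<Rightarrow> real" where
  "bessel_coeff k n = (-1) ^ n / (fact n * pochhammer (k + 1) n)"

text \<open>This is the hypergeometric series 0F1(; k + 1; -v). In the variable
  \<open>v = (u / 2)\<^sup>2\<close> the even series of \<open>bessel_j\<close> becomes an ordinary
  power series, open to termwise differentiation.\<close>

definition bessel_series :: "real \<Rightarrow> real \<Rightarrow> real" where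
  "bessel_series k v = (\<Sum>n. bessel_coeff k n * v ^ n)"

lemma pochhammer_Gamma_real:
  fixes k :: real
  assumes "k > -1"
  shows "Gamma (real n + k + 1) = pochhammer (k + 1) n * Gamma (k + 1)"
proof -
  have "k + 1 \<notin> \<int>\<^sub>\<le>\<^sub>0" using assms by (auto elim!: nonpos_Ints_cases)
  then have "pochhammer (k + 1) n = Gamma (k + 1 + of_nat n) / Gamma (k + 1)"
    by (rule pochhammer_Gamma)
  moreover have "Gamma (k + 1) > 0" using assms by (intro Gamma_real_pos) auto
  ultimately show ?thesis by (simp add: field_simps)
qed

text \<open>Every factor after the first exceeds 1, so the first factor decides; for n = 0 the
  product is 1. As the bound is uniform in n, the Bessel coefficients are dominated by those of the
  exponential series.\<close>

lemma pochhammer_lower_bound: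
  fixes k :: real
  assumes "k > -1"
  shows "pochhammer (k + 1) n \<ge> min 1 (k + 1)"
proof (cases n)
  case (Suc m)
  have "1 \<le> pochhammer (k + 2) m"
    unfolding pochhammer_prod using assms by (intro prod_ge_1) auto
  then have "(k + 1) * 1 \<le> (k + 1) * pochhammer (k + 2) m"
    using assms by (intro mult_left_mono) auto
  then show ?thesis using Suc by (simp add: pochhammer_rec add.assoc)
qed auto

lemma abs_bessel_coeff_le:
  assumes "k > -1"
  shows "\<bar>bessel_coeff k n\<bar> \<le> 1 / min 1 (k + 1) * (1 / fact n)"
proof -
  have "min 1 (k + 1) * fact n \<le> fact n * pochhammer (k + 1) n"
    using pochhammer_lower_bound[OF assms, of n] by (simp add: mult.commute)
  moreover have "min 1 (k + 1) > 0" using assms by auto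
  ultimately show ?thesis
    unfolding bessel_coeff_def using assms pochhammer_lower_bound[OF assms, of n]
    by (auto simp: abs_mult field_simps intro!: frac_le)
qed

lemma summable_bessel:
  assumes "k > -1"
  shows "summable (\<lambda>n. bessel_coeff k n * v ^ n)"
proof (rule summable_comparison_test')
  show "summable (\<lambda>n. 1 / min 1 (k + 1) * (\<bar>v\<bar> ^ n /\<^sub>R fact n))"
    by (intro summable_mult summable_exp_generic)
  show "norm (bessel_coeff k n * v ^ n) \<le> 1 / min 1 (k + 1) * (\<bar>v\<bar> ^ n /\<^sub>R fact n)" if "n \<ge> 0" for n
    using mult_right_mono[OF abs_bessel_coeff_le[OF assms, of n], of "\<bar>v\<bar> ^ n"]
    by (simp add: abs_mult power_abs divide_inverse mult_ac)
qed

lemma bessel_j_eq_series: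
  assumes "k > -1"
  shows "bessel_j k u = bessel_series k ((u / 2)\<^sup>2)"
proof -
  have G: "Gamma (k + 1) > 0" using assms by (intro Gamma_real_pos) auto
  have "(-1) ^ n * (u / 2) ^ (2 * n) / (fact n * Gamma (real n + k + 1))
      = 1 / Gamma (k + 1) * (bessel_coeff k n * ((u / 2)\<^sup>2) ^ n)" for n
    unfolding pochhammer_Gamma_real[OF assms] bessel_coeff_def power_mult using G by simp
  then show ?thesis
    unfolding bessel_j_def bessel_series_def
    using G suminf_mult[OF summable_bessel[OF assms, of "(u / 2)\<^sup>2"], of "1 / Gamma (k + 1)"]
    by simp
qed

lemma bessel_coeff_diffs:
  assumes "k > -1"
  shows "diffs (bessel_coeff k) n = - (bessel_coeff (k + 1) n / (k + 1))"
proof -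
  have "k + 1 + 1 = k + (2::real)" by simp
  moreover have "pochhammer (k + 2) n > 0" using assms by (intro pochhammer_pos) auto
  ultimately show ?thesis using assms
    unfolding diffs_def bessel_coeff_def pochhammer_rec fact_Suc
    by (simp add: divide_simps add.assoc)
qed

lemma bessel_series_deriv:
  assumes "k > -1"
  shows "(bessel_series k has_real_derivative - (bessel_series (k + 1) v / (k + 1))) (at v)"
proof -
  have "((\<lambda>v. \<Sum>n. bessel_coeff k n * v ^ n) has_real_derivative
          (\<Sum>n. diffs (bessel_coeff k) n * v ^ n)) (at v)"
    by (rule termdiffs_strong_converges_everywhere) (rule summable_bessel[OF assms])
  moreover have "(\<Sum>n. diffs (bessel_coeff k) n * v ^ n) = - (bessel_series (k + 1) v / (k + 1))"
  proof -
    have "(\<lambda>n. bessel_coeff (k + 1) n * v ^ n) sums bessel_series (k + 1) v"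
      unfolding bessel_series_def using assms by (intro summable_sums summable_bessel) auto
    then have "(\<lambda>n. - (1 / (k + 1)) * (bessel_coeff (k + 1) n * v ^ n)) sums
        (- (1 / (k + 1)) * bessel_series (k + 1) v)"
      by (rule sums_mult)
    then show ?thesis
      unfolding bessel_coeff_diffs[OF assms] by (simp add: sums_iff)
  qed
  ultimately show ?thesis by (simp add: bessel_series_def[abs_def])
qed

text \<open>Passing from order k + 1 to order k multiplies the n-th coefficient by 1 + n / (k + 1).
  The factor n comes from v times the derivative, and that derivative is a multiple of the series of
  order k + 2.\<close>

lemma bessel_series_contiguous:
  assumes "k > -1"
  shows "bessel_series k v =
    bessel_series (k + 1) v - v / (k + 1) * (bessel_series (k + 2) v / (k + 2))"
proof -
  have k1: "k + 1 > -1" using assms by simp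
  let ?c = "bessel_coeff (k + 1)"
  have s1: "(\<lambda>n. ?c n * v ^ n) sums bessel_series (k + 1) v"
    unfolding bessel_series_def by (intro summable_sums summable_bessel k1)
  have "summable (\<lambda>n. diffs ?c n * v ^ n)"
    by (rule termdiff_converges_all) (rule summable_bessel[OF k1])
  then have "(\<lambda>n. of_nat n * ?c n * v ^ (n - Suc 0)) sums (\<Sum>n. diffs ?c n * v ^ n)"
    by (rule diffs_equiv)
  moreover have "(\<Sum>n. diffs ?c n * v ^ n) = - (bessel_series (k + 2) v / (k + 2))"
  proof -
    have "((\<lambda>v. \<Sum>n. ?c n * v ^ n) has_real_derivative (\<Sum>n. diffs ?c n * v ^ n)) (at v)"
      by (rule termdiffs_strong_converges_everywhere) (rule summable_bessel[OF k1])
    from DERIV_unique[OF this] bessel_series_deriv[OF k1, of v] show ?thesis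
      by (simp add: bessel_series_def[abs_def] add.assoc)
  qed
  ultimately have "(\<lambda>n. v / (k + 1) * (of_nat n * ?c n * v ^ (n - Suc 0))) sums
      (v / (k + 1) * - (bessel_series (k + 2) v / (k + 2)))"
    by (intro sums_mult) simp
  from sums_add[OF s1 this]
  have s: "(\<lambda>n. ?c n * v ^ n + v / (k + 1) * (of_nat n * ?c n * v ^ (n - Suc 0))) sums
     (bessel_series (k + 1) v - v / (k + 1) * (bessel_series (k + 2) v / (k + 2)))"
    by simp
  have "?c n * v ^ n + v / (k + 1) * (of_nat n * ?c n * v ^ (n - Suc 0)) =
      bessel_coeff k n * v ^ n" for n
  proof -
    have "?c n + real n / (k + 1) * ?c n = bessel_coeff k n"
    proof -
      have p: "pochhammer (k + 1) n > 0" "pochhammer (k + 1 + 1) n > 0"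
        using assms by (auto intro!: pochhammer_pos)
      have "(k + 1) * pochhammer (k + 1 + 1) n = pochhammer (k + 1) n * (k + 1 + real n)"
        using pochhammer_rec[of "k + 1" n] pochhammer_rec'[of "k + 1" n] by (simp add: mult_ac)
      then have "pochhammer (k + 1 + 1) n = pochhammer (k + 1) n * (k + 1 + real n) / (k + 1)"
        using assms by (simp add: field_simps)
      moreover have "k + 1 + real n > 0" using assms by linarith
      ultimately show ?thesis using p assms unfolding bessel_coeff_def
        by (simp add: divide_simps) (simp add: algebra_simps)
    qed
    \<comment> \<open>At n = 0 the truncated exponent spoils the power, but the factor n vanishes
      there; hence the disjunction in the next step.\<close>
    moreover have "v * (of_nat n * v ^ (n - Suc 0)) = of_nat n * v ^ n"
      by (cases n) auto
    then have "v * v ^ (n - Suc 0) = v ^ n \<or> n = 0"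
      by auto
    then have "v / (k + 1) * (of_nat n * ?c n * v ^ (n - Suc 0)) = real n / (k + 1) * ?c n * v ^ n"
      by (auto simp: field_simps)
    ultimately show ?thesis by (metis distrib_right)
  qed
  with s show ?thesis by (simp add: sums_iff bessel_series_def)
qed

section \<open>The normalized Bessel function and the bound of the kernel\<close>

lemma bessel_j_0: "k > -1 \<Longrightarrow> bessel_j k 0 = 1"
  using powser_sums_zero[of "bessel_coeff k"]
  by (simp add: bessel_j_eq_series bessel_series_def sums_iff bessel_coeff_def)

lemma bessel_j_deriv:
  assumes "k > -1"
  shows "(bessel_j k has_real_derivative - (u / (2 * (k + 1)) * bessel_j (k + 1) u)) (at u)"
proof -
  have "((\<lambda>u. bessel_series k ((u / 2)\<^sup>2)) has_real_derivative
     - (bessel_series (k + 1) ((u / 2)\<^sup>2) / (k + 1)) * (u / 2)) (at u)"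
    by (rule DERIV_chain2[where f = "bessel_series k", OF bessel_series_deriv[OF assms]])
      (auto intro!: derivative_eq_intros)
  moreover have "bessel_j k = (\<lambda>u. bessel_series k ((u / 2)\<^sup>2))"
    using assms by (auto simp: bessel_j_eq_series)
  ultimately show ?thesis using assms by (simp add: bessel_j_eq_series field_simps)
qed

lemma bessel_j_contiguous:
  assumes "k > -1"
  shows "bessel_j k u =
    bessel_j (k + 1) u - u\<^sup>2 / (2 * (k + 1)) * (bessel_j (k + 2) u / (2 * (k + 2)))"
proof -
  have "u\<^sup>2 / (2 * (k + 1)) * (X / (2 * (k + 2))) = (u / 2)\<^sup>2 / (k + 1) * (X / (k + 2))" for X
    by (simp add: power_divide field_simps)
  then show ?thesis
    using assms bessel_series_contiguous[of k "(u / 2)\<^sup>2"] by (simp add: bessel_j_eq_series)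
qed

lemma continuous_bessel_j [continuous_intros]:
  assumes "k > -1" "continuous_on S f"
  shows "continuous_on S (\<lambda>x. bessel_j k (f x))"
proof -
  have "continuous_on UNIV (bessel_j k)"
    using bessel_j_deriv[OF assms(1)] by (auto intro!: DERIV_continuous_on)
  then show ?thesis using assms(2) by (rule continuous_on_compose2) auto
qed

lemma bessel_j_minus: "k > -1 \<Longrightarrow> bessel_j k (- u) = bessel_j k u"
  by (simp add: bessel_j_eq_series)

text \<open>With \<open>h = - j'\<close>, Bessel's equation gives
  \<open>(j\<^sup>2 + h\<^sup>2)' = - 2 (2 k + 1) h\<^sup>2 / u\<close>, so \<open>j\<^sup>2 + h\<^sup>2\<close> decreases from its value \<open>1\<close> at \<open>0\<close>.\<close>

lemma bessel_j_energy_le_1: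
  assumes k: "k \<ge> - 1 / 2"
  shows "(bessel_j k u)\<^sup>2 + (u / (2 * (k + 1)) * bessel_j (k + 1) u)\<^sup>2 \<le> 1"
proof -
  have k1: "k > -1" "k + 1 > -1" using k by auto
  define h where "h = (\<lambda>u. u / (2 * (k + 1)) * bessel_j (k + 1) u)"
  define W where "W = (\<lambda>u. (bessel_j k u)\<^sup>2 + (h u)\<^sup>2)"
  \<comment> \<open>The product rule brings in the order k + 2; the contiguous relation trades it
    for the order k. This is Bessel's equation in first-order form.\<close>
  have dh: "(h has_real_derivative
      bessel_j k v - (2 * k + 1) / (2 * (k + 1)) * bessel_j (k + 1) v) (at v)" for v
  proof -
    have "(h has_real_derivative 1 / (2 * (k + 1)) * bessel_j (k + 1) v
        + v / (2 * (k + 1)) * - (v / (2 * (k + 1 + 1)) * bessel_j (k + 1 + 1) v)) (at v)"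
    proof -
      have "((\<lambda>u. u / (2 * (k + 1))) has_real_derivative 1 / (2 * (k + 1))) (at v)"
        by (intro DERIV_cdivide DERIV_ident)
      from DERIV_mult[OF this bessel_j_deriv[OF k1(2)]] show ?thesis
        unfolding h_def by (simp only: mult.commute)
    qed
    moreover have "1 / (2 * (k + 1)) * bessel_j (k + 1) v
        + v / (2 * (k + 1)) * - (v / (2 * (k + 1 + 1)) * bessel_j (k + 1 + 1) v)
        = bessel_j k v - (2 * k + 1) / (2 * (k + 1)) * bessel_j (k + 1) v"
    proof -
      have "1 / p * A + v / p * - (v / q * B) = A - v\<^sup>2 / p * (B / q) - (p - 1) / p * A"
        if "p \<noteq> 0" "q \<noteq> 0" for p q A B :: real
        using that by (simp add: divide_simps) (simp add: algebra_simps power2_eq_square)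
      from this[of "2 * (k + 1)" "2 * (k + 2)" "bessel_j (k + 1) v" "bessel_j (k + 2) v"] k1
      show ?thesis
        unfolding bessel_j_contiguous[OF k1(1), of v] by (simp add: add.assoc)
    qed
    ultimately show ?thesis by simp
  qed
  \<comment> \<open>The quotient h / v is written as
    \<open>bessel_j (k + 1) v / (2 * (k + 1))\<close>, so that the formula also covers v =
    0.\<close>
  have dW: "(W has_real_derivative - 2 * (2 * k + 1) * v * (bessel_j (k + 1) v / (2 * (k + 1)))\<^sup>2) (at v)"
    for v
  proof -
    have dj: "(bessel_j k has_real_derivative - h v) (at v)"
      using bessel_j_deriv[OF k1(1)] by (simp add: h_def)
    have "(W has_real_derivative 2 * bessel_j k v * - h v
        + 2 * h v * (bessel_j k v - (2 * k + 1) / (2 * (k + 1)) * bessel_j (k + 1) v)) (at v)"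
      unfolding W_def by (auto intro!: derivative_eq_intros dj dh)
    then show ?thesis
      by (rule DERIV_cong) (simp add: h_def algebra_simps power2_eq_square diff_divide_distrib add_divide_distrib)
  qed
  have pos: "W v \<le> 1" if "v \<ge> 0" for v
  proof -
    have "W v \<le> W 0"
    proof (rule DERIV_nonpos_imp_nonincreasing[OF that])
      fix x assume "0 \<le> x" "x \<le> v"
      \<comment> \<open>The sign is that of -(2k + 1): here k \<ge> -1/2 enters.\<close>
      then show "\<exists>y. (W has_real_derivative y) (at x) \<and> y \<le> 0"
        using k by (intro exI[of _ "- 2 * (2 * k + 1) * x * (bessel_j (k + 1) x / (2 * (k + 1)))\<^sup>2"] conjI dW)
          (auto intro!: mult_nonpos_nonneg)
    qed
    then show ?thesis by (simp add: W_def h_def bessel_j_0 k1)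
  qed
  have "W u = W \<bar>u\<bar>" using k1 by (auto simp: W_def h_def abs_if bessel_j_minus)
  with pos[of "\<bar>u\<bar>"] show ?thesis by (simp add: W_def h_def)
qed

text \<open>The real and imaginary parts of the kernel are \<open>bessel_j k\<close> and its
  derivative at \<xi> x, so the squared modulus is the energy bounded above.\<close>

lemma norm_dunkl_kernel_le_1:
  assumes "k \<ge> - 1 / 2"
  shows "norm (dunkl_kernel k \<xi> x) \<le> 1"
proof -
  let ?u = "\<xi> * x"
  have "dunkl_kernel k \<xi> x
     = Complex (bessel_j k ?u) (- (?u / (2 * (k + 1)) * bessel_j (k + 1) ?u))"
    unfolding dunkl_kernel_def by (simp add: complex_eq_iff Re_divide_of_real Im_divide_of_real)
  then have "(norm (dunkl_kernel k \<xi> x))\<^sup>2 \<le> 1"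
    using bessel_j_energy_le_1[OF assms, of ?u] by (simp add: cmod_power2)
  then show ?thesis by (simp add: power2_le_imp_le abs_square_le_1)
qed

lemma continuous_dunkl_kernel [continuous_intros]:
  assumes "k > -1" "continuous_on S f" "continuous_on S g"
  shows "continuous_on S (\<lambda>x. dunkl_kernel k (f x) (g x))"
proof -
  have "2 * (k + 1) \<noteq> 0" using assms(1) by simp
  then have "complex_of_real (2 * (k + 1)) \<noteq> 0" unfolding of_real_eq_0_iff .
  then show ?thesis
    unfolding dunkl_kernel_def using assms by (intro continuous_intros) auto
qed

lemma borel_measurable_dunkl_kernel [measurable]:
  assumes k: "k > -1" and [measurable]: "f \<in> borel_measurable M" "g \<in> borel_measurable M"
  shows "(\<lambda>x. dunkl_kernel k (f x) (g x)) \<in> borel_measurable M"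
proof -
  have "(\<lambda>u. dunkl_kernel k 1 u) \<in> borel_measurable borel"
    using k by (intro borel_measurable_continuous_onI continuous_intros) auto
  moreover have "dunkl_kernel k (f x) (g x) = dunkl_kernel k 1 (f x * g x)" for x
    by (simp add: dunkl_kernel_def)
  ultimately show ?thesis by simp
qed

section \<open>The weighted measure\<close>

abbreviation dunkl_mu :: "real \<Rightarrow> real measure" ("\<mu>") where
  "\<mu> \<equiv> dunkl_measure"

definition dunkl_weight :: "real \<Rightarrow> real \<Rightarrow> real" where
  "dunkl_weight k x = \<bar>x\<bar> powr (2*k + 1) / (2 powr (k + 1) * Gamma (k + 1))"

lemma dunkl_measure_eq: "\<mu> k = density lborel (\<lambda>x. ennreal (dunkl_weight k x))"
  by (simp add: dunkl_measure_def dunkl_weight_def)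

lemma sets_dunkl_measure [simp, measurable_cong]: "sets (\<mu> k) = sets borel"
  by (simp add: dunkl_measure_def)

lemma space_dunkl_measure [simp]: "space (\<mu> k) = UNIV"
  by (simp add: dunkl_measure_def)

lemma borel_measurable_dunkl_measure_iff [simp]:
  "borel_measurable (\<mu> k) = borel_measurable borel"
  by (intro measurable_cong_sets) simp_all

lemma measurable_dunkl_weight [measurable]: "dunkl_weight k \<in> borel_measurable borel"
  unfolding dunkl_weight_def[abs_def] by measurable

lemma dunkl_weight_nonneg: "k > -1 \<Longrightarrow> dunkl_weight k x \<ge> 0"
  using Gamma_real_pos[of "k + 1"] by (simp add: dunkl_weight_def)

lemma sigma_finite_dunkl_measure: "sigma_finite_measure (\<mu> k)"
  unfolding dunkl_measure_eq
  by (subst sigma_finite_measure.sigma_finite_iff_density_finite[OF sigma_finite_lborel]) auto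

lemma AE_dunkl_measureI:
  assumes "AE x in lborel. P x"
  shows "AE x in \<mu> k. P x"
  using assms unfolding dunkl_measure_eq by (subst AE_density) auto

lemma AE_dunkl_neq_0: "AE x in \<mu> k. x \<noteq> 0"
  by (rule AE_dunkl_measureI[OF AE_lborel_singleton])

lemma nn_integral_dunkl_measure:
  assumes "f \<in> borel_measurable borel"
  shows "(\<integral>\<^sup>+x. f x \<partial>\<mu> k) = (\<integral>\<^sup>+x. ennreal (dunkl_weight k x) * f x \<partial>lborel)"
  unfolding dunkl_measure_eq using assms by (subst nn_integral_density) auto

text \<open>The weight is even and homogeneous of degree 2k + 1; Lebesgue measure adds one more
  power of |b|.\<close>

lemma nn_integral_dunkl_scale:
  assumes [measurable]: "f \<in> borel_measurable borel" and k: "k > -1" and b: "b \<noteq> 0"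
  shows "(\<integral>\<^sup>+x. f (x / b) \<partial>\<mu> k)
    = ennreal (\<bar>b\<bar> powr (2 * k + 2)) * (\<integral>\<^sup>+x. f x \<partial>\<mu> k)"
proof -
  have w: "dunkl_weight k (b * x) = \<bar>b\<bar> powr (2 * k + 1) * dunkl_weight k x" for x
    using b by (simp add: dunkl_weight_def abs_mult powr_mult)
  have "(\<integral>\<^sup>+x. f (x / b) \<partial>\<mu> k)
      = \<bar>b\<bar> * (\<integral>\<^sup>+x. ennreal (dunkl_weight k (0 + b * x)) * f ((0 + b * x) / b) \<partial>lborel)"
    using b by (subst nn_integral_dunkl_measure, measurable, subst nn_integral_real_affine[of _ b 0]) auto
  also have "\<dots> = \<bar>b\<bar> * (\<integral>\<^sup>+x. ennreal (\<bar>b\<bar> powr (2 * k + 1)) * (ennreal (dunkl_weight k x) * f x) \<partial>lborel)"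
    using b by (simp add: w ennreal_mult dunkl_weight_nonneg k mult.assoc)
  also have "\<dots> = (ennreal \<bar>b\<bar> * ennreal (\<bar>b\<bar> powr (2 * k + 1))) * (\<integral>\<^sup>+x. ennreal (dunkl_weight k x) * f x \<partial>lborel)"
    by (subst nn_integral_cmult) (auto simp: mult.assoc)
  also have "ennreal \<bar>b\<bar> * ennreal (\<bar>b\<bar> powr (2 * k + 1)) = ennreal (\<bar>b\<bar> powr (2 * k + 2))"
    using b powr_add[of "\<bar>b\<bar>" 1 "2 * k + 1"] by (simp add: ennreal_mult' [symmetric] add_ac)
  finally show ?thesis by (subst nn_integral_dunkl_measure) auto
qed

lemma integral_dunkl_odd:
  fixes f :: "real \<Rightarrow> 'a :: {banach, second_countable_topology}"
  assumes k: "k > -1" and odd: "\<And>x. f (- x) = - f x" and [measurable]: "f \<in> borel_measurable borel"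
  shows "(LINT x|\<mu> k. f x) = 0"
proof -
  have "(LINT x|\<mu> k. f x) = (LINT x|lborel. dunkl_weight k x *\<^sub>R f x)"
    unfolding dunkl_measure_eq using k by (subst integral_density) (auto simp: dunkl_weight_nonneg)
  moreover have "(LINT x|lborel. dunkl_weight k x *\<^sub>R f x)
      = - (LINT x|lborel. dunkl_weight k x *\<^sub>R f x)"
    using lborel_integral_real_affine[of "-1" "\<lambda>x. dunkl_weight k x *\<^sub>R f x" 0]
    by (simp add: odd dunkl_weight_def)
  ultimately show ?thesis
    by (metis add_eq_0_iff scaleR_half_double scaleR_zero_right)
qed

text \<open>Two half lines contribute 2 / (2k + 2), and the division by k + 1 raises Gamma (k + 1)
  to Gamma (k + 2). This is the ball constant inside \<open>C_const\<close>.\<close>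

lemma emeasure_dunkl_ball:
  assumes k: "k > -1" and r: "r \<ge> 0"
  shows "emeasure (\<mu> k) {-r..r} = ennreal (r powr (2 * k + 2) / (2 powr (k + 1) * Gamma (k + 2)))"
proof -
  define c where "c = 1 / (2 powr (k + 1) * Gamma (k + 1))"
  have G: "Gamma (k + 1) > 0" using k by (intro Gamma_real_pos) auto
  have c: "c > 0" using G by (simp add: c_def)
  define g where "g = (\<lambda>x::real. ennreal (indicator {0..r} x * x powr (2 * k + 1)))"
  have g: "(\<integral>\<^sup>+x. g x \<partial>lborel) = ennreal (r powr (2 * k + 2) / (2 * k + 2))"
    using nn_integral_has_integral_lebesgue[OF _ has_integral_powr_from_0[of "2 * k + 1" r]] k r
    by (simp add: g_def add_ac)
  have [measurable]: "g \<in> borel_measurable borel" unfolding g_def by measurable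
  have "emeasure (\<mu> k) {-r..r} = (\<integral>\<^sup>+x. indicator {-r..r} x \<partial>\<mu> k)"
    by simp
  also have "\<dots> = (\<integral>\<^sup>+x. ennreal (dunkl_weight k x) * indicator {-r..r} x \<partial>lborel)"
    by (intro nn_integral_dunkl_measure) auto
  \<comment> \<open>The integral is folded onto the half line by reflection; the point 0, common to
    both halves, is discarded as a null set.\<close>
  also have "\<dots> = (\<integral>\<^sup>+x. ennreal c * (g x + g (0 + -1 * x)) \<partial>lborel)"
  proof (rule nn_integral_cong_AE)
    show "AE x in lborel. ennreal (dunkl_weight k x) * indicator {-r..r} x = ennreal c * (g x + g (0 + -1 * x))"
      using AE_lborel_singleton[of 0]
    proof eventually_elim
      case (elim x)
      then show ?case using c
        by (cases "x > 0") (auto simp: g_def c_def dunkl_weight_def indicator_def ennreal_mult'[symmetric])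
    qed
  qed
  also have "\<dots> = ennreal c * ((\<integral>\<^sup>+x. g x \<partial>lborel) + (\<integral>\<^sup>+x. g (0 + -1 * x) \<partial>lborel))"
    by (subst nn_integral_cmult, measurable, subst nn_integral_add, measurable)
  also have "(\<integral>\<^sup>+x. g (0 + -1 * x) \<partial>lborel) = (\<integral>\<^sup>+x. g x \<partial>lborel)"
    using nn_integral_real_affine[of g "-1" 0] by simp
  also have "ennreal c * ((\<integral>\<^sup>+x. g x \<partial>lborel) + (\<integral>\<^sup>+x. g x \<partial>lborel))
      = ennreal (c * (r powr (2 * k + 2) / (2 * k + 2) * 2))"
    unfolding g using c k by (simp add: ennreal_mult'[symmetric] ennreal_plus[symmetric] del: ennreal_plus)
  also have "c * (r powr (2 * k + 2) / (2 * k + 2) * 2) = r powr (2 * k + 2) / (2 powr (k + 1) * Gamma (k + 2))"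
  proof -
    have "Gamma (k + 1 + 1) = (k + 1) * Gamma (k + 1)"
      using k by (intro Gamma_plus1) (auto elim!: nonpos_Ints_cases)
    then have "Gamma (k + 2) = (k + 1) * Gamma (k + 1)" by (simp add: add.assoc)
    then show ?thesis using k G by (simp add: c_def divide_simps)
  qed
  finally show ?thesis .
qed

section \<open>Gaussians\<close>

text \<open>The substitution \<open>u = t * x\<^sup>2 / 2\<close> leads to Euler's integral for
  \<open>Gamma a\<close>. It is performed on bounded intervals, and monotone convergence removes the
  cutoff.\<close>

lemma nn_integral_gaussian_half_line:
  assumes a: "a > 0" and t: "t > 0"
  shows "(\<integral>\<^sup>+x. ennreal (indicator {0..} x * (x powr (2 * a - 1) * exp (- (t * x\<^sup>2 / 2)))) \<partial>lborel)
    = ennreal ((2 / t) powr a * Gamma a / 2)"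
proof -
  define f where "f = (\<lambda>u::real. ennreal (indicator {0..} u * (u powr (a - 1) / exp u)))"
  have [measurable]: "f \<in> borel_measurable borel" unfolding f_def by measurable
  define h where "h = (\<lambda>x::real. ennreal (indicator {0..} x * (x powr (2 * a - 1) * exp (- (t * x\<^sup>2 / 2)))))"
  have [measurable]: "h \<in> borel_measurable borel" unfolding h_def by measurable
  \<comment> \<open>The constant left over by the substitution: f(u) du becomes C h(x) dx for x >
    0.\<close>
  define C where "C = 2 * (t / 2) powr a"
  have C: "C > 0" using t by (simp add: C_def)
  have fh: "f (t * x\<^sup>2 / 2) * ennreal (t * x) * indicator {0..r} x = ennreal C * (h x * indicator {0..r} x)"
    if "r \<ge> 0" for x r
  proof (cases "x > 0")
    case True
    have "(t * x\<^sup>2 / 2) powr (a - 1) * (t * x) = C * x powr (2 * a - 1)"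
    proof -
      have "(t * x\<^sup>2 / 2) powr (a - 1) = (t / 2) powr (a - 1) * (x powr 2) powr (a - 1)"
        using t True by (simp add: powr_mult powr_divide powr_realpow[symmetric] del: powr_numeral)
      also have "(x powr 2) powr (a - 1) = x powr (2 * a - 2)"
        unfolding powr_powr by (simp add: algebra_simps)
      finally have "(t * x\<^sup>2 / 2) powr (a - 1) * (t * x) = (t / 2) powr (a - 1) * t * (x powr (2 * a - 2) * x powr 1)"
        using True by simp
      also have "\<dots> = (t / 2) powr (a - 1) * t * x powr (2 * a - 1)"
        unfolding powr_add[symmetric] by (simp add: algebra_simps)
      also have "(t / 2) powr (a - 1) * t = C"
        using t by (simp add: C_def powr_diff)
      finally show ?thesis .
    qed
    then show ?thesis using True t C that
      by (auto simp: f_def h_def indicator_def ennreal_mult'[symmetric] exp_minus field_simps)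
  next
    case False
    then show ?thesis by (auto simp: f_def h_def indicator_def not_less antisym_conv1)
  qed
  have step: "(\<integral>\<^sup>+u. f u * indicator {0..t * r\<^sup>2 / 2} u \<partial>lborel) = ennreal C * (\<integral>\<^sup>+x. h x * indicator {0..r} x \<partial>lborel)"
    if r: "r \<ge> 0" for r
  proof -
    let ?F = "\<lambda>u. indicator {0..} u * (u powr (a - 1) / exp u)"
    have "(\<integral>\<^sup>+u. f u * indicator {t * 0\<^sup>2 / 2..t * r\<^sup>2 / 2} u \<partial>lborel)
      = (\<integral>\<^sup>+u. ennreal (?F u * indicator {t * 0\<^sup>2 / 2..t * r\<^sup>2 / 2} u) \<partial>lborel)"
      by (intro nn_integral_cong) (auto simp: f_def indicator_def)
    also have "\<dots> = (\<integral>\<^sup>+x. ennreal (?F (t * x\<^sup>2 / 2) * (t * x) * indicator {0..r} x) \<partial>lborel)"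
      using t r
      by (intro nn_integral_substitution[where g = "\<lambda>x. t * x\<^sup>2 / 2"])
        (auto intro!: derivative_eq_intros continuous_intros simp: set_borel_measurable_def)
    also have "\<dots> = (\<integral>\<^sup>+x. f (t * x\<^sup>2 / 2) * ennreal (t * x) * indicator {0..r} x \<partial>lborel)"
      using t by (intro nn_integral_cong) (auto simp: f_def indicator_def ennreal_mult'[symmetric])
    also have "\<dots> = (\<integral>\<^sup>+x. ennreal C * (h x * indicator {0..r} x) \<partial>lborel)"
      using fh[OF r] by simp
    also have "\<dots> = ennreal C * (\<integral>\<^sup>+x. h x * indicator {0..r} x \<partial>lborel)"
      by (subst nn_integral_cmult) auto
    finally show ?thesis by simp
  qed
  have lim: "(\<lambda>n. \<integral>\<^sup>+x. g x * indicator {0..R n} x \<partial>lborel) \<longlonglongrightarrow> (\<integral>\<^sup>+x. g x \<partial>lborel)"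
    if [measurable]: "g \<in> borel_measurable borel" and g0: "\<And>x. x < 0 \<Longrightarrow> g x = 0"
      and R: "incseq R" "filterlim R at_top sequentially"
    for g :: "real \<Rightarrow> ennreal" and R :: "nat \<Rightarrow> real"
  proof (rule nn_integral_LIMSEQ)
    show "incseq (\<lambda>n x. g x * indicator {0..R n} x)"
      using R(1) by (auto simp: incseq_def le_fun_def indicator_def intro: order_trans)
    fix x
    have "eventually (\<lambda>n. x \<le> R n) sequentially"
      using R(2) by (simp add: filterlim_at_top)
    then have "eventually (\<lambda>n. g x = g x * indicator {0..R n} x) sequentially"
      by eventually_elim (use g0[of x] in \<open>auto simp: indicator_def\<close>)
    then show "(\<lambda>n. g x * indicator {0..R n} x) \<longlonglongrightarrow> g x"
      by (rule tendsto_eventually[OF eventually_mono]) auto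
  qed auto
  have "(\<lambda>n. \<integral>\<^sup>+u. f u * indicator {0..t * (real n)\<^sup>2 / 2} u \<partial>lborel) \<longlonglongrightarrow> (\<integral>\<^sup>+u. f u \<partial>lborel)"
  proof (rule lim)
    show "incseq (\<lambda>n. t * (real n)\<^sup>2 / 2)"
      using t by (auto simp: incseq_def intro!: mult_left_mono power_mono)
    have "filterlim (\<lambda>n. t / 2 * (real n)\<^sup>2) at_top sequentially"
      using t by (intro filterlim_tendsto_pos_mult_at_top[OF tendsto_const] filterlim_pow_at_top
          filterlim_real_sequentially) auto
    then show "filterlim (\<lambda>n. t * (real n)\<^sup>2 / 2) at_top sequentially" by simp
  qed (auto simp: f_def)
  moreover have "(\<lambda>n. ennreal C * (\<integral>\<^sup>+x. h x * indicator {0..real n} x \<partial>lborel)) \<longlonglongrightarrow> ennreal C * (\<integral>\<^sup>+u. h u \<partial>lborel)"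
    by (intro ennreal_tendsto_cmult lim) (auto simp: h_def incseq_def filterlim_real_sequentially)
  ultimately have "(\<integral>\<^sup>+u. f u \<partial>lborel) = ennreal C * (\<integral>\<^sup>+u. h u \<partial>lborel)"
    by (simp add: step LIMSEQ_unique)
  moreover have "(\<integral>\<^sup>+u. f u \<partial>lborel) = ennreal (Gamma a)"
    unfolding f_def using Gamma_conv_nn_integral_real[OF a] by simp
  ultimately have e: "ennreal C * (\<integral>\<^sup>+u. h u \<partial>lborel) = ennreal (Gamma a)" by simp
  have "(\<integral>\<^sup>+u. h u \<partial>lborel) = ennreal (1 / C) * (ennreal C * (\<integral>\<^sup>+u. h u \<partial>lborel))"
    using C by (simp add: mult.assoc[symmetric] ennreal_mult'[symmetric])
  also have "\<dots> = ennreal (Gamma a / C)"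
    unfolding e using C Gamma_real_pos[OF a] by (simp add: ennreal_mult'[symmetric])
  also have "Gamma a / C = (2 / t) powr a * Gamma a / 2"
    using t by (simp add: C_def powr_divide mult.commute)
  finally show ?thesis by (simp add: h_def)
qed

text \<open>Evenness reduces to the half line with \<open>a = k + 1 + n\<close>, and Gamma (k + 1)
  from the weight turns the Gamma quotient into a Pochhammer symbol. For n = 0 and t = 1 the value
  is 1: the normalization of the measure is the one that gives exp(-x^2/2) mass 1.\<close>

lemma nn_integral_dunkl_gaussian:
  assumes k: "k > -1" and t: "t > 0"
  shows "(\<integral>\<^sup>+x. ennreal (x ^ (2 * n) * exp (- (t * x\<^sup>2 / 2))) \<partial>\<mu> k)
    = ennreal ((2 / t) ^ n * pochhammer (k + 1) n * t powr (- (k + 1)))"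
proof -
  define c where "c = 1 / (2 powr (k + 1) * Gamma (k + 1))"
  have G: "Gamma (k + 1) > 0" using k by (intro Gamma_real_pos) auto
  have c: "c > 0" using G by (simp add: c_def)
  define a where "a = k + 1 + real n"
  have a: "a > 0" using k by (simp add: a_def)
  define g where "g = (\<lambda>x::real. ennreal (indicator {0..} x * (x powr (2 * a - 1) * exp (- (t * x\<^sup>2 / 2)))))"
  have [measurable]: "g \<in> borel_measurable borel" unfolding g_def by measurable
  have g: "(\<integral>\<^sup>+x. g x \<partial>lborel) = ennreal ((2 / t) powr a * Gamma a / 2)"
    unfolding g_def by (rule nn_integral_gaussian_half_line[OF a t])
  have "(\<integral>\<^sup>+x. ennreal (x ^ (2 * n) * exp (- (t * x\<^sup>2 / 2))) \<partial>\<mu> k)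
      = (\<integral>\<^sup>+x. ennreal (dunkl_weight k x) * ennreal (x ^ (2 * n) * exp (- (t * x\<^sup>2 / 2))) \<partial>lborel)"
    by (intro nn_integral_dunkl_measure) auto
  also have "\<dots> = (\<integral>\<^sup>+x. ennreal c * (g x + g (0 + -1 * x)) \<partial>lborel)"
  proof (rule nn_integral_cong_AE)
    show "AE x in lborel. ennreal (dunkl_weight k x) * ennreal (x ^ (2 * n) * exp (- (t * x\<^sup>2 / 2)))
        = ennreal c * (g x + g (0 + -1 * x))"
      using AE_lborel_singleton[of 0]
    proof eventually_elim
      case (elim x)
      have "x ^ (2 * n) = \<bar>x\<bar> ^ (2 * n)" by (simp add: power_mult)
      also have "\<dots> = \<bar>x\<bar> powr (2 * real n)" using elim by (simp add: powr_realpow[symmetric])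
      finally have "\<bar>x\<bar> powr (2 * k + 1) * x ^ (2 * n) = \<bar>x\<bar> powr (2 * a - 1)"
        by (simp add: powr_add[symmetric] a_def algebra_simps)
      then have "dunkl_weight k x * (x ^ (2 * n) * exp (- (t * x\<^sup>2 / 2)))
          = c * (\<bar>x\<bar> powr (2 * a - 1) * exp (- (t * x\<^sup>2 / 2)))"
        by (simp add: dunkl_weight_def c_def)
      moreover have "g x + g (0 + -1 * x) = ennreal (\<bar>x\<bar> powr (2 * a - 1) * exp (- (t * x\<^sup>2 / 2)))"
        using elim by (cases "x > 0") (auto simp: g_def)
      ultimately show ?case using c k
        by (simp add: ennreal_mult'[symmetric] dunkl_weight_nonneg)
    qed
  qed
  also have "\<dots> = ennreal c * ((\<integral>\<^sup>+x. g x \<partial>lborel) + (\<integral>\<^sup>+x. g (0 + -1 * x) \<partial>lborel))"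
    by (subst nn_integral_cmult, measurable, subst nn_integral_add, measurable)
  also have "(\<integral>\<^sup>+x. g (0 + -1 * x) \<partial>lborel) = (\<integral>\<^sup>+x. g x \<partial>lborel)"
    using nn_integral_real_affine[of g "-1" 0] by simp
  also have "ennreal c * ((\<integral>\<^sup>+x. g x \<partial>lborel) + (\<integral>\<^sup>+x. g x \<partial>lborel))
      = ennreal (c * ((2 / t) powr a * Gamma a))"
    unfolding g using c Gamma_real_pos[OF a] t
    by (simp add: ennreal_mult'[symmetric] ennreal_plus[symmetric] del: ennreal_plus)
  also have "c * ((2 / t) powr a * Gamma a) = (2 / t) ^ n * pochhammer (k + 1) n * t powr (- (k + 1))"
  proof -
    have "Gamma a = pochhammer (k + 1) n * Gamma (k + 1)"
      using pochhammer_Gamma_real[OF k, of n] by (simp add: a_def add_ac)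
    moreover have "(2 / t) powr a = 2 powr (k + 1) * t powr (- (k + 1)) * (2 / t) ^ n"
      using t by (simp add: a_def powr_add powr_realpow powr_divide powr_minus divide_inverse powr_mult inverse_powr powr_diff power_inverse)
    ultimately show ?thesis using G by (simp add: c_def)
  qed
  finally show ?thesis .
qed

section \<open>The Dunkl transform and its isometry on Gaussians\<close>

definition dunkl_transform :: "real \<Rightarrow> (real \<Rightarrow> complex) \<Rightarrow> real \<Rightarrow> complex" where
  "dunkl_transform k f \<xi> = (LINT x|\<mu> k. f x * dunkl_kernel k \<xi> x)"

section \<open>The transform of integrable functions\<close>

lemma integrable_mult_dunkl_kernel:
  assumes k: "k \<ge> - 1 / 2" and f: "integrable (\<mu> k) f"
  shows "integrable (\<mu> k) (\<lambda>x. f x * dunkl_kernel k \<xi> x)"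
proof (rule Bochner_Integration.integrable_bound[OF f])
  have [measurable]: "f \<in> borel_measurable borel"
    using borel_measurable_integrable[OF f] by simp
  show "(\<lambda>x. f x * dunkl_kernel k \<xi> x) \<in> borel_measurable (\<mu> k)"
    using k by simp
  show "AE x in \<mu> k. norm (f x * dunkl_kernel k \<xi> x) \<le> norm (f x)"
    using norm_dunkl_kernel_le_1[OF k] by (intro AE_I2) (simp add: norm_mult mult_left_le)
qed

lemma norm_dunkl_transform_le:
  assumes k: "k \<ge> - 1 / 2" and f: "integrable (\<mu> k) f"
  shows "norm (dunkl_transform k f \<xi>) \<le> (LINT x|\<mu> k. norm (f x))"
proof -
  have "norm (dunkl_transform k f \<xi>) \<le> (LINT x|\<mu> k. norm (f x * dunkl_kernel k \<xi> x))"
    unfolding dunkl_transform_def by (rule integral_norm_bound)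
  also have "\<dots> \<le> (LINT x|\<mu> k. norm (f x))"
    using norm_dunkl_kernel_le_1[OF k]
    by (intro integral_mono integrable_norm integrable_mult_dunkl_kernel k f)
      (simp add: norm_mult mult_left_le)
  finally show ?thesis .
qed

lemma borel_measurable_dunkl_transform [measurable]:
  assumes k: "k > -1" and f[measurable]: "f \<in> borel_measurable borel"
  shows "dunkl_transform k f \<in> borel_measurable borel"
proof -
  interpret sigma_finite_measure "\<mu> k" by (rule sigma_finite_dunkl_measure)
  have "(\<lambda>(\<xi>, x). f x * dunkl_kernel k \<xi> x) \<in> borel_measurable (borel \<Otimes>\<^sub>M \<mu> k)"
    unfolding split_beta' using k by measurable
  then show ?thesis
    unfolding dunkl_transform_def[abs_def] by (rule borel_measurable_lebesgue_integral)
qed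

lemma dunkl_transform_add:
  assumes "k \<ge> - 1 / 2" "integrable (\<mu> k) f" "integrable (\<mu> k) g"
  shows "dunkl_transform k (\<lambda>x. f x + g x) \<xi> = dunkl_transform k f \<xi> + dunkl_transform k g \<xi>"
  unfolding dunkl_transform_def distrib_right
  using assms by (intro Bochner_Integration.integral_add integrable_mult_dunkl_kernel)

lemma dunkl_transform_cmult: "dunkl_transform k (\<lambda>x. c * f x) \<xi> = c * dunkl_transform k f \<xi>"
  unfolding dunkl_transform_def mult.assoc by simp

lemma dunkl_transform_sum:
  assumes "k \<ge> - 1 / 2" "\<And>i. i \<in> I \<Longrightarrow> integrable (\<mu> k) (f i)"
  shows "dunkl_transform k (\<lambda>x. \<Sum>i\<in>I. f i x) \<xi> = (\<Sum>i\<in>I. dunkl_transform k (f i) \<xi>)"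
  unfolding dunkl_transform_def sum_distrib_right
  using assms by (intro Bochner_Integration.integral_sum integrable_mult_dunkl_kernel)

lemma dunkl_transform_tendsto:
  assumes k: "k \<ge> - 1 / 2" and w: "integrable (\<mu> k) w"
    and [measurable]: "f \<in> borel_measurable borel" "\<And>n. s n \<in> borel_measurable borel"
    and lim: "AE x in \<mu> k. (\<lambda>n. s n x) \<longlonglongrightarrow> f x" and bound: "\<And>n x. norm (s n x) \<le> w x"
  shows "(\<lambda>n. dunkl_transform k (s n) \<xi>) \<longlonglongrightarrow> dunkl_transform k f \<xi>"
  unfolding dunkl_transform_def
proof (rule integral_dominated_convergence[where w = w])
  show "AE x in \<mu> k. (\<lambda>n. s n x * dunkl_kernel k \<xi> x) \<longlonglongrightarrow> f x * dunkl_kernel k \<xi> x"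
    using lim by eventually_elim (intro tendsto_intros)
  show "AE x in \<mu> k. norm (s n x * dunkl_kernel k \<xi> x) \<le> w x" for n
  proof (rule AE_I2)
    fix x
    have "norm (s n x * dunkl_kernel k \<xi> x) \<le> norm (s n x)"
      using norm_dunkl_kernel_le_1[OF k] by (simp add: norm_mult mult_left_le)
    then show "norm (s n x * dunkl_kernel k \<xi> x) \<le> w x"
      using bound[of n x] by simp
  qed
qed (use k w in auto)

section \<open>Gaussian integrals against Bessel functions\<close>

lemma has_bochner_integral_gaussian:
  assumes k: "k > -1" and t: "t > 0"
  shows "has_bochner_integral (\<mu> k) (\<lambda>x. x ^ (2 * n) * exp (- (t * x\<^sup>2 / 2)))
    ((2 / t) ^ n * pochhammer (k + 1) n * t powr (- (k + 1)))"
proof (rule has_bochner_integral_nn_integral)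
  show "0 \<le> (2 / t) ^ n * pochhammer (k + 1) n * t powr (- (k + 1))"
    using k t by (auto intro!: mult_nonneg_nonneg pochhammer_nonneg)
  show "(\<integral>\<^sup>+x. ennreal (x ^ (2 * n) * exp (- (t * x\<^sup>2 / 2))) \<partial>\<mu> k)
    = ennreal ((2 / t) ^ n * pochhammer (k + 1) n * t powr (- (k + 1)))"
    by (rule nn_integral_dunkl_gaussian[OF k t])
qed (auto simp: power_mult)

text \<open>Weber's integral. The series of \<open>bessel_j\<close> is integrated term by term; the
  Pochhammer symbol of the n-th Gaussian moment cancels the one in the n-th coefficient, and an
  exponential series remains.\<close>

lemma integral_gaussian_bessel:
  assumes k: "k > -1" and t: "t > 0"
  shows "integrable (\<mu> k) (\<lambda>x. exp (- (t * x\<^sup>2 / 2)) * bessel_j k (\<xi> * x))"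
    and "(LINT x|\<mu> k. exp (- (t * x\<^sup>2 / 2)) * bessel_j k (\<xi> * x))
      = t powr (- (k + 1)) * exp (- (\<xi>\<^sup>2 / (2 * t)))"
proof -
  define q where "q = (\<xi> / 2)\<^sup>2"
  have q: "q \<ge> 0" by (simp add: q_def)
  let ?f = "\<lambda>n x. bessel_coeff k n * q ^ n * (x ^ (2 * n) * exp (- (t * x\<^sup>2 / 2)))"
  have i: "has_bochner_integral (\<mu> k) (?f n)
      (bessel_coeff k n * q ^ n * ((2 / t) ^ n * pochhammer (k + 1) n * t powr (- (k + 1))))" for n
    by (intro has_bochner_integral_mult_right has_bochner_integral_gaussian k t)
  have p: "pochhammer (k + 1) n > 0" for n using k by (intro pochhammer_pos) auto
  have val: "bessel_coeff k n * q ^ n * ((2 / t) ^ n * pochhammer (k + 1) n * t powr (- (k + 1)))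
      = t powr (- (k + 1)) * ((- (\<xi>\<^sup>2 / (2 * t))) ^ n /\<^sub>R fact n)" for n
  proof -
    have "(- (\<xi>\<^sup>2 / (2 * t))) ^ n = (-1) ^ n * (q ^ n * (2 / t) ^ n)"
      unfolding power_mult_distrib[symmetric] by (simp add: q_def power2_eq_square)
    then have e: "(-1) ^ n * (q ^ n * (2 / t) ^ n) = (- (\<xi>\<^sup>2 / (2 * t))) ^ n" ..
    have c: "bessel_coeff k n * pochhammer (k + 1) n = (-1) ^ n / fact n"
      using p[of n] by (simp add: bessel_coeff_def)
    have "bessel_coeff k n * q ^ n * ((2 / t) ^ n * pochhammer (k + 1) n * t powr (- (k + 1)))
        = t powr (- (k + 1)) * (bessel_coeff k n * pochhammer (k + 1) n * (q ^ n * (2 / t) ^ n))"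
      by (simp only: mult_ac)
    also have "\<dots> = t powr (- (k + 1)) * (((-1) ^ n * (q ^ n * (2 / t) ^ n)) /\<^sub>R fact n)"
      unfolding c by (simp only: divide_inverse real_scaleR_def mult_ac)
    finally show ?thesis unfolding e .
  qed
  have nrm: "norm (?f n x) = \<bar>bessel_coeff k n\<bar> * q ^ n * (x ^ (2 * n) * exp (- (t * x\<^sup>2 / 2)))" for n x
    using q by (simp add: abs_mult power_mult)
  have in': "has_bochner_integral (\<mu> k) (\<lambda>x. norm (?f n x))
      (\<bar>bessel_coeff k n\<bar> * q ^ n * ((2 / t) ^ n * pochhammer (k + 1) n * t powr (- (k + 1))))" for n
    unfolding nrm by (intro has_bochner_integral_mult_right has_bochner_integral_gaussian k t)
  have summable_ptw: "summable (\<lambda>n. norm (?f n x))" for x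
  proof (rule summable_comparison_test')
    show "summable (\<lambda>n. 1 / min 1 (k + 1) * exp (- (t * x\<^sup>2 / 2)) * ((q * x\<^sup>2) ^ n /\<^sub>R fact n))"
      by (intro summable_mult summable_exp_generic)
    fix n :: nat
    have "\<bar>bessel_coeff k n\<bar> * (q * x\<^sup>2) ^ n * exp (- (t * x\<^sup>2 / 2))
        \<le> 1 / min 1 (k + 1) * (1 / fact n) * (q * x\<^sup>2) ^ n * exp (- (t * x\<^sup>2 / 2))"
      using q by (intro mult_right_mono abs_bessel_coeff_le k) auto
    moreover have "norm (norm (?f n x)) = \<bar>bessel_coeff k n\<bar> * (q * x\<^sup>2) ^ n * exp (- (t * x\<^sup>2 / 2))"
    proof -
      have "norm (norm (?f n x)) = norm (?f n x)" by simp
      then show ?thesis unfolding nrm unfolding power_mult power_mult_distrib by (simp only: mult_ac)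
    qed
    moreover have "1 / min 1 (k + 1) * (1 / fact n) * (q * x\<^sup>2) ^ n * exp (- (t * x\<^sup>2 / 2))
        = 1 / min 1 (k + 1) * exp (- (t * x\<^sup>2 / 2)) * ((q * x\<^sup>2) ^ n /\<^sub>R fact n)"
      by (simp only: divide_inverse real_scaleR_def mult_ac mult_1)
    ultimately show "norm (norm (?f n x)) \<le> 1 / min 1 (k + 1) * exp (- (t * x\<^sup>2 / 2)) * ((q * x\<^sup>2) ^ n /\<^sub>R fact n)"
      by metis
  qed
  \<comment> \<open>With absolute values the same cancellation gives the exponential series at
    \<xi>^2 / (2 t), up to a constant factor, which justifies the exchange of sum and
    integral.\<close>
  have summable_int: "summable (\<lambda>n. LINT x|\<mu> k. norm (?f n x))"
  proof -
    have "(LINT x|\<mu> k. norm (?f n x)) = t powr (- (k + 1)) * ((\<xi>\<^sup>2 / (2 * t)) ^ n /\<^sub>R fact n)" for n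
    proof -
      have "(LINT x|\<mu> k. norm (?f n x))
        = \<bar>bessel_coeff k n * q ^ n * ((2 / t) ^ n * pochhammer (k + 1) n * t powr (- (k + 1)))\<bar>"
        using has_bochner_integral_integral_eq[OF in'] q t p[of n] by (simp add: abs_mult)
      also have "\<dots> = t powr (- (k + 1)) * ((\<xi>\<^sup>2 / (2 * t)) ^ n /\<^sub>R fact n)"
        unfolding val using t by (simp add: abs_mult power_abs)
      finally show ?thesis .
    qed
    then show ?thesis by (simp only: summable_mult[OF summable_exp_generic])
  qed
  have suminf: "(\<Sum>n. ?f n x) = exp (- (t * x\<^sup>2 / 2)) * bessel_j k (\<xi> * x)" for x
  proof -
    have "(\<Sum>n. exp (- (t * x\<^sup>2 / 2)) * (bessel_coeff k n * ((\<xi> * x / 2)\<^sup>2) ^ n))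
        = exp (- (t * x\<^sup>2 / 2)) * bessel_series k ((\<xi> * x / 2)\<^sup>2)"
      unfolding bessel_series_def by (intro suminf_mult summable_bessel k)
    moreover have "exp (- (t * x\<^sup>2 / 2)) * (bessel_coeff k n * ((\<xi> * x / 2)\<^sup>2) ^ n) = ?f n x" for n
      by (simp add: q_def power_mult power_mult_distrib power_divide)
    ultimately show ?thesis using k by (simp add: bessel_j_eq_series)
  qed
  have I: "integrable (\<mu> k) (?f n)" for n
    using i by (rule integrable.intros)
  have "AE x in \<mu> k. summable (\<lambda>n. norm (?f n x))"
    using summable_ptw by auto
  note A = this summable_int
  show "integrable (\<mu> k) (\<lambda>x. exp (- (t * x\<^sup>2 / 2)) * bessel_j k (\<xi> * x))"
    using integrable_suminf[of "\<mu> k" ?f, OF I A] unfolding suminf .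
  have "(\<lambda>n. t powr (- (k + 1)) * ((- (\<xi>\<^sup>2 / (2 * t))) ^ n /\<^sub>R fact n)) sums
      (LINT x|\<mu> k. exp (- (t * x\<^sup>2 / 2)) * bessel_j k (\<xi> * x))"
    using sums_integral[of "\<mu> k" ?f, OF I A]
    unfolding suminf has_bochner_integral_integral_eq[OF i] val .
  moreover have "(\<lambda>n. t powr (- (k + 1)) * ((- (\<xi>\<^sup>2 / (2 * t))) ^ n /\<^sub>R fact n)) sums
      (t powr (- (k + 1)) * exp (- (\<xi>\<^sup>2 / (2 * t))))"
    by (intro sums_mult exp_converges)
  ultimately show "(LINT x|\<mu> k. exp (- (t * x\<^sup>2 / 2)) * bessel_j k (\<xi> * x))
      = t powr (- (k + 1)) * exp (- (\<xi>\<^sup>2 / (2 * t)))"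
    by (rule sums_unique2)
qed

text \<open>A factor x^2 raises the order of the measure by one. The odd atom meets the odd part of
  the kernel in such a factor, which brings that case back to Weber's integral of order k +
  1.\<close>

lemma dunkl_weight_Suc:
  assumes "k > -1"
  shows "dunkl_weight k x * x\<^sup>2 = 2 * (k + 1) * dunkl_weight (k + 1) x"
proof (cases "x = 0")
  case False
  have "Gamma (k + 1 + 1) = (k + 1) * Gamma (k + 1)"
    using assms by (intro Gamma_plus1) (auto elim!: nonpos_Ints_cases)
  moreover have "\<bar>x\<bar> powr (2 * (k + 1) + 1) = \<bar>x\<bar> powr (2 * k + 1) * x\<^sup>2"
  proof -
    have "\<bar>x\<bar> powr (2 * (k + 1) + 1) = \<bar>x\<bar> powr (2 * k + 1) * \<bar>x\<bar> powr 2"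
      unfolding powr_add[symmetric] by (simp add: algebra_simps)
    then show ?thesis using False by (simp add: powr_numeral)
  qed
  moreover have "(2::real) powr (k + 1 + 1) = 2 * 2 powr (k + 1)"
    by (simp add: powr_add)
  moreover have "Gamma (k + 1) > 0" using assms by (intro Gamma_real_pos) auto
  ultimately show ?thesis using assms by (simp add: dunkl_weight_def divide_simps)
qed (simp add: dunkl_weight_def)

lemma integral_dunkl_Suc:
  fixes f :: "real \<Rightarrow> real"
  assumes k: "k > -1" and [measurable]: "f \<in> borel_measurable borel"
  shows "(LINT x|\<mu> k. x\<^sup>2 * f x) = 2 * (k + 1) * (LINT x|\<mu> (k + 1). f x)"
proof -
  have "(LINT x|\<mu> k. x\<^sup>2 * f x) = (LINT x|lborel. dunkl_weight k x *\<^sub>R (x\<^sup>2 * f x))"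
    unfolding dunkl_measure_eq using k by (subst integral_density) (auto simp: dunkl_weight_nonneg)
  also have "\<dots> = (LINT x|lborel. 2 * (k + 1) * (dunkl_weight (k + 1) x *\<^sub>R f x))"
  proof (rule Bochner_Integration.integral_cong)
    fix x show "dunkl_weight k x *\<^sub>R (x\<^sup>2 * f x) = 2 * (k + 1) * (dunkl_weight (k + 1) x *\<^sub>R f x)"
      using dunkl_weight_Suc[OF k, of x] by (metis mult.assoc real_scaleR_def)
  qed simp
  also have "\<dots> = 2 * (k + 1) * (LINT x|lborel. dunkl_weight (k + 1) x *\<^sub>R f x)"
    by (rule integral_mult_right_zero)
  also have "(LINT x|lborel. dunkl_weight (k + 1) x *\<^sub>R f x) = (LINT x|\<mu> (k + 1). f x)"
    unfolding dunkl_measure_eq using k by (subst integral_density) (auto simp: dunkl_weight_nonneg)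
  finally show ?thesis .
qed

section \<open>Gaussian atoms and their Gram matrices\<close>

definition gauss_atom :: "real \<Rightarrow> bool \<Rightarrow> real \<Rightarrow> real" where
  "gauss_atom t \<sigma> x = (if \<sigma> then x else 1) * exp (- (t * x\<^sup>2 / 2))"

text \<open>The multipliers by which the transform acts on the atoms. Odd functions pick up the
  factor -i, as under the Fourier transform; being unimodular it disappears from the Gram
  matrix.\<close>

definition gauss_factor :: "real \<Rightarrow> real \<Rightarrow> bool \<Rightarrow> complex" where
  "gauss_factor k t \<sigma> =
    (if \<sigma> then - \<i> * of_real (t powr (- (k + 2))) else of_real (t powr (- (k + 1))))"

lemma gauss_atom_measurable [measurable]: "gauss_atom t \<sigma> \<in> borel_measurable borel"
  unfolding gauss_atom_def[abs_def] by measurable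

lemma integrable_gauss_atom_mult:
  assumes k: "k > -1" and t: "s > 0" "t > 0"
  shows "integrable (\<mu> k) (\<lambda>x. gauss_atom s \<sigma> x * gauss_atom t \<tau> x)"
proof -
  have e: "exp (- (s * x\<^sup>2 / 2)) * exp (- (t * x\<^sup>2 / 2)) = exp (- ((s + t) * x\<^sup>2 / 2))" for x
    by (simp add: exp_add[symmetric] algebra_simps add_divide_distrib)
  have "integrable (\<mu> k) (\<lambda>x. x ^ (2 * 0) * exp (- ((s + t) * x\<^sup>2 / 2)) + x ^ (2 * 1) * exp (- ((s + t) * x\<^sup>2 / 2)))"
    using t by (intro Bochner_Integration.integrable_add
        integrable.intros[OF has_bochner_integral_gaussian] k) auto
  then show ?thesis
  proof (rule Bochner_Integration.integrable_bound)
    have "\<bar>gauss_atom s \<sigma> x * gauss_atom t \<tau> x\<bar> \<le> (1 + x\<^sup>2) * exp (- ((s + t) * x\<^sup>2 / 2))" for x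
    proof -
      \<comment> \<open>Needed for a product of atoms of opposite parity, where a single factor x
        occurs.\<close>
      have x: "\<bar>x\<bar> \<le> 1 + x\<^sup>2"
        using zero_le_power2[of "\<bar>x\<bar> - 1"] by (simp add: power2_diff)
      have "gauss_atom s \<sigma> x * gauss_atom t \<tau> x
          = (if \<sigma> then x else 1) * (if \<tau> then x else 1) * exp (- ((s + t) * x\<^sup>2 / 2))"
        unfolding e[symmetric] gauss_atom_def by (simp add: mult_ac)
      moreover have "\<bar>(if \<sigma> then x else 1) * (if \<tau> then x else 1)\<bar> \<le> 1 + x\<^sup>2"
        using x by (auto simp: abs_mult power2_eq_square)
      ultimately show ?thesis by (simp add: abs_mult mult_right_mono)
    qed
    then show "AE x in \<mu> k. norm (gauss_atom s \<sigma> x * gauss_atom t \<tau> x)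
       \<le> norm (x ^ (2 * 0) * exp (- ((s + t) * x\<^sup>2 / 2)) + x ^ (2 * 1) * exp (- ((s + t) * x\<^sup>2 / 2)))"
      by (auto simp: distrib_right)
  qed simp
qed

lemma integrable_gauss_atom:
  assumes k: "k > -1" and t: "t > 0"
  shows "integrable (\<mu> k) (gauss_atom t \<sigma>)"
proof -
  \<comment> \<open>Splitting the exponential into two equal halves makes a single atom a product of
    two atoms.\<close>
  have "gauss_atom (t / 2) \<sigma> x * gauss_atom (t / 2) False x = gauss_atom t \<sigma> x" for x
    by (simp add: gauss_atom_def mult_exp_exp field_simps)
  then show ?thesis using integrable_gauss_atom_mult[OF k, of "t / 2" "t / 2" \<sigma> False] t by simp
qed

lemma integral_gauss_atom_mult:
  assumes k: "k > -1" and t: "s > 0" "t > 0"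
  shows "(LINT x|\<mu> k. gauss_atom s \<sigma> x * gauss_atom t \<tau> x) =
    (if \<sigma> \<noteq> \<tau> then 0 else if \<sigma> then 2 * (k + 1) * (s + t) powr (- (k + 2)) else (s + t) powr (- (k + 1)))"
proof (cases "\<sigma> = \<tau>")
  case False
  then show ?thesis
    using integral_dunkl_odd[OF k, of "\<lambda>x. gauss_atom s \<sigma> x * gauss_atom t \<tau> x"]
    by (auto simp: gauss_atom_def)
next
  case True
  have e: "exp (- (s * x\<^sup>2 / 2)) * exp (- (t * x\<^sup>2 / 2)) = exp (- ((s + t) * x\<^sup>2 / 2))" for x
    by (simp add: exp_add[symmetric] algebra_simps add_divide_distrib)
  have "gauss_atom s \<sigma> x * gauss_atom t \<tau> x = x ^ (2 * (if \<sigma> then 1 else 0)) * exp (- ((s + t) * x\<^sup>2 / 2))" for x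
    unfolding e[symmetric] gauss_atom_def using True by (simp add: power2_eq_square mult_ac)
  then have "(LINT x|\<mu> k. gauss_atom s \<sigma> x * gauss_atom t \<tau> x) =
     (2 / (s + t)) ^ (if \<sigma> then 1 else 0) * pochhammer (k + 1) (if \<sigma> then 1 else 0) * (s + t) powr (- (k + 1))"
    using has_bochner_integral_integral_eq[OF has_bochner_integral_gaussian[OF k, of "s + t"]] t by simp
  moreover have "(s + t) powr (- (k + 2)) = (s + t) powr (- (k + 1)) / (s + t)"
    using t powr_diff[of "s + t" "- (k + 1)" 1] by (simp add: algebra_simps)
  ultimately show ?thesis using True by auto
qed

text \<open>Parity annihilates one of the two parts of the kernel. An even atom leaves Weber's
  integral of order k, an odd atom the one of order k + 1.\<close>

lemma dunkl_transform_gauss_atom: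
  assumes k: "k \<ge> - 1 / 2" and t: "t > 0"
  shows "dunkl_transform k (\<lambda>x. of_real (gauss_atom t \<sigma> x)) \<xi> = gauss_factor k t \<sigma> * of_real (gauss_atom (1 / t) \<sigma> \<xi>)"
proof -
  have k1: "k > -1" "k + 1 > -1" using k by auto
  define A where "A = (\<lambda>x. gauss_atom t \<sigma> x * bessel_j k (\<xi> * x))"
  define B where "B = (\<lambda>x. gauss_atom t \<sigma> x * (\<xi> * x / (2 * (k + 1))) * bessel_j (k + 1) (\<xi> * x))"
  have AB: "of_real (gauss_atom t \<sigma> x) * dunkl_kernel k \<xi> x = Complex (A x) (- B x)" for x
    by (simp add: A_def B_def complex_eq_iff dunkl_kernel_def Re_divide_of_real Im_divide_of_real algebra_simps)
  have [measurable]: "bessel_j k \<in> borel_measurable borel" "bessel_j (k + 1) \<in> borel_measurable borel"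
    using k1 by (auto intro!: borel_measurable_continuous_onI continuous_intros)
  have [measurable]: "A \<in> borel_measurable borel" "B \<in> borel_measurable borel"
    unfolding A_def B_def by measurable
  have int: "integrable (\<mu> k) (\<lambda>x. of_real (gauss_atom t \<sigma> x) * dunkl_kernel k \<xi> x)"
    by (intro integrable_mult_dunkl_kernel k integrable_of_real integrable_gauss_atom k1 t)
  have D: "dunkl_transform k (\<lambda>x. of_real (gauss_atom t \<sigma> x)) \<xi>
      = Complex (LINT x|\<mu> k. A x) (- (LINT x|\<mu> k. B x))"
    using integral_Re[OF int] integral_Im[OF int]
    by (simp add: dunkl_transform_def complex_eq_iff AB)
  show ?thesis
  proof (cases \<sigma>)
    case False
    have "(LINT x|\<mu> k. B x) = 0"
      using False k1 by (intro integral_dunkl_odd k1) (auto simp: B_def gauss_atom_def bessel_j_minus)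
    moreover have "(LINT x|\<mu> k. A x) = t powr (- (k + 1)) * exp (- (\<xi>\<^sup>2 / (2 * t)))"
      using integral_gaussian_bessel(2)[OF k1(1) t, of \<xi>] False by (simp add: A_def gauss_atom_def)
    ultimately show ?thesis using D False
      by (simp add: complex_eq_iff gauss_factor_def gauss_atom_def mult.commute)
  next
    case True
    have "(LINT x|\<mu> k. A x) = 0"
      using True k1 by (intro integral_dunkl_odd k1) (auto simp: A_def gauss_atom_def bessel_j_minus)
    moreover have "(LINT x|\<mu> k. B x) = \<xi> * t powr (- (k + 2)) * exp (- (\<xi>\<^sup>2 / (2 * t)))"
    proof -
      have "(LINT x|\<mu> k. B x)
         = (LINT x|\<mu> k. \<xi> / (2 * (k + 1)) * (x\<^sup>2 * (exp (- (t * x\<^sup>2 / 2)) * bessel_j (k + 1) (\<xi> * x))))"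
        using True by (intro Bochner_Integration.integral_cong)
          (auto simp: B_def gauss_atom_def power2_eq_square)
      also have "\<dots> = \<xi> / (2 * (k + 1)) * (2 * (k + 1) *
          (LINT x|\<mu> (k + 1). exp (- (t * x\<^sup>2 / 2)) * bessel_j (k + 1) (\<xi> * x)))"
        by (subst integral_mult_right_zero, subst integral_dunkl_Suc[OF k1(1)]) auto
      also have "\<dots> = \<xi> * t powr (- (k + 2)) * exp (- (\<xi>\<^sup>2 / (2 * t)))"
      proof -
        have "\<xi> / p * (p * y) = \<xi> * y" if "p \<noteq> 0" for p y :: real using that by simp
        moreover have "2 * (k + 1) \<noteq> 0" using k1 by simp
        ultimately show ?thesis
          unfolding integral_gaussian_bessel(2)[OF k1(2) t] by (simp add: add.assoc mult.assoc)
      qed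
      finally show ?thesis .
    qed
    ultimately show ?thesis using D True
      by (simp add: complex_eq_iff gauss_factor_def gauss_atom_def mult.commute)
  qed
qed

text \<open>It rests on \<open>s * t * (1 / s + 1 / t) = s + t\<close>: the powers of s and t in the
  multipliers are exactly those that turn the Gram entry at 1 / s, 1 / t into the entry at s,
  t.\<close>

lemma gauss_factor_gram:
  assumes t: "s > 0" "t > 0"
  shows "gauss_factor k s \<sigma> * cnj (gauss_factor k t \<sigma>) *
      of_real ((1 / s + 1 / t) powr (- (if \<sigma> then k + 2 else k + 1)))
    = of_real ((s + t) powr (- (if \<sigma> then k + 2 else k + 1)))"
proof -
  have "s powr (- r) * t powr (- r) * (1 / s + 1 / t) powr (- r) = (s + t) powr (- r)" for r
  proof -
    have "s powr (- r) * t powr (- r) * (1 / s + 1 / t) powr (- r) = (s * t * (1 / s + 1 / t)) powr (- r)"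
      using t by (simp add: powr_mult)
    also have "s * t * (1 / s + 1 / t) = s + t" using t by (simp add: field_simps)
    finally show ?thesis .
  qed
  note * = this[of "k + 1"] this[of "k + 2"]
  have "gauss_factor k s \<sigma> * cnj (gauss_factor k t \<sigma>)
      = of_real (s powr (- (if \<sigma> then k + 2 else k + 1)) * t powr (- (if \<sigma> then k + 2 else k + 1)))"
    by (simp add: gauss_factor_def complex_eq_iff)
  then show ?thesis using * by (cases \<sigma>) (simp_all only: if_True if_False of_real_mult[symmetric])
qed

lemma norm_sum_squared:
  fixes c :: "'i \<Rightarrow> complex" and u :: "'i \<Rightarrow> real"
  shows "of_real ((norm (\<Sum>i\<in>I. c i * of_real (u i)))\<^sup>2)
    = (\<Sum>i\<in>I. \<Sum>j\<in>I. c i * cnj (c j) * of_real (u i * u j))"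
  unfolding complex_norm_square cnj_sum sum_product by (simp add: mult_ac)

lemma integral_norm_sum_squared:
  fixes c :: "'i \<Rightarrow> complex" and u :: "'i \<Rightarrow> 'a \<Rightarrow> real"
  assumes "\<And>i j. i \<in> I \<Longrightarrow> j \<in> I \<Longrightarrow> integrable M (\<lambda>x. u i x * u j x)"
  shows "integrable M (\<lambda>x. (norm (\<Sum>i\<in>I. c i * of_real (u i x)))\<^sup>2)"
    and "of_real (LINT x|M. (norm (\<Sum>i\<in>I. c i * of_real (u i x)))\<^sup>2)
      = (\<Sum>i\<in>I. \<Sum>j\<in>I. c i * cnj (c j) * of_real (LINT x|M. u i x * u j x))"
proof -
  have i: "integrable M (\<lambda>x. c i * cnj (c j) * of_real (u i x * u j x))" if "i \<in> I" "j \<in> I" for i j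
    using assms[OF that] by (intro integrable_mult_right integrable_of_real)
  have "integrable M (\<lambda>x. complex_of_real ((norm (\<Sum>i\<in>I. c i * of_real (u i x)))\<^sup>2))"
    unfolding norm_sum_squared by (intro Bochner_Integration.integrable_sum i)
  then have "integrable M (\<lambda>x. Re (complex_of_real ((norm (\<Sum>i\<in>I. c i * of_real (u i x)))\<^sup>2)))"
    by (rule integrable_Re)
  then show "integrable M (\<lambda>x. (norm (\<Sum>i\<in>I. c i * of_real (u i x)))\<^sup>2)"
    unfolding Re_complex_of_real .
  have "of_real (LINT x|M. (norm (\<Sum>i\<in>I. c i * of_real (u i x)))\<^sup>2)
     = (LINT x|M. complex_of_real ((norm (\<Sum>i\<in>I. c i * of_real (u i x)))\<^sup>2))"
    by (rule integral_complex_of_real[symmetric])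
  also have "\<dots> = (\<Sum>i\<in>I. \<Sum>j\<in>I. (LINT x|M. c i * cnj (c j) * of_real (u i x * u j x)))"
    unfolding norm_sum_squared
    by (subst Bochner_Integration.integral_sum, intro Bochner_Integration.integrable_sum i, assumption+)
      (intro sum.cong refl Bochner_Integration.integral_sum i)
  also have "\<dots> = (\<Sum>i\<in>I. \<Sum>j\<in>I. c i * cnj (c j) * of_real (LINT x|M. u i x * u j x))"
    by (intro sum.cong refl) (subst integral_mult_right_zero, subst integral_complex_of_real, rule refl)
  finally show "of_real (LINT x|M. (norm (\<Sum>i\<in>I. c i * of_real (u i x)))\<^sup>2)
      = (\<Sum>i\<in>I. \<Sum>j\<in>I. c i * cnj (c j) * of_real (LINT x|M. u i x * u j x))" .
qed

lemma dunkl_transform_isometry_gauss: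
  fixes c :: "'i \<Rightarrow> complex" and t :: "'i \<Rightarrow> real"
  assumes k: "k \<ge> - 1 / 2" and t: "\<And>i. i \<in> I \<Longrightarrow> t i > 0"
    and g: "g = (\<lambda>x. \<Sum>i\<in>I. c i * of_real (gauss_atom (t i) (\<sigma> i) x))"
  shows "(\<integral>\<^sup>+\<xi>. ennreal ((norm (dunkl_transform k g \<xi>))\<^sup>2) \<partial>\<mu> k)
    = (\<integral>\<^sup>+x. ennreal ((norm (g x))\<^sup>2) \<partial>\<mu> k)"
proof -
  have k1: "k > -1" using k by auto
  define d where "d = (\<lambda>i. c i * gauss_factor k (t i) (\<sigma> i))"
  have D: "dunkl_transform k g \<xi> = (\<Sum>i\<in>I. d i * of_real (gauss_atom (1 / t i) (\<sigma> i) \<xi>))" for \<xi>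
  proof -
    have "dunkl_transform k g \<xi> = (\<Sum>i\<in>I. dunkl_transform k (\<lambda>x. c i * of_real (gauss_atom (t i) (\<sigma> i) x)) \<xi>)"
      unfolding g using t
      by (intro dunkl_transform_sum k integrable_mult_right integrable_of_real integrable_gauss_atom k1)
    also have "\<dots> = (\<Sum>i\<in>I. d i * of_real (gauss_atom (1 / t i) (\<sigma> i) \<xi>))"
      unfolding dunkl_transform_cmult using t
      by (intro sum.cong refl) (simp only: dunkl_transform_gauss_atom[OF k] d_def mult.assoc)
    finally show ?thesis .
  qed
  have G: "g x = (\<Sum>i\<in>I. c i * of_real (gauss_atom (t i) (\<sigma> i) x))" for x
    by (simp add: g)
  have i1: "integrable (\<mu> k) (\<lambda>x. gauss_atom (t i) (\<sigma> i) x * gauss_atom (t j) (\<sigma> j) x)"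
    "integrable (\<mu> k) (\<lambda>x. gauss_atom (1 / t i) (\<sigma> i) x * gauss_atom (1 / t j) (\<sigma> j) x)"
    if "i \<in> I" "j \<in> I" for i j
    using t that by (auto intro!: integrable_gauss_atom_mult k1)
  \<comment> \<open>The two Gram matrices, weighted by the coefficients, agree entry by entry;
    entries of opposite parity vanish on both sides.\<close>
  have eq: "d i * cnj (d j) * of_real (LINT x|\<mu> k. gauss_atom (1 / t i) (\<sigma> i) x * gauss_atom (1 / t j) (\<sigma> j) x)
     = c i * cnj (c j) * of_real (LINT x|\<mu> k. gauss_atom (t i) (\<sigma> i) x * gauss_atom (t j) (\<sigma> j) x)"
    if "i \<in> I" "j \<in> I" for i j
  proof (cases "\<sigma> i = \<sigma> j")
    case True
    have tt: "t i > 0" "t j > 0" "1 / t i > 0" "1 / t j > 0" using t that by auto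
    define r where "r = (if \<sigma> j then k + 2 else k + 1)"
    define m where "m = complex_of_real (if \<sigma> j then 2 * (k + 1) else 1)"
    have I: "of_real (LINT x|\<mu> k. gauss_atom a (\<sigma> j) x * gauss_atom b (\<sigma> j) x) = m * of_real ((a + b) powr (- r))"
      if "a > 0" "b > 0" for a b
      unfolding integral_gauss_atom_mult[OF k1 that] by (simp add: r_def m_def)
    have "d i * cnj (d j) * (m * of_real ((1 / t i + 1 / t j) powr (- r)))
       = c i * cnj (c j) * m * (gauss_factor k (t i) (\<sigma> j) * cnj (gauss_factor k (t j) (\<sigma> j)) * of_real ((1 / t i + 1 / t j) powr (- r)))"
      by (simp add: d_def True mult_ac)
    then show ?thesis
      unfolding True I[OF tt(1,2)] I[OF tt(3,4)]
      using gauss_factor_gram[OF tt(1,2), of k "\<sigma> j", folded r_def] by (simp only: mult.assoc)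
  next
    case False
    then show ?thesis using t that k1 by (simp add: integral_gauss_atom_mult)
  qed
  have "complex_of_real (LINT \<xi>|\<mu> k. (norm (dunkl_transform k g \<xi>))\<^sup>2) =
      complex_of_real (LINT x|\<mu> k. (norm (g x))\<^sup>2)"
    unfolding D G
    by (subst (1 2) integral_norm_sum_squared(2)) (auto intro!: i1 sum.cong eq)
  then have "(LINT \<xi>|\<mu> k. (norm (dunkl_transform k g \<xi>))\<^sup>2) = (LINT x|\<mu> k. (norm (g x))\<^sup>2)"
    by (simp only: of_real_eq_iff)
  moreover have "integrable (\<mu> k) (\<lambda>\<xi>. (norm (dunkl_transform k g \<xi>))\<^sup>2)"
    unfolding D by (intro integral_norm_sum_squared(1) i1)
  moreover have "integrable (\<mu> k) (\<lambda>x. (norm (g x))\<^sup>2)"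
    unfolding g by (intro integral_norm_sum_squared(1) i1)
  ultimately show ?thesis by (simp add: nn_integral_eq_integral)
qed

section \<open>Approximation by Gaussians and the Plancherel contraction\<close>

text \<open>Such functions lie in every L^p with p \<ge> 1 at once, so the interpolation can vary
  the exponent before any limit is taken.\<close>

definition bdd_supp :: "(real \<Rightarrow> complex) \<Rightarrow> bool" where
  "bdd_supp f \<longleftrightarrow> f \<in> borel_measurable borel \<and>
     (\<exists>B R. 0 < B \<and> 0 < R \<and> (\<forall>x. norm (f x) \<le> B) \<and> (\<forall>x. R < \<bar>x\<bar> \<longrightarrow> f x = 0))"

text \<open>Substituting \<open>v = exp (- x\<^sup>2 / 2)\<close> turns an even function into a function on \<open>[0, 1]\<close>
  vanishing near \<open>0\<close>; dividing by \<open>v\<close> before applying the Weierstrass theorem makes the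
  error decay like a Gaussian.\<close>

lemma gauss_approx_even:
  fixes h :: "real \<Rightarrow> real"
  assumes cont: "continuous_on UNIV h" and even: "\<And>x. h (- x) = h x"
    and supp: "\<And>x. R \<le> \<bar>x\<bar> \<Longrightarrow> h x = 0" and R: "R > 0" and e: "e > 0"
  obtains a :: "nat \<Rightarrow> real" and n where
    "\<And>x. \<bar>h x - (\<Sum>i\<le>n. a i * gauss_atom (real (Suc i)) False x)\<bar> \<le> e * exp (- (x\<^sup>2 / 2))"
proof -
  define v0 where "v0 = exp (- (R\<^sup>2 / 2))"
  have v0: "v0 > 0" by (simp add: v0_def)
  \<comment> \<open>The \<open>max\<close> freezes the argument at the radius R for v below
    \<open>v0\<close>, that is for |x| > R. As h vanishes at R, this extends the quotient by 0,
    continuously up to v = 0.\<close>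
  define \<Psi> where "\<Psi> = (\<lambda>v. h (sqrt (- 2 * ln (max v v0))) / max v v0)"
  have "continuous_on {0..1} \<Psi>"
    unfolding \<Psi>_def using v0
    by (intro continuous_intros continuous_on_compose2[OF cont]) auto
  then obtain p where p: "real_polynomial_function p" "\<And>v. v \<in> {0..1} \<Longrightarrow> \<bar>\<Psi> v - p v\<bar> < e"
    using Stone_Weierstrass_real_polynomial_function[of "{0..1}" \<Psi> e] e by auto
  then obtain a n where a: "p = (\<lambda>v. \<Sum>i\<le>n. a i * v ^ i)"
    using real_polynomial_function_iff_sum by blast
  show thesis
  proof (rule that)
    fix x
    define v :: real where "v = exp (- (x\<^sup>2 / 2))"
    have v: "v > 0" "v \<le> 1" by (auto simp: v_def)
    have \<Psi>v: "v * \<Psi> v = h x"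
    proof (cases "\<bar>x\<bar> \<le> R")
      case True
      then have "x\<^sup>2 \<le> R\<^sup>2" using power_mono[of "\<bar>x\<bar>" R 2] by simp
      then have "max v v0 = v" by (simp add: v_def v0_def)
      moreover have "sqrt (- 2 * ln v) = \<bar>x\<bar>" by (simp add: v_def)
      moreover have "h \<bar>x\<bar> = h x" using even by (simp add: abs_if)
      ultimately show ?thesis using v by (simp add: \<Psi>_def)
    next
      case False
      then have "R\<^sup>2 \<le> x\<^sup>2" using power_mono[of R "\<bar>x\<bar>" 2] R by simp
      then have "max v v0 = v0" by (simp add: v_def v0_def)
      moreover have "sqrt (- 2 * ln v0) = R" using R by (simp add: v0_def)
      ultimately show ?thesis using supp[of R] supp[of x] False R by (simp add: \<Psi>_def)
    qed
    \<comment> \<open>The factor v restored after the division shifts the exponent i to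
      \<open>Suc i\<close>, so the constant term of the polynomial also gives a decaying
      Gaussian.\<close>
    have "a i * gauss_atom (real (Suc i)) False x = v * (a i * v ^ i)" for i
      by (simp add: gauss_atom_def v_def exp_of_nat_mult[symmetric] mult_exp_exp algebra_simps add_divide_distrib)
    then have "(\<Sum>i\<le>n. a i * gauss_atom (real (Suc i)) False x) = v * p v"
      unfolding a sum_distrib_left by (intro sum.cong refl)
    then have "\<bar>h x - (\<Sum>i\<le>n. a i * gauss_atom (real (Suc i)) False x)\<bar> = v * \<bar>\<Psi> v - p v\<bar>"
      using v by (simp add: \<Psi>v[symmetric] abs_mult flip: right_diff_distrib)
    also have "\<dots> \<le> v * e"
      using p(2)[of v] v by (intro mult_left_mono) auto
    finally show "\<bar>h x - (\<Sum>i\<le>n. a i * gauss_atom (real (Suc i)) False x)\<bar> \<le> e * exp (- (x\<^sup>2 / 2))"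
      by (simp add: v_def mult.commute)
  qed
qed

text \<open>Division by x gives an even function, and multiplying its approximation by x produces
  odd atoms. Vanishing near 0 keeps the quotient continuous, and
  \<open>max (x\<^sup>2) (d\<^sup>2)\<close> avoids the zero of the denominator.\<close>

lemma gauss_approx_odd:
  fixes h :: "real \<Rightarrow> real"
  assumes cont: "continuous_on UNIV h" and odd: "\<And>x. h (- x) = - h x"
    and supp: "\<And>x. R \<le> \<bar>x\<bar> \<Longrightarrow> h x = 0" and zero: "\<And>x. \<bar>x\<bar> \<le> d \<Longrightarrow> h x = 0"
    and R: "R > 0" and d: "d > 0" and e: "e > 0"
  obtains a :: "nat \<Rightarrow> real" and n where
    "\<And>x. \<bar>h x - (\<Sum>i\<le>n. a i * gauss_atom (real (Suc i)) True x)\<bar> \<le> e * \<bar>x\<bar> * exp (- (x\<^sup>2 / 2))"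
proof -
  define h2 where "h2 = (\<lambda>x. h x * x / max (x\<^sup>2) (d\<^sup>2))"
  have xh2: "x * h2 x = h x" for x
  proof (cases "\<bar>x\<bar> \<le> d")
    case False
    then have "d\<^sup>2 \<le> x\<^sup>2" using power_mono[of d "\<bar>x\<bar>" 2] d by simp
    then have "max (x\<^sup>2) (d\<^sup>2) = x\<^sup>2" by simp
    then show ?thesis using False d by (auto simp: h2_def power2_eq_square)
  qed (simp add: h2_def zero)
  have "max (x\<^sup>2) (d\<^sup>2) \<noteq> 0" for x :: real using d by (auto simp: max_def)
  then have "continuous_on UNIV h2"
    unfolding h2_def by (intro continuous_intros cont) auto
  moreover have "h2 (- x) = h2 x" for x by (simp add: h2_def odd)
  moreover have "h2 x = 0" if "R \<le> \<bar>x\<bar>" for x using supp[OF that] by (simp add: h2_def)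
  ultimately obtain a n where
    a: "\<And>x. \<bar>h2 x - (\<Sum>i\<le>n. a i * gauss_atom (real (Suc i)) False x)\<bar> \<le> e * exp (- (x\<^sup>2 / 2))"
    using gauss_approx_even[of h2 R e] R e by blast
  show thesis
  proof (rule that)
    fix x
    have "(\<Sum>i\<le>n. a i * gauss_atom (real (Suc i)) True x) = x * (\<Sum>i\<le>n. a i * gauss_atom (real (Suc i)) False x)"
      by (simp add: sum_distrib_left gauss_atom_def mult_ac)
    then have "\<bar>h x - (\<Sum>i\<le>n. a i * gauss_atom (real (Suc i)) True x)\<bar>
      = \<bar>x\<bar> * \<bar>h2 x - (\<Sum>i\<le>n. a i * gauss_atom (real (Suc i)) False x)\<bar>"
      by (simp add: xh2[symmetric] abs_mult flip: right_diff_distrib)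
    also have "\<dots> \<le> \<bar>x\<bar> * (e * exp (- (x\<^sup>2 / 2)))"
      by (intro mult_left_mono a) auto
    finally show "\<bar>h x - (\<Sum>i\<le>n. a i * gauss_atom (real (Suc i)) True x)\<bar> \<le> e * \<bar>x\<bar> * exp (- (x\<^sup>2 / 2))"
      by (simp add: mult_ac)
  qed
qed

lemma gauss_approx_real:
  fixes h :: "real \<Rightarrow> real"
  assumes cont: "continuous_on UNIV h"
    and supp: "\<And>x. R \<le> \<bar>x\<bar> \<Longrightarrow> h x = 0" and zero: "\<And>x. \<bar>x\<bar> \<le> d \<Longrightarrow> h x = 0"
    and R: "R > 0" and d: "d > 0" and e: "e > 0"
  obtains a :: "bool \<Rightarrow> nat \<Rightarrow> real" and n :: "bool \<Rightarrow> nat" where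
    "\<And>x. \<bar>h x - (\<Sum>\<sigma>\<in>UNIV. \<Sum>i\<le>n \<sigma>. a \<sigma> i * gauss_atom (real (Suc i)) \<sigma> x)\<bar>
      \<le> e * (1 + \<bar>x\<bar>) * exp (- (x\<^sup>2 / 2))"
proof -
  define h0 h1 where "h0 = (\<lambda>x. (h x + h (- x)) / 2)" and "h1 = (\<lambda>x. (h x - h (- x)) / 2)"
  have cont': "continuous_on UNIV (\<lambda>x. h (- x))"
    by (intro continuous_on_compose2[OF cont] continuous_intros) auto
  obtain a0 n0 where 0: "\<And>x. \<bar>h0 x - (\<Sum>i\<le>n0. a0 i * gauss_atom (real (Suc i)) False x)\<bar> \<le> e * exp (- (x\<^sup>2 / 2))"
  proof (rule gauss_approx_even[of h0 R e])
    show "continuous_on UNIV h0" unfolding h0_def by (intro continuous_intros cont cont') auto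
  qed (use supp R e in \<open>auto simp: h0_def\<close>)
  obtain a1 n1 where 1: "\<And>x. \<bar>h1 x - (\<Sum>i\<le>n1. a1 i * gauss_atom (real (Suc i)) True x)\<bar> \<le> e * \<bar>x\<bar> * exp (- (x\<^sup>2 / 2))"
  proof (rule gauss_approx_odd[of h1 R d e])
    show "continuous_on UNIV h1" unfolding h1_def by (intro continuous_intros cont cont') auto
  qed (use supp zero R d e in \<open>auto simp: h1_def field_simps\<close>)
  show thesis
  proof (rule that)
    fix x
    have "h x = h0 x + h1 x" by (simp add: h0_def h1_def field_simps)
    then show "\<bar>h x - (\<Sum>\<sigma>\<in>UNIV. \<Sum>i\<le>(if \<sigma> then n1 else n0). (if \<sigma> then a1 i else a0 i) * gauss_atom (real (Suc i)) \<sigma> x)\<bar>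
      \<le> e * (1 + \<bar>x\<bar>) * exp (- (x\<^sup>2 / 2))"
      using 0[of x] 1[of x] by (simp add: UNIV_bool algebra_simps)
  qed
qed

text \<open>In the index triple the first flag separates the approximation of the real part from
  that of the imaginary part, the second is the parity, and the number n stands for the parameter
  \<open>Suc n\<close>.\<close>

definition gauss_span :: "(real \<Rightarrow> complex) set" where
  "gauss_span = {g. \<exists>(I :: (bool \<times> bool \<times> nat) set) c. finite I \<and>
     g = (\<lambda>x. \<Sum>j\<in>I. c j * of_real (gauss_atom (real (Suc (snd (snd j)))) (fst (snd j)) x))}"

lemma gauss_approx_complex:
  fixes h :: "real \<Rightarrow> complex"
  assumes cont: "continuous_on UNIV h"
    and supp: "\<And>x. R \<le> \<bar>x\<bar> \<Longrightarrow> h x = 0" and zero: "\<And>x. \<bar>x\<bar> \<le> d \<Longrightarrow> h x = 0"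
    and R: "R > 0" and d: "d > 0" and e: "e > 0"
  obtains g where "g \<in> gauss_span" "\<And>x. norm (h x - g x) \<le> e * (1 + \<bar>x\<bar>) * exp (- (x\<^sup>2 / 2))"
proof -
  obtain a n where a: "\<And>x. \<bar>Re (h x) - (\<Sum>\<sigma>\<in>UNIV. \<Sum>i\<le>n \<sigma>. a \<sigma> i * gauss_atom (real (Suc i)) \<sigma> x)\<bar>
      \<le> e / 2 * (1 + \<bar>x\<bar>) * exp (- (x\<^sup>2 / 2))"
    by (rule gauss_approx_real[of "\<lambda>x. Re (h x)" R d "e / 2"])
      (use supp zero R d e in \<open>auto intro!: continuous_intros cont\<close>)
  obtain b m where b: "\<And>x. \<bar>Im (h x) - (\<Sum>\<sigma>\<in>UNIV. \<Sum>i\<le>m \<sigma>. b \<sigma> i * gauss_atom (real (Suc i)) \<sigma> x)\<bar>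
      \<le> e / 2 * (1 + \<bar>x\<bar>) * exp (- (x\<^sup>2 / 2))"
    by (rule gauss_approx_real[of "\<lambda>x. Im (h x)" R d "e / 2"])
      (use supp zero R d e in \<open>auto intro!: continuous_intros cont\<close>)
  define I where "I = (SIGMA r:UNIV. SIGMA \<sigma>:UNIV. {..(if r then n \<sigma> else m \<sigma>)})"
  define c where "c = (\<lambda>(r, \<sigma>, i). if r then complex_of_real (a \<sigma> i) else \<i> * of_real (b \<sigma> i))"
  define g where "g = (\<lambda>x. \<Sum>j\<in>I. c j * of_real (gauss_atom (real (Suc (snd (snd j)))) (fst (snd j)) x))"
  have "finite I" unfolding I_def by auto
  then have "g \<in> gauss_span" unfolding gauss_span_def g_def by blast
  moreover have "norm (h x - g x) \<le> e * (1 + \<bar>x\<bar>) * exp (- (x\<^sup>2 / 2))" for x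
  proof -
    let ?A = "\<Sum>\<sigma>\<in>UNIV. \<Sum>i\<le>n \<sigma>. a \<sigma> i * gauss_atom (real (Suc i)) \<sigma> x"
    let ?B = "\<Sum>\<sigma>\<in>UNIV. \<Sum>i\<le>m \<sigma>. b \<sigma> i * gauss_atom (real (Suc i)) \<sigma> x"
    have "g x = (\<Sum>r\<in>UNIV. \<Sum>\<sigma>\<in>UNIV. \<Sum>i\<le>(if r then n \<sigma> else m \<sigma>). c (r, \<sigma>, i) * of_real (gauss_atom (real (Suc i)) \<sigma> x))"
      unfolding g_def I_def by (simp add: sum.Sigma split_beta')
    also have "\<dots> = of_real ?A + \<i> * of_real ?B"
      unfolding c_def UNIV_bool by (simp add: sum_distrib_left distrib_left mult.assoc)
    finally have g: "g x = of_real ?A + \<i> * of_real ?B" .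
    have "norm (h x - g x) \<le> \<bar>Re (h x - g x)\<bar> + \<bar>Im (h x - g x)\<bar>" by (rule cmod_le)
    also have "\<dots> \<le> e / 2 * (1 + \<bar>x\<bar>) * exp (- (x\<^sup>2 / 2)) + e / 2 * (1 + \<bar>x\<bar>) * exp (- (x\<^sup>2 / 2))"
      unfolding g using a[of x] b[of x] by (intro add_mono) simp_all
    finally show ?thesis by simp
  qed
  ultimately show thesis by (rule that)
qed

text \<open>A measurable function is almost everywhere a limit of continuous ones. Clamping their
  values and cutting them off far out and near 0 makes them accessible to
  \<open>gauss_approx_complex\<close>, and it provides the common integrable majorant that dominated
  convergence will need.\<close>

lemma bdd_supp_gauss_sequence:
  assumes f: "f \<in> borel_measurable borel" and B: "B > 0" "\<And>x. norm (f x) \<le> B"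
    and R: "R > 0" "\<And>x. R < \<bar>x\<bar> \<Longrightarrow> f x = 0"
  obtains g where "\<And>n. g n \<in> gauss_span" "AE x in lborel. (\<lambda>n. g n x) \<longlonglongrightarrow> f x"
    "\<And>n x. norm (g n x) \<le> B * indicator {- (R + 1)..R + 1} x + (1 + \<bar>x\<bar>) * exp (- (x\<^sup>2 / 2))"
proof -
  have "f measurable_on UNIV"
    using f by (intro lebesgue_measurable_imp_measurable_on) (auto intro: measurable_completion)
  then obtain N G where N: "negligible N" and G: "\<And>n. continuous_on UNIV (G n)"
      and lim: "\<And>x. x \<notin> N \<Longrightarrow> (\<lambda>n. G n x) \<longlonglongrightarrow> f x"
    unfolding measurable_on_def by auto
  \<comment> \<open>The radial retraction onto the disc of radius B; it fixes the values of
    f.\<close>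
  define clamp where "clamp = (\<lambda>z::complex. z * of_real (B / max B (norm z)))"
  have maxB: "max B y \<noteq> 0" for y using B(1) by auto
  have clamp_cont: "continuous_on UNIV clamp"
    unfolding clamp_def using maxB by (intro continuous_intros) auto
  have clamp_bound: "norm (clamp z) \<le> B" for z
    using B(1) by (auto simp: clamp_def norm_mult norm_divide max_def field_simps)
  have clamp_f: "clamp (f x) = f x" for x
    using B by (simp add: clamp_def max_absorb1)
  define cut where "cut = (\<lambda>y::real. max 0 (min 1 y))"
  have cut_cont: "continuous_on UNIV (\<lambda>x. cut (u x))" if "continuous_on UNIV u" for u :: "real \<Rightarrow> real"
    unfolding cut_def by (intro continuous_intros that)
  have cut01: "0 \<le> cut y" "cut y \<le> 1" for y by (auto simp: cut_def)
  \<comment> \<open>The first cutoff is 1 for |x| \<le> R and 0 for |x| \<ge> R + 1. The second is 0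
    for |x| \<le> 1/(n+1) and 1 for |x| \<ge> 2/(n+1), so it tends to 1 off the origin.\<close>
  define \<phi> where "\<phi> = (\<lambda>n x. of_real (cut (R + 1 - \<bar>x\<bar>) * cut (real (Suc n) * \<bar>x\<bar> - 1)) * clamp (G n x))"
  have \<phi>_bound: "norm (\<phi> n x) \<le> B * indicator {- (R + 1)..R + 1} x" for n x
  proof (cases "\<bar>x\<bar> \<le> R + 1")
    case True
    have "\<bar>cut (R + 1 - \<bar>x\<bar>) * cut (real (Suc n) * \<bar>x\<bar> - 1)\<bar> * norm (clamp (G n x)) \<le> 1 * B"
      using cut01 clamp_bound by (intro mult_mono) (auto simp: abs_mult intro: mult_le_one)
    then have "norm (\<phi> n x) \<le> B" by (simp only: \<phi>_def norm_mult norm_of_real mult_1)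
    then show ?thesis using True by (simp add: indicator_def abs_le_iff)
  qed (use B in \<open>auto simp: \<phi>_def cut_def\<close>)
  have "\<exists>g. g \<in> gauss_span \<and> (\<forall>x. norm (\<phi> n x - g x) \<le> 1 / real (Suc n) * (1 + \<bar>x\<bar>) * exp (- (x\<^sup>2 / 2)))" for n
  proof (rule gauss_approx_complex[of "\<phi> n" "R + 1" "1 / real (Suc n)" "1 / real (Suc n)"])
    show "continuous_on UNIV (\<phi> n)"
      unfolding \<phi>_def
      by (intro continuous_intros cut_cont continuous_on_compose2[OF clamp_cont] G) auto
    show "\<phi> n x = 0" if "\<bar>x\<bar> \<le> 1 / real (Suc n)" for x
    proof -
      have "real (Suc n) * \<bar>x\<bar> \<le> 1" using that by (simp add: field_simps)
      then show ?thesis by (simp add: \<phi>_def cut_def)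
    qed
  qed (use R in \<open>auto simp: \<phi>_def cut_def\<close>)
  then obtain g where g: "\<And>n. g n \<in> gauss_span"
    "\<And>n x. norm (\<phi> n x - g n x) \<le> 1 / real (Suc n) * (1 + \<bar>x\<bar>) * exp (- (x\<^sup>2 / 2))"
    by metis
  show thesis
  proof (rule that[OF g(1)])
    have "AE x in lborel. x \<notin> N"
    proof -
      have "N \<in> null_sets lebesgue" using N by (simp add: negligible_iff_null_sets)
      then have "AE x in lebesgue. x \<notin> N" by (rule AE_not_in)
      then show ?thesis by (simp add: AE_completion_iff)
    qed
    then show "AE x in lborel. (\<lambda>n. g n x) \<longlonglongrightarrow> f x"
      using AE_lborel_singleton[of 0]
    proof eventually_elim
      case (elim x)
      have 1: "(\<lambda>n. clamp (G n x)) \<longlonglongrightarrow> f x"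
        using isCont_tendsto_compose[of "f x" clamp, OF _ lim[OF elim(1)]] clamp_cont clamp_f
        by (simp add: continuous_on_eq_continuous_at)
      have "filterlim (\<lambda>n. real (Suc n) * \<bar>x\<bar>) at_top sequentially"
        using elim(2) filterlim_real_sequentially
        by (intro filterlim_at_top_mult_tendsto_pos[OF tendsto_const] filterlim_compose[OF filterlim_real_sequentially filterlim_Suc]) auto
      then have "eventually (\<lambda>n. real (Suc n) * \<bar>x\<bar> \<ge> 2) sequentially"
        by (simp add: filterlim_at_top)
      then have "eventually (\<lambda>n. cut (real (Suc n) * \<bar>x\<bar> - 1) = 1) sequentially"
        by eventually_elim (simp add: cut_def)
      then have "(\<lambda>n. cut (real (Suc n) * \<bar>x\<bar> - 1)) \<longlonglongrightarrow> 1"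
        by (rule tendsto_eventually)
      then have "(\<lambda>n. \<phi> n x) \<longlonglongrightarrow> of_real (cut (R + 1 - \<bar>x\<bar>) * 1) * f x"
        unfolding \<phi>_def by (intro tendsto_intros 1)
      moreover have "of_real (cut (R + 1 - \<bar>x\<bar>) * 1) * f x = f x"
        using R(2)[of x] by (cases "R < \<bar>x\<bar>") (auto simp: cut_def)
      ultimately have 2: "(\<lambda>n. \<phi> n x) \<longlonglongrightarrow> f x" by (simp only:)
      have "(\<lambda>n. \<phi> n x - g n x) \<longlonglongrightarrow> 0"
      proof (rule Lim_null_comparison)
        show "\<forall>\<^sub>F n in sequentially. norm (\<phi> n x - g n x) \<le> 1 / real (Suc n) * ((1 + \<bar>x\<bar>) * exp (- (x\<^sup>2 / 2)))"
          using g(2)[of _ x] by (simp add: mult.assoc)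
        show "(\<lambda>n. 1 / real (Suc n) * ((1 + \<bar>x\<bar>) * exp (- (x\<^sup>2 / 2)))) \<longlonglongrightarrow> 0"
          using LIMSEQ_inverse_real_of_nat by (intro tendsto_mult_left_zero) (simp add: inverse_eq_divide)
      qed
      from tendsto_diff[OF 2 this] show ?case by simp
    qed
  next
    fix n x
    have "norm (g n x) \<le> norm (\<phi> n x) + norm (\<phi> n x - g n x)"
      using norm_triangle_ineq4[of "\<phi> n x" "\<phi> n x - g n x"] by simp
    also have "norm (\<phi> n x - g n x) \<le> 1 / real (Suc n) * ((1 + \<bar>x\<bar>) * exp (- (x\<^sup>2 / 2)))"
      using g(2)[of n x] by (simp add: mult.assoc)
    also have "\<dots> \<le> 1 * ((1 + \<bar>x\<bar>) * exp (- (x\<^sup>2 / 2)))"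
      by (intro mult_right_mono) auto
    finally show "norm (g n x) \<le> B * indicator {- (R + 1)..R + 1} x + (1 + \<bar>x\<bar>) * exp (- (x\<^sup>2 / 2))"
      using \<phi>_bound[of n x] by simp
  qed
qed

section \<open>The contraction property in L^2\<close>

lemma integrable_bdd_supp:
  assumes k: "k > -1" and f: "bdd_supp f"
  shows "integrable (\<mu> k) f"
proof -
  obtain B R where [measurable]: "f \<in> borel_measurable borel" and B: "\<And>x. norm (f x) \<le> B"
    and R: "0 < R" "\<And>x. R < \<bar>x\<bar> \<Longrightarrow> f x = 0"
    using f unfolding bdd_supp_def by auto
  have "integrable (\<mu> k) (indicator {-R..R} :: real \<Rightarrow> real)"
    using emeasure_dunkl_ball[OF k, of R] R by (intro integrable_real_indicator) auto
  then have "integrable (\<mu> k) (\<lambda>x. B * indicator {-R..R} x)"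
    by (rule integrable_mult_right)
  then show ?thesis
  proof (rule Bochner_Integration.integrable_bound)
    show "AE x in \<mu> k. norm (f x) \<le> norm (B * indicator {- R..R} x)"
    proof (rule AE_I2)
      fix x show "norm (f x) \<le> norm (B * indicator {- R..R} x)"
        using B[of x] R(2)[of x] by (cases "R < \<bar>x\<bar>") (auto simp: indicator_def)
    qed
  qed simp
qed

text \<open>The majorant gives convergence of the L^2 norms before the transform, but only pointwise
  convergence after it. Fatou's lemma therefore turns the isometry on Gaussians into an inequality,
  which is what interpolation asks for.\<close>

lemma dunkl_transform_contraction:
  assumes k: "k \<ge> - 1 / 2" and f: "bdd_supp f"
  shows "(\<integral>\<^sup>+\<xi>. ennreal ((norm (dunkl_transform k f \<xi>))\<^sup>2) \<partial>\<mu> k)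
    \<le> (\<integral>\<^sup>+x. ennreal ((norm (f x))\<^sup>2) \<partial>\<mu> k)"
proof -
  have k1: "k > -1" using k by auto
  obtain B R where [measurable]: "f \<in> borel_measurable borel" and B: "0 < B" "\<And>x. norm (f x) \<le> B"
    and R: "0 < R" "\<And>x. R < \<bar>x\<bar> \<Longrightarrow> f x = 0"
    using f unfolding bdd_supp_def by auto
  obtain g where g: "\<And>n. g n \<in> gauss_span" and lim: "AE x in lborel. (\<lambda>n. g n x) \<longlonglongrightarrow> f x"
    and bound: "\<And>n x. norm (g n x) \<le> B * indicator {- (R + 1)..R + 1} x + (1 + \<bar>x\<bar>) * exp (- (x\<^sup>2 / 2))"
    using bdd_supp_gauss_sequence[of f B R] B R by auto
  have lim': "AE x in \<mu> k. (\<lambda>n. g n x) \<longlonglongrightarrow> f x"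
    by (rule AE_dunkl_measureI[OF lim])
  define w where "w = (\<lambda>x::real. B * indicator {- (R + 1)..R + 1} x + (1 + \<bar>x\<bar>) * exp (- (x\<^sup>2 / 2)))"
  have [measurable]: "w \<in> borel_measurable borel" unfolding w_def by measurable
  have gm[measurable]: "g n \<in> borel_measurable borel" for n
    using g[of n] unfolding gauss_span_def by auto
  have w: "integrable (\<mu> k) w"
  proof -
    have "integrable (\<mu> k) (\<lambda>x. B * indicator {- (R + 1)..R + 1} x)"
      using emeasure_dunkl_ball[OF k1, of "R + 1"] R
      by (intro integrable_mult_right integrable_real_indicator) auto
    moreover have "integrable (\<mu> k) (\<lambda>x. gauss_atom 1 False x + \<bar>gauss_atom 1 True x\<bar>)"
      by (intro Bochner_Integration.integrable_add integrable_abs integrable_gauss_atom k1) auto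
    ultimately show ?thesis unfolding w_def
      by (intro Bochner_Integration.integrable_add) (auto simp: gauss_atom_def abs_mult distrib_right)
  qed
  have w0: "0 \<le> w x" for x using B by (simp add: w_def)
  \<comment> \<open>Since w is bounded, its square is at most a multiple of w; one integrable
    majorant thus serves for the functions and for their squares.\<close>
  have w_le: "w x \<le> B + 2" for x
  proof -
    have "\<bar>x\<bar> \<le> 1 + x\<^sup>2 / 2"
      using zero_le_power2[of "\<bar>x\<bar> - 1"] by (simp add: power2_diff)
    also have "\<dots> \<le> exp (x\<^sup>2 / 2)" by (rule exp_ge_add_one_self)
    finally have "\<bar>x\<bar> * exp (- (x\<^sup>2 / 2)) \<le> 1" by (simp add: exp_minus field_simps)
    moreover have "exp (- (x\<^sup>2 / 2)) \<le> 1" by simp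
    moreover have "B * indicator {- (R + 1)..R + 1} x \<le> B" using B by (simp add: indicator_def)
    ultimately show ?thesis unfolding w_def distrib_right by linarith
  qed
  have T: "(\<lambda>n. dunkl_transform k (g n) \<xi>) \<longlonglongrightarrow> dunkl_transform k f \<xi>" for \<xi>
    by (rule dunkl_transform_tendsto[OF k w _ _ lim']) (use bound in \<open>auto simp: w_def\<close>)
  have S: "(\<lambda>n. \<integral>\<^sup>+x. ennreal ((norm (g n x))\<^sup>2) \<partial>\<mu> k) \<longlonglongrightarrow> (\<integral>\<^sup>+x. ennreal ((norm (f x))\<^sup>2) \<partial>\<mu> k)"
  proof (rule nn_integral_dominated_convergence[where w = "\<lambda>x. ennreal ((B + 2) * w x)"])
    show "AE x in \<mu> k. ennreal ((norm (g n x))\<^sup>2) \<le> ennreal ((B + 2) * w x)" for n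
    proof (rule AE_I2)
      fix x
      have "(norm (g n x))\<^sup>2 \<le> (w x)\<^sup>2" using bound[of n x] by (intro power_mono) (auto simp: w_def)
      also have "\<dots> \<le> (B + 2) * w x"
        unfolding power2_eq_square by (intro mult_right_mono w_le w0)
      finally show "ennreal ((norm (g n x))\<^sup>2) \<le> ennreal ((B + 2) * w x)" by (rule ennreal_leI)
    qed
    have "norm ((B + 2) * w x) = (B + 2) * w x" for x using B(1) w0[of x] by simp
    moreover have "integrable (\<mu> k) (\<lambda>x. (B + 2) * w x)" using w by simp
    ultimately show "(\<integral>\<^sup>+x. ennreal ((B + 2) * w x) \<partial>\<mu> k) < \<infinity>"
      unfolding integrable_iff_bounded by (simp only:)
    show "AE x in \<mu> k. (\<lambda>n. ennreal ((norm (g n x))\<^sup>2)) \<longlonglongrightarrow> ennreal ((norm (f x))\<^sup>2)"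
      using lim' by eventually_elim (intro tendsto_intros)
  qed auto
  have iso: "(\<integral>\<^sup>+\<xi>. ennreal ((norm (dunkl_transform k (g n) \<xi>))\<^sup>2) \<partial>\<mu> k)
      = (\<integral>\<^sup>+x. ennreal ((norm (g n x))\<^sup>2) \<partial>\<mu> k)" for n
  proof -
    obtain I :: "(bool \<times> bool \<times> nat) set" and c where "finite I"
      "g n = (\<lambda>x. \<Sum>j\<in>I. c j * of_real (gauss_atom (real (Suc (snd (snd j)))) (fst (snd j)) x))"
      using g[of n] unfolding gauss_span_def by blast
    then show ?thesis
      by (intro dunkl_transform_isometry_gauss[OF k, where t = "\<lambda>j. real (Suc (snd (snd j)))"]) auto
  qed
  have "(\<integral>\<^sup>+\<xi>. ennreal ((norm (dunkl_transform k f \<xi>))\<^sup>2) \<partial>\<mu> k)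
    = (\<integral>\<^sup>+\<xi>. liminf (\<lambda>n. ennreal ((norm (dunkl_transform k (g n) \<xi>))\<^sup>2)) \<partial>\<mu> k)"
    by (intro nn_integral_cong lim_imp_Liminf[symmetric] tendsto_intros T) auto
  also have "\<dots> \<le> liminf (\<lambda>n. \<integral>\<^sup>+\<xi>. ennreal ((norm (dunkl_transform k (g n) \<xi>))\<^sup>2) \<partial>\<mu> k)"
    using k1 by (intro nn_integral_liminf) measurable
  also have "\<dots> = (\<integral>\<^sup>+x. ennreal ((norm (f x))\<^sup>2) \<partial>\<mu> k)"
    unfolding iso by (intro lim_imp_Liminf S) auto
  finally show ?thesis .
qed

section \<open>The three lines theorem\<close>

text \<open>Phragmen-Lindelof argument: a factor exp(d (w^2 - c)) with d > 0 decays along the strip,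
  the maximum modulus principle applies on a large rectangle, and then d tends to 0.\<close>

lemma three_lines:
  assumes hol: "F holomorphic_on {z. a < Re z \<and> Re z < b}"
    and cont: "continuous_on {z. a \<le> Re z \<and> Re z \<le> b} F"
    and bdd: "\<And>z. a \<le> Re z \<Longrightarrow> Re z \<le> b \<Longrightarrow> norm (F z) \<le> K"
    and bdry: "\<And>z. Re z = a \<or> Re z = b \<Longrightarrow> norm (F z) \<le> 1"
    and z: "a \<le> Re z" "Re z \<le> b"
  shows "norm (F z) \<le> 1"
proof -
  \<comment> \<open>It dominates the square of the real part on the strip, so the damping factor has
    modulus at most 1 there.\<close>
  define c where "c = a\<^sup>2 + b\<^sup>2"
  have c: "(Re w)\<^sup>2 \<le> c" if "a \<le> Re w" "Re w \<le> b" for w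
  proof -
    have "\<bar>Re w\<bar> \<le> max \<bar>a\<bar> \<bar>b\<bar>" using that by linarith
    then have "\<bar>Re w\<bar> ^ 2 \<le> (max \<bar>a\<bar> \<bar>b\<bar>) ^ 2" by (intro power_mono) auto
    also have "\<dots> \<le> c" by (auto simp: c_def max_def)
    finally show ?thesis by simp
  qed
  have key: "norm (F z) * exp (d * ((Re z)\<^sup>2 - (Im z)\<^sup>2 - c)) \<le> 1" if d: "d > 0" for d
  proof -
    define G where "G = (\<lambda>w. F w * exp (of_real d * (w\<^sup>2 - of_real c)))"
    have normG: "norm (G w) = norm (F w) * exp (d * ((Re w)\<^sup>2 - (Im w)\<^sup>2 - c))" for w
      by (simp add: G_def norm_mult power2_eq_square)
    have K0: "K \<ge> 0" using bdd[OF z] norm_ge_zero order_trans by blast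
    \<comment> \<open>The height is chosen so that K \<le> 1 + d Y^2 \<le> exp(d Y^2), which bounds
      the damped function by 1 on the horizontal sides, and so that z lies in the rectangle.\<close>
    define Y where "Y = sqrt (K / d) + \<bar>Im z\<bar> + 1"
    have Y: "Y > 0" "\<bar>Im z\<bar> < Y" "K \<le> exp (d * Y\<^sup>2)"
    proof -
      have s: "sqrt (K / d) \<ge> 0" using K0 d by simp
      then show "Y > 0" "\<bar>Im z\<bar> < Y" unfolding Y_def by linarith+
      have "K / d = (sqrt (K / d))\<^sup>2" using K0 d by simp
      also have "\<dots> \<le> Y\<^sup>2" using s by (intro power_mono) (auto simp: Y_def)
      finally have "K \<le> 1 + d * Y\<^sup>2" using d by (simp add: field_simps)
      also have "\<dots> \<le> exp (d * Y\<^sup>2)" by (rule exp_ge_add_one_self)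
      finally show "K \<le> exp (d * Y\<^sup>2)" .
    qed
    define S where "S = cbox (Complex a (- Y)) (Complex b Y)"
    have S: "w \<in> S \<longleftrightarrow> a \<le> Re w \<and> Re w \<le> b \<and> - Y \<le> Im w \<and> Im w \<le> Y" for w
      by (auto simp: S_def in_cbox_complex_iff)
    have intS: "interior S = box (Complex a (- Y)) (Complex b Y)" by (simp add: S_def interior_cbox)
    have sub: "interior S \<subseteq> {z. a < Re z \<and> Re z < b}"
      unfolding intS by (auto simp: in_box_complex_iff)
    have clS: "closure S = S" by (simp add: S_def)
    have "norm (G z) \<le> 1"
    proof (rule maximum_modulus_frontier[of G S 1])
      show "G holomorphic_on interior S"
        unfolding G_def by (intro holomorphic_intros holomorphic_on_subset[OF hol sub])
      have "S \<subseteq> {z. a \<le> Re z \<and> Re z \<le> b}" by (auto simp: S)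
      then show "continuous_on (closure S) G"
        unfolding clS G_def by (intro continuous_intros continuous_on_subset[OF cont])
      show "bounded S" by (simp add: S_def)
      show "z \<in> S" using z Y by (auto simp: S)
      fix w assume "w \<in> frontier S"
      then have "w \<in> S" "w \<notin> interior S" by (auto simp: frontier_def clS)
      then have w: "a \<le> Re w" "Re w \<le> b" "Re w = a \<or> Re w = b \<or> Im w = Y \<or> Im w = - Y"
        unfolding intS by (auto simp: S in_box_complex_iff)
      have le: "d * ((Re w)\<^sup>2 - (Im w)\<^sup>2 - c) \<le> d * - (Im w)\<^sup>2"
        using c[OF w(1,2)] d by (intro mult_left_mono) auto
      show "norm (G w) \<le> 1"
      proof (cases "Re w = a \<or> Re w = b")
        case True
        have "norm (F w) * exp (d * ((Re w)\<^sup>2 - (Im w)\<^sup>2 - c)) \<le> 1 * 1"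
          using bdry[OF True] le d by (intro mult_mono) (auto intro: order_trans)
        then show ?thesis by (simp add: normG)
      next
        case False
        then have "(Im w)\<^sup>2 = Y\<^sup>2" using w(3) by auto
        then have "norm (F w) * exp (d * ((Re w)\<^sup>2 - (Im w)\<^sup>2 - c)) \<le> K * exp (d * - Y\<^sup>2)"
          using bdd[OF w(1,2)] le K0 by (intro mult_mono) auto
        also have "\<dots> \<le> 1" using Y(3) by (simp add: exp_minus field_simps)
        finally show ?thesis by (simp add: normG)
      qed
    qed
    then show ?thesis by (simp add: normG)
  qed
  have "(\<lambda>n. norm (F z) * exp (1 / real (Suc n) * ((Re z)\<^sup>2 - (Im z)\<^sup>2 - c))) \<longlonglongrightarrow>
      norm (F z) * exp (0 * ((Re z)\<^sup>2 - (Im z)\<^sup>2 - c))"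
    using LIMSEQ_inverse_real_of_nat by (intro tendsto_intros) (simp add: inverse_eq_divide)
  then have "(\<lambda>n. norm (F z) * exp (1 / real (Suc n) * ((Re z)\<^sup>2 - (Im z)\<^sup>2 - c))) \<longlonglongrightarrow> norm (F z)"
    by (simp only: mult_zero_left exp_zero mult_1_right)
  then show ?thesis
    by (rule LIMSEQ_le_const2) (intro exI allI impI key, simp)
qed

section \<open>The Hausdorff--Young inequality for the Dunkl transform\<close>

text \<open>The endpoint p = 1 of the bilinear estimate: the transform is bounded by the L^1 norm
  because the kernel is bounded by 1.\<close>

lemma integrable_dunkl_transform_mult:
  assumes k: "k \<ge> - 1 / 2" and f: "integrable (\<mu> k) f" and g: "integrable (\<mu> k) g"
  shows "integrable (\<mu> k) (\<lambda>\<xi>. dunkl_transform k f \<xi> * g \<xi>)"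
    and "norm (LINT \<xi>|\<mu> k. dunkl_transform k f \<xi> * g \<xi>)
      \<le> (LINT x|\<mu> k. norm (f x)) * (LINT x|\<mu> k. norm (g x))"
proof -
  define C where "C = (LINT x|\<mu> k. norm (f x))"
  have C0: "C \<ge> 0" by (simp add: C_def)
  have [measurable]: "f \<in> borel_measurable borel" "g \<in> borel_measurable borel"
    using borel_measurable_integrable[OF f] borel_measurable_integrable[OF g] by simp_all
  have g': "integrable (\<mu> k) (\<lambda>\<xi>. C * norm (g \<xi>))" using g by simp
  have le: "norm (dunkl_transform k f \<xi> * g \<xi>) \<le> C * norm (g \<xi>)" for \<xi>
    unfolding norm_mult C_def using norm_dunkl_transform_le[OF k f] by (intro mult_right_mono) auto
  show int: "integrable (\<mu> k) (\<lambda>\<xi>. dunkl_transform k f \<xi> * g \<xi>)"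
    by (rule Bochner_Integration.integrable_bound[OF g'])
      (use k le C0 in \<open>auto intro!: AE_I2 order_trans[OF le]\<close>)
  have "norm (LINT \<xi>|\<mu> k. dunkl_transform k f \<xi> * g \<xi>)
      \<le> (LINT \<xi>|\<mu> k. norm (dunkl_transform k f \<xi> * g \<xi>))"
    by (rule integral_norm_bound)
  also have "\<dots> \<le> (LINT \<xi>|\<mu> k. C * norm (g \<xi>))"
    by (intro integral_mono integrable_norm int g' le)
  finally show "norm (LINT \<xi>|\<mu> k. dunkl_transform k f \<xi> * g \<xi>)
      \<le> (LINT x|\<mu> k. norm (f x)) * (LINT x|\<mu> k. norm (g x))"
    by (simp add: C_def)
qed

section \<open>Interpolation for functions with finite range\<close>

lemma bdd_supp_measurable: "bdd_supp f \<Longrightarrow> f \<in> borel_measurable borel"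
  by (simp add: bdd_supp_def)

text \<open>A measurable function with finite range is simple, and composing it with any map keeps
  it simple; \<open>h 0 = 0\<close> preserves the support.\<close>

lemma bdd_supp_comp:
  assumes f: "bdd_supp f" and fin: "finite (range f)" and 0: "h 0 = (0::complex)"
  shows "bdd_supp (\<lambda>x. h (f x))" "finite (range (\<lambda>x. h (f x)))"
proof -
  obtain R where [measurable]: "f \<in> borel_measurable borel" and R: "0 < R" "\<And>x. R < \<bar>x\<bar> \<Longrightarrow> f x = 0"
    using f unfolding bdd_supp_def by auto
  have "range (\<lambda>x. h (f x)) = h ` range f" by auto
  then show fin': "finite (range (\<lambda>x. h (f x)))" using fin by simp
  have "simple_function borel f" using fin by (intro simple_function_borel_measurable) auto
  then have "simple_function borel (\<lambda>x. h (f x))"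
    by (rule simple_function_compose1)
  then have "(\<lambda>x. h (f x)) \<in> borel_measurable borel" by (rule borel_measurable_simple_function)
  moreover obtain B where "\<And>x. norm (h (f x)) \<le> B"
    using finite_imp_bounded[OF fin'] by (auto simp: bounded_iff)
  then have "0 < max B 1 \<and> (\<forall>x. norm (h (f x)) \<le> max B 1)" by (auto intro: max.coboundedI1)
  ultimately show "bdd_supp (\<lambda>x. h (f x))"
    unfolding bdd_supp_def using R 0
    by (intro conjI exI[of _ "max B 1"] exI[of _ R]) auto
qed

text \<open>The Riesz-Thorin family: the phase of c times the modulus raised to the complex power p
  w. It is entire in w, and w = 1/p returns c.\<close>

definition cpow :: "real \<Rightarrow> complex \<Rightarrow> complex \<Rightarrow> complex" where
  "cpow p c w = (if c = 0 then 0 else c / of_real (norm c) * exp (of_real (p * ln (norm c)) * w))"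

lemma norm_cpow: "norm (cpow p c w) = norm c powr (p * Re w)"
  by (auto simp: cpow_def norm_mult norm_divide powr_def mult_ac)

lemma cpow_0 [simp]: "cpow p 0 w = 0" by (simp add: cpow_def)

lemma cpow_inverse: "p \<noteq> 0 \<Longrightarrow> cpow p c (of_real (1 / p)) = c"
proof -
  assume "p \<noteq> 0"
  then have "complex_of_real (p * ln (norm c)) * of_real (1 / p) = of_real (ln (norm c))"
    unfolding of_real_mult[symmetric] by simp
  then show ?thesis unfolding cpow_def by (simp only: exp_of_real) simp
qed

lemma holomorphic_cpow: "(\<lambda>w. cpow p c w) holomorphic_on S"
proof (cases "c = 0")
  case False
  have "(\<lambda>w. c / of_real (norm c) * exp (of_real (p * ln (norm c)) * w)) holomorphic_on S"
    by (rule holomorphic_on_mult[OF holomorphic_on_const]) (intro holomorphic_intros)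
  then show ?thesis using False by (simp add: cpow_def)
qed simp

lemma sum_over_range:
  fixes f :: "real \<Rightarrow> complex" and h :: "complex \<Rightarrow> complex"
  assumes "finite (range f)" "h 0 = 0"
  shows "h (f x) = (\<Sum>c\<in>range f - {0}. h c * indicator (f -` {c}) x)"
proof (cases "f x = 0")
  case True
  then show ?thesis using assms by (auto simp: indicator_def intro!: sum.neutral[symmetric])
next
  case False
  have "(\<Sum>c\<in>range f - {0}. h c * indicator (f -` {c}) x) = (\<Sum>c\<in>range f - {0}. if f x = c then h c else 0)"
    by (intro sum.cong) (auto simp: indicator_def)
  then show ?thesis using assms False by (simp add: sum.delta')
qed

lemma bdd_supp_powr:
  assumes k: "k > -1" and f: "bdd_supp f" and p: "p > 0"
  shows "integrable (\<mu> k) (\<lambda>x. norm (f x) powr p)"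
proof -
  obtain B R where [measurable]: "f \<in> borel_measurable borel" and B: "\<And>x. norm (f x) \<le> B"
    and R: "0 < R" "\<And>x. R < \<bar>x\<bar> \<Longrightarrow> f x = 0" "0 < B"
    using f unfolding bdd_supp_def by auto
  have "bdd_supp (\<lambda>x. of_real (norm (f x) powr p))"
    unfolding bdd_supp_def
  proof (intro conjI exI allI impI)
    show "norm (complex_of_real (norm (f x) powr p)) \<le> B powr p" for x
      using B[of x] p by (simp add: powr_mono2)
  qed (use R p in auto)
  from integrable_norm[OF integrable_bdd_supp[OF k this]] show ?thesis by simp
qed

text \<open>Both arguments carry the same exponent p, because testing against L^p measures the L^q
  norm. The number 1/p lies between the line Re w = 1, where both families have L^1 norm at most 1,
  and the line Re w = 1/2, where both have L^2 norm at most 1.\<close>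

lemma hausdorff_young_bilinear_normalized:
  assumes k: "k \<ge> - 1 / 2" and p: "1 \<le> p" "p \<le> 2"
    and f: "bdd_supp f" "finite (range f)" and g: "bdd_supp g" "finite (range g)"
    and f1: "(LINT x|\<mu> k. norm (f x) powr p) \<le> 1"
    and g1: "(LINT x|\<mu> k. norm (g x) powr p) \<le> 1"
  shows "norm (LINT \<xi>|\<mu> k. dunkl_transform k f \<xi> * g \<xi>) \<le> 1"
proof -
  have k1: "k > -1" using k by auto
  define F where "F = (\<lambda>w. LINT \<xi>|\<mu> k. dunkl_transform k (\<lambda>x. cpow p (f x) w) \<xi> * cpow p (g \<xi>) w)"
  have bf: "bdd_supp (\<lambda>x. cpow p (f x) w)" and bg: "bdd_supp (\<lambda>x. cpow p (g x) w)" for w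
    using bdd_supp_comp(1)[OF f, of "\<lambda>c. cpow p c w"] bdd_supp_comp(1)[OF g, of "\<lambda>c. cpow p c w"] by auto
  have If: "integrable (\<mu> k) (\<lambda>x. cpow p (f x) w)"
    and Ig: "integrable (\<mu> k) (\<lambda>x. cpow p (g x) w)" for w
    using bf bg by (auto intro!: integrable_bdd_supp k1)
  define ind :: "(real \<Rightarrow> complex) \<Rightarrow> complex \<Rightarrow> real \<Rightarrow> complex"
    where "ind = (\<lambda>f c. indicator (f -` {c}))"
  \<comment> \<open>A nonzero value has a bounded level set, whereas the zero level contains
    everything outside the support.\<close>
  have indI: "integrable (\<mu> k) (ind h c)" if h: "bdd_supp h" "finite (range h)" and c: "c \<noteq> 0" for h c
  proof -
    have "ind h c = (\<lambda>x. (\<lambda>z. if z = c then 1 else 0) (h x))"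
      by (auto simp: ind_def indicator_def fun_eq_iff)
    then have "bdd_supp (ind h c)"
      using bdd_supp_comp(1)[OF h, of "\<lambda>z. if z = c then 1 else 0"] c by simp
    then show ?thesis by (rule integrable_bdd_supp[OF k1])
  qed
  define A where "A = (\<lambda>c d. LINT \<xi>|\<mu> k. dunkl_transform k (ind f c) \<xi> * ind g d \<xi>)"
  \<comment> \<open>By finiteness of the ranges, w enters only through finitely many exponentials;
    holomorphy and continuity on the strip follow at once.\<close>
  have F_sum: "F w = (\<Sum>c\<in>range f - {0}. \<Sum>d\<in>range g - {0}. cpow p c w * cpow p d w * A c d)" for w
  proof -
    have "dunkl_transform k (\<lambda>x. cpow p (f x) w) \<xi>
        = (\<Sum>c\<in>range f - {0}. cpow p c w * dunkl_transform k (ind f c) \<xi>)" for \<xi>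
    proof -
      have "(\<lambda>x. cpow p (f x) w) = (\<lambda>x. \<Sum>c\<in>range f - {0}. cpow p c w * ind f c x)"
        using sum_over_range[OF f(2), of "\<lambda>c. cpow p c w"] by (simp add: ind_def)
      then have "dunkl_transform k (\<lambda>x. cpow p (f x) w) \<xi>
        = (\<Sum>c\<in>range f - {0}. dunkl_transform k (\<lambda>x. cpow p c w * ind f c x) \<xi>)"
        by (simp only:) (intro dunkl_transform_sum k integrable_mult_right indI[OF f], simp)
      then show ?thesis by (simp add: dunkl_transform_cmult)
    qed
    moreover have "cpow p (g \<xi>) w = (\<Sum>d\<in>range g - {0}. cpow p d w * ind g d \<xi>)" for \<xi>
      using sum_over_range[OF g(2), of "\<lambda>c. cpow p c w"] by (simp add: ind_def)
    ultimately have "F w = (LINT \<xi>|\<mu> k. (\<Sum>c\<in>range f - {0}. \<Sum>d\<in>range g - {0}.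
        cpow p c w * cpow p d w * (dunkl_transform k (ind f c) \<xi> * ind g d \<xi>)))"
      unfolding F_def
      by (intro Bochner_Integration.integral_cong refl) (simp only: sum_product, intro sum.cong refl, simp only: mult_ac)
    also have "\<dots> = (\<Sum>c\<in>range f - {0}. \<Sum>d\<in>range g - {0}.
        LINT \<xi>|\<mu> k. cpow p c w * cpow p d w * (dunkl_transform k (ind f c) \<xi> * ind g d \<xi>))"
      by (intro trans[OF Bochner_Integration.integral_sum] sum.cong refl Bochner_Integration.integrable_sum
          integrable_mult_right integrable_dunkl_transform_mult(1) k indI f g) auto
    finally show ?thesis by (simp add: A_def)
  qed
  have nf: "(LINT x|\<mu> k. norm (cpow p (f x) w)) \<le> 1"
    and ng: "(LINT x|\<mu> k. norm (cpow p (g x) w)) \<le> 1" if "Re w = 1" for w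
    using f1 g1 that by (simp_all add: norm_cpow)
  have line1: "norm (F w) \<le> 1" if "Re w = 1" for w
  proof -
    have "norm (F w) \<le> (LINT x|\<mu> k. norm (cpow p (f x) w)) * (LINT x|\<mu> k. norm (cpow p (g x) w))"
      unfolding F_def by (rule integrable_dunkl_transform_mult(2)[OF k If Ig])
    also have "\<dots> \<le> 1 * 1" by (intro mult_mono nf ng that) auto
    finally show ?thesis by simp
  qed
  \<comment> \<open>Here the squared modulus of each family is the p-th power of the given modulus.
    As both L^2 norms are at most 1, the inequality 2 a b \<le> a^2 + b^2 does the work of
    Cauchy-Schwarz.\<close>
  have line2: "norm (F w) \<le> 1" if w: "Re w = 1 / 2" for w
  proof -
    have sq: "(norm (cpow p c w))\<^sup>2 = norm c powr p" for c
      unfolding norm_cpow w by (simp add: power2_eq_square powr_add[symmetric])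
    have sf: "(\<integral>\<^sup>+x. ennreal ((norm (cpow p (h x) w))\<^sup>2) \<partial>\<mu> k) \<le> 1"
      if h: "bdd_supp h" and h1: "(LINT x|\<mu> k. norm (h x) powr p) \<le> 1" for h
    proof -
      have "(\<integral>\<^sup>+x. ennreal ((norm (cpow p (h x) w))\<^sup>2) \<partial>\<mu> k)
          = ennreal (LINT x|\<mu> k. norm (h x) powr p)"
        unfolding sq using p by (intro nn_integral_eq_integral bdd_supp_powr k1 h) auto
      then show ?thesis using h1 by (simp add: ennreal_le_1)
    qed
    have [measurable]: "(\<lambda>x. cpow p (f x) w) \<in> borel_measurable borel" "(\<lambda>x. cpow p (g x) w) \<in> borel_measurable borel"
      using bf bg by (auto intro: bdd_supp_measurable)
    have tf: "(\<integral>\<^sup>+x. ennreal ((norm (dunkl_transform k (\<lambda>x. cpow p (f x) w) x))\<^sup>2) \<partial>\<mu> k) \<le> 1"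
      by (rule order_trans[OF dunkl_transform_contraction[OF k bf] sf[OF f(1) f1]])
    let ?h = "\<lambda>\<xi>. dunkl_transform k (\<lambda>x. cpow p (f x) w) \<xi>" and ?g = "\<lambda>\<xi>. cpow p (g \<xi>) w"
    have "ennreal (norm (F w)) \<le> (\<integral>\<^sup>+\<xi>. ennreal (norm (?h \<xi> * ?g \<xi>)) \<partial>\<mu> k)"
      unfolding F_def by (rule integral_norm_bound_ennreal[OF integrable_dunkl_transform_mult(1)[OF k If Ig]])
    also have "\<dots> \<le> (\<integral>\<^sup>+\<xi>. ennreal (1 / 2) * (ennreal ((norm (?h \<xi>))\<^sup>2) + ennreal ((norm (?g \<xi>))\<^sup>2)) \<partial>\<mu> k)"
    proof (rule nn_integral_mono)
      fix \<xi>
      have "norm (?h \<xi> * ?g \<xi>) \<le> 1 / 2 * ((norm (?h \<xi>))\<^sup>2 + (norm (?g \<xi>))\<^sup>2)"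
        using sum_squares_bound[of "norm (?h \<xi>)" "norm (?g \<xi>)"] by (simp add: norm_mult)
      then show "ennreal (norm (?h \<xi> * ?g \<xi>)) \<le> ennreal (1 / 2) * (ennreal ((norm (?h \<xi>))\<^sup>2) + ennreal ((norm (?g \<xi>))\<^sup>2))"
        by (subst ennreal_plus[symmetric], simp, simp, subst ennreal_mult'[symmetric], simp, rule ennreal_leI)
    qed
    also have "\<dots> = ennreal (1 / 2) * ((\<integral>\<^sup>+\<xi>. ennreal ((norm (?h \<xi>))\<^sup>2) \<partial>\<mu> k) + (\<integral>\<^sup>+\<xi>. ennreal ((norm (?g \<xi>))\<^sup>2) \<partial>\<mu> k))"
      using k1 by (subst nn_integral_cmult, measurable, subst nn_integral_add, measurable)
    also have "\<dots> \<le> ennreal (1 / 2) * (1 + 1)"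
      by (intro mult_left_mono add_mono tf sf[OF g(1) g1]) auto
    also have "(1::ennreal) + 1 = ennreal 2" by simp
    also have "ennreal (1 / 2) * ennreal 2 = ennreal (1 / 2 * 2)" by (rule ennreal_mult'[symmetric]) simp
    also have "\<dots> = ennreal 1" by simp
    finally show ?thesis by (simp add: ennreal_le_iff del: ennreal_1)
  qed
  \<comment> \<open>A crude bound on the closed strip: the exponent p Re w stays between 0 and p
    there, so each modulus power is at most 1 plus the p-th power.\<close>
  define K where "K = (\<Sum>c\<in>range f - {0}. \<Sum>d\<in>range g - {0}. (1 + norm c powr p) * (1 + norm d powr p) * norm (A c d))"
  have cpow_le: "norm (cpow p c w) \<le> 1 + norm c powr p" if "1 / 2 \<le> Re w" "Re w \<le> 1" for c w
  proof (cases "norm c \<le> 1")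
    case True
    then have "norm c powr (p * Re w) \<le> 1" using that p by (intro powr_le1) auto
    then show ?thesis by (simp add: norm_cpow add_increasing2)
  next
    case False
    then have "norm c powr (p * Re w) \<le> norm c powr (p * 1)"
      using that p by (intro powr_mono mult_left_mono) auto
    then show ?thesis by (simp add: norm_cpow)
  qed
  have "norm (F (of_real (1 / p))) \<le> 1"
  proof (rule three_lines[where F = F and a = "1 / 2" and b = 1 and K = K])
    show "F holomorphic_on {z. 1 / 2 < Re z \<and> Re z < 1}"
      unfolding F_sum[abs_def] by (intro holomorphic_intros holomorphic_cpow)
    show "continuous_on {z. 1 / 2 \<le> Re z \<and> Re z \<le> 1} F"
      unfolding F_sum[abs_def]
      by (intro continuous_intros holomorphic_on_imp_continuous_on[OF holomorphic_cpow])
    fix z assume z: "1 / 2 \<le> Re z" "Re z \<le> 1"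
    show "norm (F z) \<le> K"
      unfolding F_sum K_def
      by (intro sum_norm_le) (auto simp: norm_mult intro!: mult_mono cpow_le z add_nonneg_nonneg)
  next
    fix z :: complex assume "Re z = 1 / 2 \<or> Re z = 1"
    then show "norm (F z) \<le> 1" using line1 line2 by auto
  qed (use p in \<open>auto simp: field_simps\<close>)
  moreover have "F (of_real (1 / p)) = (LINT \<xi>|\<mu> k. dunkl_transform k f \<xi> * g \<xi>)"
    unfolding F_def using p by (subst (1 2) cpow_inverse) auto
  ultimately show ?thesis by simp
qed

section \<open>The bilinear estimate for bounded functions\<close>

definition Lp_bdd :: "real \<Rightarrow> real \<Rightarrow> (real \<Rightarrow> complex) \<Rightarrow> real" where
  "Lp_bdd k p f = (LINT x|\<mu> k. norm (f x) powr p) powr (1 / p)"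

lemma bdd_supp_cmult: "bdd_supp f \<Longrightarrow> bdd_supp (\<lambda>x. c * f x)"
proof -
  assume "bdd_supp f"
  then obtain B R where [measurable]: "f \<in> borel_measurable borel" and B: "0 < B" "\<And>x. norm (f x) \<le> B"
    and R: "0 < R" "\<And>x. R < \<bar>x\<bar> \<Longrightarrow> f x = 0"
    unfolding bdd_supp_def by auto
  have "norm (c * f x) \<le> (norm c + 1) * B" for x
    unfolding norm_mult using B(2)[of x] by (intro mult_mono) auto
  moreover have "0 < (norm c + 1) * B" using B(1) by (intro mult_pos_pos add_nonneg_pos) auto
  ultimately show ?thesis
    unfolding bdd_supp_def using R by (intro conjI exI[of _ "(norm c + 1) * B"] exI[of _ R]) auto
qed

lemma integral_powr_eq_0_imp:
  fixes f :: "real \<Rightarrow> complex"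
  assumes k: "k > -1" and f: "bdd_supp f" and p: "p > 0"
    and 0: "(LINT x|\<mu> k. norm (f x) powr p) = 0"
  shows "AE x in \<mu> k. f x = 0"
proof -
  have "AE x in \<mu> k. norm (f x) powr p = 0"
    using 0 by (subst (asm) integral_nonneg_eq_0_iff_AE[OF bdd_supp_powr[OF k f p]]) auto
  then show ?thesis by eventually_elim simp
qed

text \<open>Homogeneity allows division by the norms. A function of norm 0 vanishes almost
  everywhere, and then so does the form.\<close>

lemma hausdorff_young_bilinear_simple:
  assumes k: "k \<ge> - 1 / 2" and p: "1 \<le> p" "p \<le> 2"
    and f: "bdd_supp f" "finite (range f)" and g: "bdd_supp g" "finite (range g)"
  shows "norm (LINT \<xi>|\<mu> k. dunkl_transform k f \<xi> * g \<xi>) \<le> Lp_bdd k p f * Lp_bdd k p g"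
proof -
  have k1: "k > -1" using k by auto
  have fm: "f \<in> borel_measurable borel" "g \<in> borel_measurable borel"
    using f g by (auto intro: bdd_supp_measurable)
  define a b where "a = (LINT x|\<mu> k. norm (f x) powr p)" and "b = (LINT x|\<mu> k. norm (g x) powr p)"
  have ab0: "a \<ge> 0" "b \<ge> 0" by (auto simp: a_def b_def)
  consider "a = 0" | "b = 0" | "a > 0" "b > 0" using ab0 by linarith
  then show ?thesis
  proof cases
    case 1
    then have "AE x in \<mu> k. f x = 0"
      using p integral_powr_eq_0_imp[OF k1 f(1), of p] by (simp add: a_def)
    then have "dunkl_transform k f \<xi> = 0" for \<xi>
      unfolding dunkl_transform_def by (intro integral_eq_zero_AE) (elim eventually_mono, simp)
    then show ?thesis by (simp add: Lp_bdd_def)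
  next
    case 2
    then have "AE x in \<mu> k. g x = 0"
      using p integral_powr_eq_0_imp[OF k1 g(1), of p] by (simp add: b_def)
    then have "(LINT \<xi>|\<mu> k. dunkl_transform k f \<xi> * g \<xi>) = 0"
      by (intro integral_eq_zero_AE) (elim eventually_mono, simp)
    then show ?thesis by (simp add: Lp_bdd_def)
  next
    case 3
    define A where "A = a powr (1 / p)"
    define B where "B = b powr (1 / p)"
    have AB: "A > 0" "B > 0" using 3 by (auto simp: A_def B_def)
    have nrm: "(LINT x|\<mu> k. norm (of_real (inverse (c powr (1 / p))) * h x :: complex) powr p) = 1"
      if "c > 0" "c = (LINT x|\<mu> k. norm (h x) powr p)" for h :: "real \<Rightarrow> complex" and c
    proof -
      have "norm (of_real (inverse (c powr (1 / p))) * h x :: complex) powr p = inverse c * norm (h x) powr p" for x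
      proof -
        have "norm (of_real (inverse (c powr (1 / p))) * h x :: complex) = inverse c powr (1 / p) * norm (h x)"
          using that(1) unfolding norm_mult norm_of_real by (simp add: inverse_powr)
        then show ?thesis using that(1) p by (simp only: powr_mult powr_powr) simp
      qed
      then show ?thesis using that by simp
    qed
    have "norm (LINT \<xi>|\<mu> k. dunkl_transform k (\<lambda>x. of_real (inverse A) * f x) \<xi> * (of_real (inverse B) * g \<xi>)) \<le> 1"
    proof (rule hausdorff_young_bilinear_normalized[OF k p])
      show "finite (range (\<lambda>x. of_real (inverse A) * f x))" "finite (range (\<lambda>x. of_real (inverse B) * g x))"
        using f(2) g(2) by (auto intro: finite_range_imageI)
    qed (use f g nrm[OF 3(1) a_def] nrm[OF 3(2) b_def] in \<open>auto simp: A_def B_def intro!: bdd_supp_cmult\<close>)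
    moreover have "(LINT \<xi>|\<mu> k. dunkl_transform k (\<lambda>x. of_real (inverse A) * f x) \<xi> * (of_real (inverse B) * g \<xi>))
        = of_real (inverse A * inverse B) * (LINT \<xi>|\<mu> k. dunkl_transform k f \<xi> * g \<xi>)"
      unfolding dunkl_transform_cmult integral_mult_right_zero[symmetric] of_real_mult
      by (simp only: mult_ac)
    ultimately have "inverse A * inverse B * norm (LINT \<xi>|\<mu> k. dunkl_transform k f \<xi> * g \<xi>) \<le> 1"
      using AB by (simp only: norm_mult norm_of_real abs_mult abs_of_pos positive_imp_inverse_positive)
    then show ?thesis using AB by (simp add: Lp_bdd_def A_def B_def a_def b_def field_simps)
  qed
qed

lemma bdd_supp_simple_sequence:
  assumes f: "bdd_supp f"
  obtains s where "\<And>n. bdd_supp (s n)" "\<And>n. finite (range (s n))"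
    "\<And>x. (\<lambda>n. s n x) \<longlonglongrightarrow> f x" "\<And>n x. norm (s n x) \<le> 2 * norm (f x)"
proof -
  obtain B R where fm: "f \<in> borel_measurable borel" and B: "0 < B" "\<And>x. norm (f x) \<le> B"
    and R: "0 < R" "\<And>x. R < \<bar>x\<bar> \<Longrightarrow> f x = 0"
    using f unfolding bdd_supp_def by auto
  obtain s where s: "\<And>n. simple_function borel (s n)" "\<And>x. (\<lambda>n. s n x) \<longlonglongrightarrow> f x"
    "\<And>n x. norm (s n x) \<le> 2 * norm (f x)"
    using borel_measurable_implies_sequence_metric[OF fm, of 0] by (auto simp: dist_norm)
  have "bdd_supp (s n)" for n
    unfolding bdd_supp_def
  proof (intro conjI exI allI impI)
    show "s n \<in> borel_measurable borel" using s(1) by (rule borel_measurable_simple_function)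
    show "norm (s n x) \<le> 2 * B" for x using s(3)[of n x] B(2)[of x] by linarith
    show "s n x = 0" if "R < \<bar>x\<bar>" for x using s(3)[of n x] R(2)[OF that] by simp
  qed (use B R in auto)
  moreover have "finite (range (s n))" for n using simple_functionD(1)[OF s(1)] by simp
  ultimately show thesis using s that by blast
qed

lemma Lp_bdd_tendsto:
  assumes k: "k > -1" and p: "p > 0" and f: "bdd_supp f" and s: "\<And>n. bdd_supp (s n)"
    and lim: "\<And>x. (\<lambda>n. s n x) \<longlonglongrightarrow> f x" and bound: "\<And>n x. norm (s n x) \<le> 2 * norm (f x)"
  shows "(\<lambda>n. Lp_bdd k p (s n)) \<longlonglongrightarrow> Lp_bdd k p f"
proof -
  have [measurable]: "f \<in> borel_measurable borel" "\<And>n. s n \<in> borel_measurable borel"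
    using f s by (auto intro: bdd_supp_measurable)
  have "(\<lambda>n. LINT x|\<mu> k. norm (s n x) powr p) \<longlonglongrightarrow> (LINT x|\<mu> k. norm (f x) powr p)"
  proof (rule integral_dominated_convergence[where w = "\<lambda>x. 2 powr p * norm (f x) powr p"])
    show "integrable (\<mu> k) (\<lambda>x. 2 powr p * norm (f x) powr p)"
      using bdd_supp_powr[OF k f p] by simp
    show "AE x in \<mu> k. (\<lambda>n. norm (s n x) powr p) \<longlonglongrightarrow> norm (f x) powr p"
      using p by (intro AE_I2 tendsto_powr' tendsto_intros lim) auto
    show "AE x in \<mu> k. norm (norm (s n x) powr p) \<le> 2 powr p * norm (f x) powr p" for n
      using p bound by (intro AE_I2) (simp add: powr_mult[symmetric] powr_mono2)
  qed auto
  then show ?thesis unfolding Lp_bdd_def using p by (intro tendsto_powr' tendsto_intros) auto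
qed

text \<open>Simple approximants dominated by 2 |f| have transforms that converge pointwise and are
  uniformly bounded by C; with the integrable majorant of the second factor, dominated convergence
  passes to the limit on both sides.\<close>

lemma hausdorff_young_bilinear:
  assumes k: "k \<ge> - 1 / 2" and p: "1 \<le> p" "p \<le> 2" and f: "bdd_supp f" and g: "bdd_supp g"
  shows "norm (LINT \<xi>|\<mu> k. dunkl_transform k f \<xi> * g \<xi>) \<le> Lp_bdd k p f * Lp_bdd k p g"
proof -
  have k1: "k > -1" using k by auto
  obtain s where s: "\<And>n. bdd_supp (s n)" "\<And>n. finite (range (s n))"
    "\<And>x. (\<lambda>n. s n x) \<longlonglongrightarrow> f x" "\<And>n x. norm (s n x) \<le> 2 * norm (f x)"
    using bdd_supp_simple_sequence[OF f] by blast
  obtain t where t: "\<And>n. bdd_supp (t n)" "\<And>n. finite (range (t n))"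
    "\<And>x. (\<lambda>n. t n x) \<longlonglongrightarrow> g x" "\<And>n x. norm (t n x) \<le> 2 * norm (g x)"
    using bdd_supp_simple_sequence[OF g] by blast
  have [measurable]: "f \<in> borel_measurable borel" "g \<in> borel_measurable borel"
      "\<And>n. s n \<in> borel_measurable borel" "\<And>n. t n \<in> borel_measurable borel"
    using f g s t by (auto intro: bdd_supp_measurable)
  have If: "integrable (\<mu> k) (\<lambda>x. 2 * norm (f x))" and Ig: "integrable (\<mu> k) (\<lambda>x. 2 * norm (g x))"
    using integrable_bdd_supp[OF k1 f] integrable_bdd_supp[OF k1 g] by auto
  define C where "C = (LINT x|\<mu> k. 2 * norm (f x))"
  have sC: "norm (dunkl_transform k (s n) \<xi>) \<le> C" for n \<xi>
  proof -
    have "norm (dunkl_transform k (s n) \<xi>) \<le> (LINT x|\<mu> k. norm (s n x))"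
      by (rule norm_dunkl_transform_le[OF k integrable_bdd_supp[OF k1 s(1)]])
    also have "\<dots> \<le> C" unfolding C_def
      by (intro integral_mono integrable_norm integrable_bdd_supp[OF k1 s(1)] If s)
    finally show ?thesis .
  qed
  have "(\<lambda>n. LINT \<xi>|\<mu> k. dunkl_transform k (s n) \<xi> * t n \<xi>) \<longlonglongrightarrow>
      (LINT \<xi>|\<mu> k. dunkl_transform k f \<xi> * g \<xi>)"
  proof (rule integral_dominated_convergence[where w = "\<lambda>\<xi>. C * (2 * norm (g \<xi>))"])
    show "integrable (\<mu> k) (\<lambda>\<xi>. C * (2 * norm (g \<xi>)))"
      using Ig by (rule integrable_mult_right)
    show "AE \<xi> in \<mu> k. (\<lambda>n. dunkl_transform k (s n) \<xi> * t n \<xi>) \<longlonglongrightarrow> dunkl_transform k f \<xi> * g \<xi>"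
      by (intro AE_I2 tendsto_mult t dunkl_transform_tendsto[OF k If] s) (auto intro: s)
    show "AE \<xi> in \<mu> k. norm (dunkl_transform k (s n) \<xi> * t n \<xi>) \<le> C * (2 * norm (g \<xi>))" for n
    proof (rule AE_I2)
      fix \<xi>
      have "0 \<le> C" by (rule order_trans[OF norm_ge_zero sC])
      then show "norm (dunkl_transform k (s n) \<xi> * t n \<xi>) \<le> C * (2 * norm (g \<xi>))"
        unfolding norm_mult by (intro mult_mono sC t) auto
    qed
  qed (use k1 in auto)
  moreover have "(\<lambda>n. Lp_bdd k p (s n) * Lp_bdd k p (t n)) \<longlonglongrightarrow> Lp_bdd k p f * Lp_bdd k p g"
    using p by (intro tendsto_mult Lp_bdd_tendsto k1 f g s t) auto
  ultimately show ?thesis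
    by (rule LIMSEQ_le[OF tendsto_norm]) (intro exI allI impI hausdorff_young_bilinear_simple k p s t)
qed

text \<open>Testing against \<open>cnj h \<bar>h\<bar>\<^sup>q\<^sup>-\<^sup>2\<close>, cut off to a bounded interval, where \<open>h\<close> is the transform of \<open>f\<close>.\<close>

lemma hausdorff_young_bdd_supp:
  assumes k: "k \<ge> - 1 / 2" and p: "1 < p" "p \<le> 2" and q: "1 / p + 1 / q = 1" and f: "bdd_supp f"
  shows "(\<integral>\<^sup>+\<xi>. ennreal (norm (dunkl_transform k f \<xi>) powr q) \<partial>\<mu> k) \<le> ennreal (Lp_bdd k p f powr q)"
proof -
  have k1: "k > -1" using k by auto
  \<comment> \<open>The second identity makes the p-th power of the test function equal to the q-th
    power of the transform.\<close>
  have q': "q > 1" "(q - 1) * p = q"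
  proof -
    have "q \<noteq> 0" using q p by auto
    then show e: "(q - 1) * p = q" using q p by (simp add: field_simps)
    have "q * (p - 1) = p" using e by (simp add: algebra_simps)
    show "q > 1"
    proof (rule ccontr)
      assume "\<not> q > 1"
      then have "q * (p - 1) \<le> 1 * (p - 1)" using p by (intro mult_right_mono) auto
      then show False using \<open>q * (p - 1) = p\<close> by simp
    qed
  qed
  have [measurable]: "f \<in> borel_measurable borel" using f by (rule bdd_supp_measurable)
  define h where "h = dunkl_transform k f"
  have [measurable]: "h \<in> borel_measurable borel" unfolding h_def using k1 by measurable
  define C where "C = (LINT x|\<mu> k. norm (f x)) + 1"
  have C: "C > 0" "\<And>\<xi>. norm (h \<xi>) \<le> C"
  proof -
    show "C > 0" unfolding C_def by (intro add_nonneg_pos) auto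
    show "norm (h \<xi>) \<le> C" for \<xi>
      using norm_dunkl_transform_le[OF k integrable_bdd_supp[OF k1 f], of \<xi>] by (simp add: h_def C_def)
  qed
  have cut: "(\<integral>\<^sup>+\<xi>. ennreal (norm (h \<xi>) powr q) * indicator {-R..R} \<xi> \<partial>\<mu> k) \<le> ennreal (Lp_bdd k p f powr q)"
    if R: "R > 0" for R
  proof -
    define G where "G = (\<lambda>\<xi>. cnj (h \<xi>) * of_real (norm (h \<xi>) powr (q - 2)) * indicator {-R..R} \<xi>)"
    have nG: "norm (G \<xi>) = norm (h \<xi>) powr (q - 1) * indicator {-R..R} \<xi>" for \<xi>
    proof (cases "h \<xi> = 0")
      case False
      have "norm (h \<xi>) * norm (h \<xi>) powr (q - 2) = norm (h \<xi>) powr (1 + (q - 2))"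
        unfolding powr_add using False by simp
      then show ?thesis by (simp add: G_def norm_mult indicator_def)
    qed (simp add: G_def)
    have "bdd_supp G"
      unfolding bdd_supp_def
    proof (intro conjI exI allI impI)
      have "(\<lambda>x. cnj (h x)) \<in> borel_measurable borel" "(\<lambda>x. complex_of_real (norm (h x) powr (q - 2))) \<in> borel_measurable borel"
        by (auto intro!: measurable_compose[OF _ borel_measurable_continuous_onI[of cnj]]
            measurable_compose[OF _ borel_measurable_continuous_onI[of complex_of_real]] continuous_intros)
      then show "G \<in> borel_measurable borel" unfolding G_def by (intro borel_measurable_times) auto
      show "norm (G \<xi>) \<le> C powr (q - 1)" for \<xi>
        unfolding nG using C q' by (auto simp: indicator_def intro: powr_mono2)
      show "G x = 0" if "R < \<bar>x\<bar>" for x using that by (auto simp: G_def indicator_def)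
    qed (use C R in auto)
    note B = hausdorff_young_bilinear[OF k _ p(2) f this]
    have hG: "h \<xi> * G \<xi> = of_real (norm (h \<xi>) powr q * indicator {-R..R} \<xi>)" for \<xi>
    proof (cases "h \<xi> = 0")
      case False
      have "norm (h \<xi>) powr 2 * norm (h \<xi>) powr (q - 2) = norm (h \<xi>) powr q"
        unfolding powr_add[symmetric] by simp
      then have "(norm (h \<xi>))\<^sup>2 * norm (h \<xi>) powr (q - 2) = norm (h \<xi>) powr q"
        using False by (simp add: powr_numeral)
      then have "of_real ((norm (h \<xi>))\<^sup>2) * of_real (norm (h \<xi>) powr (q - 2)) = complex_of_real (norm (h \<xi>) powr q)"
        by (simp only: of_real_mult[symmetric])
      moreover have "h \<xi> * G \<xi> = (h \<xi> * cnj (h \<xi>)) * of_real (norm (h \<xi>) powr (q - 2)) * indicator {-R..R} \<xi>"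
        by (simp add: G_def mult_ac)
      ultimately have "h \<xi> * G \<xi> = of_real (norm (h \<xi>) powr q) * indicator {-R..R} \<xi>"
        by (simp only: complex_norm_square[symmetric])
      then show ?thesis by (simp add: indicator_def)
    qed (simp add: G_def)
    have Gp: "norm (G \<xi>) powr p = norm (h \<xi>) powr q * indicator {-R..R} \<xi>" for \<xi>
      unfolding nG using q' by (simp add: indicator_def powr_powr)
    \<comment> \<open>The mass of the transform on the bounded interval. The cutoff makes it finite,
      which the division by \<open>X powr (1 / p)\<close> below relies on.\<close>
    define X where "X = (LINT \<xi>|\<mu> k. norm (h \<xi>) powr q * indicator {-R..R} \<xi>)"
    have X0: "X \<ge> 0" unfolding X_def by (intro Bochner_Integration.integral_nonneg) auto
    have IX: "integrable (\<mu> k) (\<lambda>\<xi>. norm (h \<xi>) powr q * indicator {-R..R} \<xi>)"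
      using bdd_supp_powr[OF k1 \<open>bdd_supp G\<close>, of p] p unfolding Gp by simp
    have "X \<le> Lp_bdd k p f * X powr (1 / p)"
    proof -
      have "(LINT \<xi>|\<mu> k. h \<xi> * G \<xi>) = of_real X"
        unfolding hG X_def by (rule integral_complex_of_real)
      moreover have "norm (LINT \<xi>|\<mu> k. h \<xi> * G \<xi>) \<le> Lp_bdd k p f * Lp_bdd k p G"
        unfolding h_def by (rule B) (use p in simp)
      moreover have "Lp_bdd k p G = X powr (1 / p)"
        unfolding Lp_bdd_def Gp X_def ..
      ultimately show ?thesis using X0 by simp
    qed
    \<comment> \<open>From X \<le> N X^(1/p), with N the norm of f, dividing by X^(1/p) leaves the
      power 1 - 1/p = 1/q.\<close>
    have "X powr (1 / q) \<le> Lp_bdd k p f"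
    proof (cases "X = 0")
      case False
      then have X: "X > 0" using X0 by simp
      have "X = X powr (1 / q) * X powr (1 / p)"
        using X q unfolding powr_add[symmetric] by (simp add: add.commute)
      then have "X powr (1 / q) * X powr (1 / p) \<le> Lp_bdd k p f * X powr (1 / p)"
        using \<open>X \<le> Lp_bdd k p f * X powr (1 / p)\<close> by simp
      then show ?thesis using X by simp
    qed (simp add: Lp_bdd_def)
    then have "(X powr (1 / q)) powr q \<le> Lp_bdd k p f powr q"
      using q' by (intro powr_mono2) auto
    then have "X \<le> Lp_bdd k p f powr q" using X0 q' by (simp add: powr_powr)
    moreover have "(\<integral>\<^sup>+\<xi>. ennreal (norm (h \<xi>) powr q) * indicator {-R..R} \<xi> \<partial>\<mu> k) = ennreal X"
      unfolding X_def using IX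
      by (subst nn_integral_eq_integral[symmetric]) (auto simp: ennreal_mult' ennreal_indicator)
    ultimately show ?thesis by (simp add: ennreal_leI)
  qed
  have "(\<lambda>n. \<integral>\<^sup>+\<xi>. ennreal (norm (h \<xi>) powr q) * indicator {- real n..real n} \<xi> \<partial>\<mu> k)
      \<longlonglongrightarrow> (\<integral>\<^sup>+\<xi>. ennreal (norm (h \<xi>) powr q) \<partial>\<mu> k)"
  proof (rule nn_integral_LIMSEQ)
    show "incseq (\<lambda>n \<xi>. ennreal (norm (h \<xi>) powr q) * indicator {- real n..real n} \<xi>)"
      by (auto simp: incseq_def le_fun_def indicator_def)
    fix \<xi> :: real
    obtain N where N: "\<bar>\<xi>\<bar> \<le> real N" using real_arch_simple by blast
    have "eventually (\<lambda>n. ennreal (norm (h \<xi>) powr q) * indicator {- real n..real n} \<xi> = ennreal (norm (h \<xi>) powr q)) sequentially"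
      using eventually_ge_at_top[of N] by eventually_elim (use N in \<open>auto simp: indicator_def\<close>)
    then show "(\<lambda>n. ennreal (norm (h \<xi>) powr q) * indicator {- real n..real n} \<xi>) \<longlonglongrightarrow> ennreal (norm (h \<xi>) powr q)"
      by (rule tendsto_eventually)
  qed auto
  then show ?thesis unfolding h_def[symmetric]
  proof (rule LIMSEQ_le_const2)
    show "\<exists>N. \<forall>n\<ge>N. (\<integral>\<^sup>+\<xi>. ennreal (norm (h \<xi>) powr q) * indicator {- real n..real n} \<xi> \<partial>\<mu> k) \<le> ennreal (Lp_bdd k p f powr q)"
      using cut by (intro exI[of _ 1]) auto
  qed
qed

text \<open>Truncation in value and in argument yields bounded functions of bounded support below
  |f|. Integrability of f makes their transforms converge pointwise, and Fatou's lemma carries the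
  uniform bound over.\<close>

theorem hausdorff_young_dunkl:
  assumes k: "k \<ge> - 1 / 2" and p: "1 < p" "p \<le> 2" and q: "1 / p + 1 / q = 1"
    and f: "integrable (\<mu> k) f"
    and A: "(\<integral>\<^sup>+x. ennreal (norm (f x) powr p) \<partial>\<mu> k) \<le> ennreal A" "A \<ge> 0"
  shows "(\<integral>\<^sup>+\<xi>. ennreal (norm (dunkl_transform k f \<xi>) powr q) \<partial>\<mu> k) \<le> ennreal (A powr (q / p))"
proof -
  have k1: "k > -1" using k by auto
  have q0: "q > 0"
  proof -
    have "1 / q = 1 - 1 / p" using q by simp
    also have "\<dots> > 0" using p by simp
    finally show ?thesis by simp
  qed
  have [measurable]: "f \<in> borel_measurable borel" using borel_measurable_integrable[OF f] by simp
  define s where "s = (\<lambda>(n::nat) x. if norm (f x) \<le> real n \<and> \<bar>x\<bar> \<le> real n then f x else 0)"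
  have sm[measurable]: "s n \<in> borel_measurable borel" for n unfolding s_def by measurable
  have s: "bdd_supp (s n)" for n
    unfolding bdd_supp_def by (intro conjI exI[of _ "real n + 1"]) (auto simp: s_def)
  have s_le: "norm (s n x) \<le> norm (f x)" for n x by (simp add: s_def)
  have lim: "(\<lambda>n. s n x) \<longlonglongrightarrow> f x" for x
  proof -
    obtain N where N: "max (norm (f x)) \<bar>x\<bar> \<le> real N" using real_arch_simple by blast
    have "eventually (\<lambda>n. s n x = f x) sequentially"
      using eventually_ge_at_top[of N] by eventually_elim (use N in \<open>auto simp: s_def\<close>)
    then show ?thesis by (rule tendsto_eventually)
  qed
  have T: "(\<lambda>n. dunkl_transform k (s n) \<xi>) \<longlonglongrightarrow> dunkl_transform k f \<xi>" for \<xi>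
    by (rule dunkl_transform_tendsto[OF k integrable_norm[OF f]]) (auto intro: lim s_le)
  have bound: "(\<integral>\<^sup>+\<xi>. ennreal (norm (dunkl_transform k (s n) \<xi>) powr q) \<partial>\<mu> k) \<le> ennreal (A powr (q / p))" for n
  proof -
    have "ennreal (LINT x|\<mu> k. norm (s n x) powr p) = (\<integral>\<^sup>+x. ennreal (norm (s n x) powr p) \<partial>\<mu> k)"
      using p by (intro nn_integral_eq_integral[symmetric] bdd_supp_powr k1 s) auto
    also have "\<dots> \<le> (\<integral>\<^sup>+x. ennreal (norm (f x) powr p) \<partial>\<mu> k)"
      using p s_le by (intro nn_integral_mono ennreal_leI powr_mono2) auto
    finally have "ennreal (LINT x|\<mu> k. norm (s n x) powr p) \<le> ennreal A" using A(1) by (rule order_trans)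
    then have "(LINT x|\<mu> k. norm (s n x) powr p) \<le> A" using A(2) by (simp add: ennreal_le_iff)
    then have "(LINT x|\<mu> k. norm (s n x) powr p) powr (q / p) \<le> A powr (q / p)"
      using q0 p by (intro powr_mono2) auto
    then have "Lp_bdd k p (s n) powr q \<le> A powr (q / p)" by (simp add: Lp_bdd_def powr_powr)
    then have "ennreal (Lp_bdd k p (s n) powr q) \<le> ennreal (A powr (q / p))" by (rule ennreal_leI)
    with hausdorff_young_bdd_supp[OF k p q s] show ?thesis by (rule order_trans)
  qed
  have "(\<integral>\<^sup>+\<xi>. ennreal (norm (dunkl_transform k f \<xi>) powr q) \<partial>\<mu> k)
    = (\<integral>\<^sup>+\<xi>. liminf (\<lambda>n. ennreal (norm (dunkl_transform k (s n) \<xi>) powr q)) \<partial>\<mu> k)"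
    using q0 by (intro nn_integral_cong lim_imp_Liminf[symmetric] tendsto_ennrealI tendsto_powr' tendsto_norm T tendsto_const) auto
  also have "\<dots> \<le> liminf (\<lambda>n. \<integral>\<^sup>+\<xi>. ennreal (norm (dunkl_transform k (s n) \<xi>) powr q) \<partial>\<mu> k)"
    using k1 by (intro nn_integral_liminf) measurable
  also have "\<dots> \<le> ennreal (A powr (q / p))"
    by (rule order_trans[OF Liminf_le_Limsup[OF sequentially_bot] Limsup_bounded]) (auto intro: always_eventually bound)
  finally show ?thesis .
qed

section \<open>Power integrals\<close>

text \<open>The p-th power of the norm, left without its root and with values in
  \<open>ennreal\<close>: Fatou's lemma and monotone limits then apply directly, without separating
  finite from infinite norms.\<close>

definition Lint :: "'a measure \<Rightarrow> real \<Rightarrow> ('a \<Rightarrow> complex) \<Rightarrow> ennreal" where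
  "Lint M p f = (\<integral>\<^sup>+x. ennreal (norm (f x) powr p) \<partial>M)"

lemma Lint_cong_AE: "AE x in M. f x = g x \<Longrightarrow> Lint M p f = Lint M p g"
  unfolding Lint_def by (intro nn_integral_cong_AE) (elim eventually_mono, simp)

lemma Lint_mono: "p \<ge> 0 \<Longrightarrow> (\<And>x. norm (f x) \<le> norm (g x)) \<Longrightarrow> Lint M p f \<le> Lint M p g"
  unfolding Lint_def by (intro nn_integral_mono ennreal_leI powr_mono2) auto

lemma Lint_minus_commute: "Lint M p (\<lambda>x. f x - g x) = Lint M p (\<lambda>x. g x - f x)"
  unfolding Lint_def by (simp add: norm_minus_commute)

lemma Lint_cmult:
  assumes "f \<in> borel_measurable M"
  shows "Lint M p (\<lambda>x. c * f x) = ennreal (norm c powr p) * Lint M p f"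
proof -
  have "ennreal (norm (c * f x) powr p) = ennreal (norm c powr p) * ennreal (norm (f x) powr p)" for x
    by (simp add: norm_mult powr_mult ennreal_mult')
  then show ?thesis
    unfolding Lint_def using assms by (simp only:) (intro nn_integral_cmult, auto)
qed

text \<open>The larger of the two moduli controls the sum. Such a quasi-triangle inequality suffices
  for limits and for the existence of some operator bound, the two uses made of it.\<close>

lemma norm_add_powr_le:
  fixes a b :: complex
  assumes "p \<ge> 0"
  shows "norm (a + b) powr p \<le> 2 powr p * (norm a powr p + norm b powr p)"
proof -
  have "norm (a + b) \<le> 2 * max (norm a) (norm b)"
    using norm_triangle_ineq[of a b] by linarith
  then have "norm (a + b) powr p \<le> (2 * max (norm a) (norm b)) powr p"
    using assms by (intro powr_mono2) auto
  also have "\<dots> = 2 powr p * max (norm a) (norm b) powr p" by (rule powr_mult)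
  also have "max (norm a) (norm b) powr p \<le> norm a powr p + norm b powr p"
    by (auto simp: max_def)
  finally show ?thesis by simp
qed

lemma Lint_add_le:
  assumes [measurable]: "f \<in> borel_measurable M" "g \<in> borel_measurable M" and p: "p \<ge> 0"
  shows "Lint M p (\<lambda>x. f x + g x) \<le> ennreal (2 powr p) * (Lint M p f + Lint M p g)"
proof -
  have "Lint M p (\<lambda>x. f x + g x)
      \<le> (\<integral>\<^sup>+x. ennreal (2 powr p) * (ennreal (norm (f x) powr p) + ennreal (norm (g x) powr p)) \<partial>M)"
    unfolding Lint_def using norm_add_powr_le[OF p]
    by (intro nn_integral_mono)
      (simp add: ennreal_mult'[symmetric] ennreal_plus[symmetric] ennreal_leI del: ennreal_plus)
  also have "\<dots> = ennreal (2 powr p) * (Lint M p f + Lint M p g)"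
    unfolding Lint_def by (subst nn_integral_cmult, measurable, subst nn_integral_add, measurable)
  finally show ?thesis .
qed

lemma Lint_eq_0_iff:
  assumes "f \<in> borel_measurable M"
  shows "Lint M p f = 0 \<longleftrightarrow> (AE x in M. f x = 0)"
proof -
  have "ennreal (norm z powr p) = 0 \<longleftrightarrow> z = 0" for z :: complex
    by (cases "z = 0") (simp_all add: ennreal_eq_0_iff not_le)
  moreover have "(\<lambda>x. ennreal (norm (f x) powr p)) \<in> borel_measurable M" using assms by measurable
  ultimately show ?thesis unfolding Lint_def by (simp only: nn_integral_0_iff_AE)
qed

section \<open>Limits and completeness in the power mean\<close>

lemma Lint_limit_unique:
  assumes [measurable]: "\<And>n. X n \<in> borel_measurable M" "g \<in> borel_measurable M" "h \<in> borel_measurable M"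
    and p: "p \<ge> 0"
    and g: "(\<lambda>n. Lint M p (\<lambda>x. X n x - g x)) \<longlonglongrightarrow> 0"
    and h: "(\<lambda>n. Lint M p (\<lambda>x. X n x - h x)) \<longlonglongrightarrow> 0"
  shows "AE x in M. g x = h x"
proof -
  have "(\<lambda>n. ennreal (2 powr p) * (Lint M p (\<lambda>x. X n x - g x) + Lint M p (\<lambda>x. X n x - h x)))
      \<longlonglongrightarrow> ennreal (2 powr p) * (0 + 0)"
    by (intro ennreal_tendsto_cmult tendsto_add g h) auto
  moreover have "Lint M p (\<lambda>x. g x - h x)
      \<le> ennreal (2 powr p) * (Lint M p (\<lambda>x. X n x - g x) + Lint M p (\<lambda>x. X n x - h x))" for n
    using Lint_add_le[of "\<lambda>x. g x - X n x" M "\<lambda>x. X n x - h x" p] p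
    by (simp add: Lint_minus_commute[of M p g])
  ultimately have "Lint M p (\<lambda>x. g x - h x) \<le> ennreal (2 powr p) * (0 + 0)"
    by (intro LIMSEQ_le_const) auto
  then have "AE x in M. g x - h x = 0" by (subst Lint_eq_0_iff[symmetric]) auto
  then show ?thesis by eventually_elim simp
qed

text \<open>The weights 2^j against integrals of size 4^(-j) still sum to a finite value, so the
  weighted series is finite almost everywhere. Its sum bounds each term, which yields the geometric
  decay. This supplies the almost everywhere convergent subsequences below.\<close>

lemma Lint_geometric_AE:
  assumes [measurable]: "\<And>j. Y j \<in> borel_measurable M" and q: "q > 0"
    and le: "\<And>j. Lint M q (Y j) \<le> ennreal ((1 / 4) ^ j)"
  shows "AE x in M. \<exists>S\<ge>0. \<forall>j. norm (Y j x) \<le> S * (2 powr (- (1 / q))) ^ j"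
proof -
  have "(\<integral>\<^sup>+x. (\<Sum>j. ennreal (2 ^ j * norm (Y j x) powr q)) \<partial>M) = (\<Sum>j. \<integral>\<^sup>+x. ennreal (2 ^ j * norm (Y j x) powr q) \<partial>M)"
    by (intro nn_integral_suminf) auto
  also have "\<dots> \<le> (\<Sum>j. ennreal ((1 / 2) ^ j))"
  proof (rule suminf_le)
    fix j
    have "(\<integral>\<^sup>+x. ennreal (2 ^ j * norm (Y j x) powr q) \<partial>M) = ennreal (2 ^ j) * Lint M q (Y j)"
      unfolding Lint_def by (subst nn_integral_cmult[symmetric]) (auto simp: ennreal_mult')
    also have "\<dots> \<le> ennreal (2 ^ j) * ennreal ((1 / 4) ^ j)" by (intro mult_left_mono le) auto
    also have "\<dots> = ennreal ((1 / 2) ^ j)"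
      by (subst ennreal_mult'[symmetric]) (auto simp: power_mult_distrib[symmetric])
    finally show "(\<integral>\<^sup>+x. ennreal (2 ^ j * norm (Y j x) powr q) \<partial>M) \<le> ennreal ((1 / 2) ^ j)" .
  qed auto
  also have "\<dots> = ennreal (\<Sum>j. (1 / 2) ^ j)"
    by (intro suminf_ennreal2) (auto intro: summable_geometric)
  also have "\<dots> < \<infinity>" by simp
  finally have "AE x in M. (\<Sum>j. ennreal (2 ^ j * norm (Y j x) powr q)) \<noteq> \<infinity>"
    by (intro nn_integral_PInf_AE) auto
  then show ?thesis
  proof eventually_elim
    case (elim x)
    define Z where "Z = (\<Sum>j. ennreal (2 ^ j * norm (Y j x) powr q))"
    have "Z \<noteq> \<infinity>" using elim by (simp add: Z_def)
    define s where "s = enn2real Z"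
    have s: "s \<ge> 0" "Z = ennreal s" using \<open>Z \<noteq> \<infinity>\<close> by (simp_all add: s_def less_top)
    have "norm (Y j x) \<le> s powr (1 / q) * (2 powr (- (1 / q))) ^ j" for j
    proof -
      have "ennreal (2 ^ j * norm (Y j x) powr q) \<le> ennreal s"
      proof -
        have "(\<Sum>i\<in>{j}. ennreal (2 ^ i * norm (Y i x) powr q)) \<le> Z"
          unfolding Z_def by (intro sum_le_suminf) auto
        then show ?thesis unfolding s(2) by (simp only: sum.insert sum.empty finite.emptyI empty_iff simp_thms add_0_right)
      qed
      then have "2 ^ j * norm (Y j x) powr q \<le> s" using s(1) by (simp add: ennreal_le_iff)
      then have "2 ^ j * norm (Y j x) powr q * (1 / 2) ^ j \<le> s * (1 / 2) ^ j"
        by (rule mult_right_mono) simp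
      moreover have "2 ^ j * norm (Y j x) powr q * (1 / 2) ^ j = norm (Y j x) powr q * (2 * (1 / 2)) ^ j"
        unfolding power_mult_distrib by (simp only: mult_ac)
      ultimately have "norm (Y j x) powr q \<le> s * (1 / 2) ^ j" by simp
      then have "(norm (Y j x) powr q) powr (1 / q) \<le> (s * (1 / 2) ^ j) powr (1 / q)"
        using q by (intro powr_mono2) auto
      also have "\<dots> = s powr (1 / q) * ((1 / 2) powr (1 / q)) ^ j"
      proof -
        have "((1 / 2) ^ j) powr (1 / q) = (((1 / 2) powr (1 / q)) ^ j :: real)"
          by (simp add: powr_power) (simp add: powr_realpow[symmetric] powr_powr)
        then show ?thesis by (simp add: powr_mult)
      qed
      also have "(1 / 2 :: real) powr (1 / q) = 2 powr (- (1 / q))"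
        by (simp add: powr_divide powr_minus_divide)
      finally show ?thesis using q by (simp add: powr_powr)
    qed
    then show ?case by (intro exI[of _ "s powr (1 / q)"]) auto
  qed
qed

lemma Lint_liminf_le:
  assumes [measurable]: "\<And>n. X n \<in> borel_measurable M" and q: "q > 0"
    and lim: "AE x in M. (\<lambda>n. X n x) \<longlonglongrightarrow> h x" and le: "\<And>n. n \<ge> N \<Longrightarrow> Lint M q (X n) \<le> c"
  shows "Lint M q h \<le> c"
proof -
  have "Lint M q h = (\<integral>\<^sup>+x. liminf (\<lambda>n. ennreal (norm (X n x) powr q)) \<partial>M)"
    unfolding Lint_def
  proof (rule nn_integral_cong_AE)
    show "AE x in M. ennreal (norm (h x) powr q) = liminf (\<lambda>n. ennreal (norm (X n x) powr q))"
      using lim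
    proof eventually_elim
      case (elim x)
      have "(\<lambda>n. ennreal (norm (X n x) powr q)) \<longlonglongrightarrow> ennreal (norm (h x) powr q)"
        using q by (intro tendsto_ennrealI tendsto_powr' tendsto_norm elim tendsto_const) auto
      then show ?case by (intro lim_imp_Liminf[symmetric]) auto
    qed
  qed
  also have "\<dots> \<le> liminf (\<lambda>n. Lint M q (X n))"
    unfolding Lint_def by (intro nn_integral_liminf) auto
  also have "\<dots> \<le> c"
  proof -
    have "eventually (\<lambda>n. Lint M q (X n) \<le> c) sequentially"
      using eventually_ge_at_top[of N] by eventually_elim (rule le)
    then show ?thesis
      by (intro order_trans[OF Liminf_le_Limsup Limsup_bounded]) auto
  qed
  finally show ?thesis .
qed

text \<open>Riesz-Fischer: a subsequence with geometrically small differences converges almost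
  everywhere, and Fatou's lemma shows that its limit is also the limit in the mean.\<close>

lemma Lint_complete:
  assumes [measurable]: "\<And>n. X n \<in> borel_measurable M" and q: "q > 0"
    and cauchy: "\<And>e. e > 0 \<Longrightarrow> \<exists>N. \<forall>m\<ge>N. \<forall>n\<ge>N. Lint M q (\<lambda>x. X m x - X n x) \<le> ennreal e"
  obtains h where "h \<in> borel_measurable M" "(\<lambda>n. Lint M q (\<lambda>x. X n x - h x)) \<longlonglongrightarrow> 0"
proof -
  have "\<exists>N. \<forall>m\<ge>N. \<forall>n\<ge>N. Lint M q (\<lambda>x. X m x - X n x) \<le> ennreal ((1 / 4) ^ j)" for j
    by (rule cauchy) simp
  then obtain N where N: "\<And>j m n. m \<ge> N j \<Longrightarrow> n \<ge> N j \<Longrightarrow> Lint M q (\<lambda>x. X m x - X n x) \<le> ennreal ((1 / 4) ^ j)"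
    by metis
  \<comment> \<open>Partial sums of the thresholds: monotone, and beyond each threshold at its own
    index.\<close>
  define r where "r = (\<lambda>j. \<Sum>i\<le>j. N i)"
  have r_N: "r j \<ge> N j" for j unfolding r_def by (rule member_le_sum) auto
  have r_mono: "r i \<le> r j" if "i \<le> j" for i j
    unfolding r_def using that by (intro sum_mono2) auto
  define d where "d = (\<lambda>j x. X (r (Suc j)) x - X (r j) x)"
  have "Lint M q (d j) \<le> ennreal ((1 / 4) ^ j)" for j
    unfolding d_def using r_mono[of j "Suc j"] r_N[of j] by (intro N) auto
  then have "AE x in M. \<exists>S\<ge>0. \<forall>j. norm (d j x) \<le> S * (2 powr (- (1 / q))) ^ j"
    by (intro Lint_geometric_AE q) (auto simp: d_def)
  then have conv: "AE x in M. (\<lambda>j. X (r j) x) \<longlonglongrightarrow> lim (\<lambda>j. X (r j) x)"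
  proof eventually_elim
    case (elim x)
    then obtain S where S: "\<And>j. norm (d j x) \<le> S * (2 powr (- (1 / q))) ^ j" by auto
    have "2 powr (- (1 / q)) < (1::real)" using q powr_less_mono[of "- (1 / q)" 0 "2::real"] by simp
    then have "summable (\<lambda>j. S * (2 powr (- (1 / q))) ^ j)" by (intro summable_mult summable_geometric) auto
    then have "summable (\<lambda>j. d j x)" by (rule summable_comparison_test'[where N = 0]) (rule S)
    then have "convergent (\<lambda>n. \<Sum>j<n. d j x)" by (rule summable_iff_convergent[THEN iffD1])
    then have "convergent (\<lambda>n. X (r 0) x + (\<Sum>j<n. d j x))"
      by (intro convergent_add convergent_const)
    moreover have "X (r 0) x + (\<Sum>j<n. d j x) = X (r n) x" for n
      unfolding d_def by (subst sum_lessThan_telescope) simp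
    ultimately show ?case by (simp add: convergent_LIMSEQ_iff)
  qed
  define h where "h = (\<lambda>x. lim (\<lambda>j. X (r j) x))"
  have hm[measurable]: "h \<in> borel_measurable M" unfolding h_def by measurable
  have tail: "Lint M q (\<lambda>x. X n x - h x) \<le> ennreal ((1 / 4) ^ i)" if n: "n \<ge> r i" for n i
  proof (rule Lint_liminf_le[OF _ q, where X = "\<lambda>j x. X n x - X (r j) x" and N = i])
    show "AE x in M. (\<lambda>j. X n x - X (r j) x) \<longlonglongrightarrow> X n x - h x"
      using conv by eventually_elim (intro tendsto_intros, simp add: h_def)
    show "Lint M q (\<lambda>x. X n x - X (r j) x) \<le> ennreal ((1 / 4) ^ i)" if "j \<ge> i" for j
      using n r_N[of i] r_mono[OF that] by (intro N) auto
  qed auto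
  have "(\<lambda>n. Lint M q (\<lambda>x. X n x - h x)) \<longlonglongrightarrow> 0"
  proof (rule order_tendstoI)
    fix a :: ennreal assume "0 < a"
    have "(\<lambda>i. ennreal ((1 / 4) ^ i)) \<longlonglongrightarrow> ennreal 0"
      by (intro tendsto_ennrealI LIMSEQ_realpow_zero) auto
    then have "eventually (\<lambda>i. ennreal ((1 / 4) ^ i) < a) sequentially"
      using \<open>0 < a\<close> by (intro order_tendstoD(2)) auto
    then obtain i where "ennreal ((1 / 4) ^ i) < a" by (auto simp: eventually_sequentially)
    then show "eventually (\<lambda>n. Lint M q (\<lambda>x. X n x - h x) < a) sequentially"
      by (intro eventually_mono[OF eventually_ge_at_top[of "r i"]]) (rule le_less_trans[OF tail])
  qed auto
  with hm that show thesis by blast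
qed

text \<open>Convergence and bound may refer to different exponents, because they meet only in an
  almost everywhere convergent subsequence, to which Fatou's lemma applies.\<close>

lemma Lint_tendsto_subseq_le:
  assumes [measurable]: "\<And>n. X n \<in> borel_measurable M" "h \<in> borel_measurable M"
    and q: "q > 0" "q' > 0"
    and lim: "(\<lambda>n. Lint M q (\<lambda>x. X n x - h x)) \<longlonglongrightarrow> 0" and le: "\<And>n. Lint M q' (X n) \<le> c"
  shows "Lint M q' h \<le> c"
proof -
  have "\<exists>n. Lint M q (\<lambda>x. X n x - h x) \<le> ennreal ((1 / 4) ^ j)" for j
  proof -
    have "eventually (\<lambda>n. Lint M q (\<lambda>x. X n x - h x) < ennreal ((1 / 4) ^ j)) sequentially"
      by (rule order_tendstoD(2)[OF lim]) simp
    then obtain n where "Lint M q (\<lambda>x. X n x - h x) < ennreal ((1 / 4) ^ j)"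
      unfolding eventually_sequentially by blast
    then show ?thesis by (intro exI less_imp_le)
  qed
  then obtain r where r: "\<And>j. Lint M q (\<lambda>x. X (r j) x - h x) \<le> ennreal ((1 / 4) ^ j)" by metis
  have "AE x in M. \<exists>S\<ge>0. \<forall>j. norm (X (r j) x - h x) \<le> S * (2 powr (- (1 / q))) ^ j"
    by (rule Lint_geometric_AE[OF _ q(1) r]) auto
  then have "AE x in M. (\<lambda>j. X (r j) x) \<longlonglongrightarrow> h x"
  proof eventually_elim
    case (elim x)
    then obtain S where S: "\<And>j. norm (X (r j) x - h x) \<le> S * (2 powr (- (1 / q))) ^ j" by auto
    have "2 powr (- (1 / q)) < (1::real)" using q powr_less_mono[of "- (1 / q)" 0 "2::real"] by simp
    then have "(\<lambda>j. S * (2 powr (- (1 / q))) ^ j) \<longlonglongrightarrow> 0"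
      by (intro tendsto_mult_right_zero LIMSEQ_realpow_zero) auto
    then have "(\<lambda>j. X (r j) x - h x) \<longlonglongrightarrow> 0"
      by (rule Lim_null_comparison[rotated]) (simp add: S)
    then show ?case by (simp add: LIM_zero_iff)
  qed
  then show ?thesis by (rule Lint_liminf_le[rotated 2, where N = 0]) (use q le in auto)
qed

text \<open>The concave function y^\<theta> lies below its tangent \<open>a * y + b\<close> at t = I
  / m, the bound for the mean of the q1-th power over B. Integrating the tangent at this point
  reproduces exactly the Hoelder product.\<close>

lemma Lint_Hoelder_on_set:
  assumes [measurable]: "g \<in> borel_measurable M" "B \<in> sets M" and q: "0 < q2" "q2 < q1"
    and m: "emeasure M B = ennreal m" "m > 0" and I: "Lint M q1 g \<le> ennreal I" "I > 0"
  shows "(\<integral>\<^sup>+x. ennreal (norm (g x) powr q2) * indicator B x \<partial>M) \<le> ennreal (m powr (1 - q2 / q1) * I powr (q2 / q1))"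
proof -
  define \<theta> where "\<theta> = q2 / q1"
  have \<theta>: "0 < \<theta>" "\<theta> < 1" using q by (auto simp: \<theta>_def)
  define t where "t = I / m"
  have t: "t > 0" using m I by (simp add: t_def)
  define a where "a = t powr (\<theta> - 1) * \<theta>"
  define b where "b = t powr (\<theta> - 1) * ((1 - \<theta>) * t)"
  have ab: "a \<ge> 0" "b \<ge> 0" using \<theta> t by (auto simp: a_def b_def)
  have young: "y powr \<theta> \<le> a * y + b" if y: "y \<ge> 0" for y
  proof (cases "y = 0")
    case False
    have "y powr \<theta> * t powr (1 - \<theta>) \<le> \<theta> * y + (1 - \<theta>) * t"
      using \<theta> t y False by (intro Youngs_inequality_0) auto
    then have "t powr (\<theta> - 1) * (y powr \<theta> * t powr (1 - \<theta>)) \<le> t powr (\<theta> - 1) * (\<theta> * y + (1 - \<theta>) * t)"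
      by (intro mult_left_mono) auto
    moreover have "t powr (\<theta> - 1) * (y powr \<theta> * t powr (1 - \<theta>)) = y powr \<theta> * (t powr (\<theta> - 1) * t powr (1 - \<theta>))"
      by (simp only: mult_ac)
    moreover have "t powr (\<theta> - 1) * t powr (1 - \<theta>) = 1"
      unfolding powr_add[symmetric] using t by simp
    ultimately show ?thesis by (simp add: a_def b_def algebra_simps)
  qed (use ab in auto)
  have "(\<integral>\<^sup>+x. ennreal (norm (g x) powr q2) * indicator B x \<partial>M)
      \<le> (\<integral>\<^sup>+x. ennreal a * ennreal (norm (g x) powr q1) + ennreal b * indicator B x \<partial>M)"
  proof (rule nn_integral_mono)
    fix x
    have "norm (g x) powr q2 = (norm (g x) powr q1) powr \<theta>" using q by (simp add: \<theta>_def powr_powr)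
    also have "\<dots> \<le> a * norm (g x) powr q1 + b" by (rule young) simp
    finally have "ennreal (norm (g x) powr q2) \<le> ennreal (a * norm (g x) powr q1 + b)" by (rule ennreal_leI)
    also have "\<dots> = ennreal a * ennreal (norm (g x) powr q1) + ennreal b"
      using ab by (simp add: ennreal_mult')
    finally show "ennreal (norm (g x) powr q2) * indicator B x
      \<le> ennreal a * ennreal (norm (g x) powr q1) + ennreal b * indicator B x"
      by (auto simp: indicator_def)
  qed
  also have "\<dots> = ennreal a * Lint M q1 g + ennreal b * ennreal m"
    unfolding Lint_def by (subst nn_integral_add, measurable, subst nn_integral_cmult, measurable,
        subst nn_integral_cmult_indicator, measurable, simp only: m(1))
  also have "\<dots> \<le> ennreal a * ennreal I + ennreal b * ennreal m"
    by (intro add_right_mono mult_left_mono I) auto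
  also have "\<dots> = ennreal (a * I + b * m)"
    using ab m I by (simp add: ennreal_mult')
  also have "a * I + b * m = m powr (1 - \<theta>) * I powr \<theta>"
  proof -
    have tm: "t * m = I" using m by (simp add: t_def)
    have "a * I + b * m = t powr (\<theta> - 1) * I"
    proof -
      have "b * m = t powr (\<theta> - 1) * ((1 - \<theta>) * (t * m))" by (simp add: b_def)
      then show ?thesis unfolding tm a_def by (simp add: algebra_simps)
    qed
    also have "\<dots> = I powr (\<theta> - 1) / m powr (\<theta> - 1) * I powr 1"
      using m I by (simp add: t_def powr_divide)
    also have "\<dots> = (I powr (\<theta> - 1) * I powr 1) * m powr (- (\<theta> - 1))"
    proof -
      have "m powr (- (\<theta> - 1)) = 1 / m powr (\<theta> - 1)" by (rule powr_minus_divide)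
      then show ?thesis by (simp only: times_divide_eq_left times_divide_eq_right mult_1_right)
    qed
    also have "\<dots> = m powr (1 - \<theta>) * I powr \<theta>"
      unfolding powr_add[symmetric] by simp
    finally show ?thesis .
  qed
  finally show ?thesis by (simp only: \<theta>_def)
qed

lemma interpolate_radius:
  fixes F N :: real
  assumes "s > 0" "q > 0" "\<alpha> \<ge> 0" "F > 0" "N > 0" "c \<ge> 0" "G \<ge> 0"
    and le: "\<And>r. r > 0 \<Longrightarrow> G \<le> c * r powr \<alpha> * F powr q + r powr (- (s * q)) * N powr q"
  shows "G powr (1 / q) \<le> (1 + c) powr (1 / q) * F powr (s * q / (\<alpha> + s * q)) * N powr (\<alpha> / (\<alpha> + s * q))"
proof -
  define D where "D = \<alpha> + s * q"
  have D: "D > 0" using assms by (simp add: D_def add_nonneg_pos)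
  \<comment> \<open>This solves r^\<alpha> F^q = r^(-s q) N^q. The constant c stays out of the
    balance, so both terms carry the common value X and the sum is (1 + c) X: hence the shape of
    \<open>C_const\<close>.\<close>
  define r where "r = (N / F) powr (q / D)"
  have r: "r > 0" using assms by (simp add: r_def)
  have rpow: "r powr e = N powr (q / D * e) / F powr (q / D * e)" for e
    using assms by (simp add: r_def powr_powr powr_divide)
  define X where "X = N powr (q * \<alpha> / D) * F powr (q * (s * q) / D)"
  have 1: "r powr \<alpha> * F powr q = X"
  proof -
    have "r powr \<alpha> * F powr q = N powr (q / D * \<alpha>) * (F powr q / F powr (q / D * \<alpha>))"
      by (simp add: rpow)
    also have "F powr q / F powr (q / D * \<alpha>) = F powr (q - q / D * \<alpha>)" by (simp add: powr_diff)
    also have "q - q / D * \<alpha> = q * (s * q) / D"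
      using D by (simp add: field_simps) (simp add: D_def algebra_simps)
    finally show ?thesis by (simp add: X_def)
  qed
  have 2: "r powr (- (s * q)) * N powr q = X"
  proof -
    have "r powr (- (s * q)) * N powr q = N powr (q / D * - (s * q)) * N powr q / F powr (q / D * - (s * q))"
      by (simp add: rpow)
    also have "N powr (q / D * - (s * q)) * N powr q = N powr (q / D * - (s * q) + q)" by (simp only: powr_add)
    also have "q / D * - (s * q) + q = q * \<alpha> / D"
      using D by (simp add: field_simps) (simp add: D_def algebra_simps)
    also have "N powr (q * \<alpha> / D) / F powr (q / D * - (s * q)) = X"
      using assms by (simp add: X_def powr_minus_divide)
    finally show ?thesis .
  qed
  have "G \<le> c * (r powr \<alpha> * F powr q) + r powr (- (s * q)) * N powr q"
    using le[OF r] by (simp add: mult.assoc)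
  then have "G \<le> (1 + c) * X" unfolding 1 2 by (simp add: algebra_simps)
  then have "G powr (1 / q) \<le> ((1 + c) * X) powr (1 / q)" using assms by (intro powr_mono2) auto
  also have "\<dots> = (1 + c) powr (1 / q) * (F powr (s * q / D) * N powr (\<alpha> / D))"
    using assms D by (simp add: X_def powr_mult powr_powr mult.commute)
  finally show ?thesis by (simp add: D_def mult.assoc)
qed

section \<open>The linear canonical Dunkl transform\<close>

lemma Lk_space_iff:
  "f \<in> Lk_space k p \<longleftrightarrow> f \<in> borel_measurable borel \<and> Lint (\<mu> k) p f < \<infinity>"
  by (auto simp: Lk_space_def Lk_norm_def ennpowr_def Lint_def less_top split: if_splits)

lemma Lk_norm_eq:
  assumes "f \<in> borel_measurable borel" "Lint (\<mu> k) p f = ennreal A" "A \<ge> 0"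
  shows "Lk_norm k p f = ennreal (A powr (1 / p))"
  using assms by (simp add: Lk_norm_def ennpowr_def Lint_def)

lemma Lk_norm_le:
  assumes f: "f \<in> borel_measurable borel" and le: "Lint (\<mu> k) p f \<le> ennreal A" and A: "A \<ge> 0" and p: "p > 0"
  shows "Lk_norm k p f \<le> ennreal (A powr (1 / p))"
proof -
  define a where "a = enn2real (Lint (\<mu> k) p f)"
  have "Lint (\<mu> k) p f < \<infinity>" using le by (rule le_less_trans) simp
  then have a: "Lint (\<mu> k) p f = ennreal a" "a \<ge> 0" by (simp_all add: a_def less_top)
  then have "a \<le> A" using le A by (simp add: ennreal_le_iff)
  then show ?thesis
    unfolding Lk_norm_eq[OF f a] using a p by (intro ennreal_leI powr_mono2) auto
qed

text \<open>A norm bound also yields measurability, because \<open>Lk_norm\<close> is infinite on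
  functions that are not measurable.\<close>

lemma Lint_le_of_Lk_norm_le:
  assumes le: "Lk_norm k q u \<le> ennreal B * Lk_norm k p h" and B: "B \<ge> 0" and q: "q > 0"
    and h: "h \<in> borel_measurable borel" "Lint (\<mu> k) p h = ennreal a" "a \<ge> 0"
  shows "u \<in> borel_measurable borel" "Lint (\<mu> k) q u \<le> ennreal (B powr q * a powr (q / p))"
proof -
  have le': "Lk_norm k q u \<le> ennreal (B * a powr (1 / p))"
    using le unfolding Lk_norm_eq[OF h] using B by (simp add: ennreal_mult')
  then have "Lk_norm k q u < \<infinity>" by (rule le_less_trans) simp
  then have "u \<in> Lk_space k q" by (simp add: Lk_space_def)
  then have u: "u \<in> borel_measurable borel" "Lint (\<mu> k) q u < \<infinity>" by (auto simp: Lk_space_iff)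
  then show "u \<in> borel_measurable borel" by simp
  define A where "A = enn2real (Lint (\<mu> k) q u)"
  have A: "Lint (\<mu> k) q u = ennreal A" "A \<ge> 0" using u(2) by (simp_all add: A_def less_top)
  have "A powr (1 / q) \<le> B * a powr (1 / p)"
    using le' B unfolding Lk_norm_eq[OF u(1) A] by (simp add: ennreal_le_iff)
  then have "(A powr (1 / q)) powr q \<le> (B * a powr (1 / p)) powr q" using q by (intro powr_mono2) auto
  then have "A \<le> B powr q * a powr (q / p)" using q A(2) B by (simp add: powr_powr powr_mult)
  then show "Lint (\<mu> k) q u \<le> ennreal (B powr q * a powr (q / p))"
    unfolding A(1) by (rule ennreal_leI)
qed

lemma integrable_of_Lk_space_1: "f \<in> Lk_space k 1 \<Longrightarrow> integrable (\<mu> k) f"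
  by (auto simp: Lk_space_iff Lint_def integrable_iff_bounded)

lemma dunkl_conjugate_exponent:
  fixes p q :: real
  assumes "1 < p" "p \<le> 2" "1 / p + 1 / q = 1"
  shows "q \<ge> 2" "q = p / (p - 1)"
proof -
  have "q \<noteq> 0" using assms by auto
  then have "q * (p - 1) = p" using assms by (simp add: field_simps)
  then show q: "q = p / (p - 1)" using assms by (simp add: field_simps)
  show "q \<ge> 2" unfolding q using assms by (simp add: field_simps)
qed

section \<open>Factorization through the Dunkl transform\<close>

definition chirp :: "real^2^2 \<Rightarrow> (real \<Rightarrow> complex) \<Rightarrow> real \<Rightarrow> complex" where
  "chirp M f x = f x * exp (\<i> / 2 * of_real (M$1$1 / M$1$2 * x\<^sup>2))"

lemma norm_chirp [simp]: "norm (chirp M f x) = norm (f x)"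
proof -
  have "norm (exp (\<i> / 2 * of_real r)) = 1" for r by (simp add: norm_exp_eq_Re)
  then show ?thesis unfolding chirp_def norm_mult by simp
qed

lemma chirp_measurable [measurable]:
  assumes "f \<in> borel_measurable borel"
  shows "chirp M f \<in> borel_measurable borel"
  unfolding chirp_def[abs_def]
  by (rule borel_measurable_times[OF assms])
    (intro borel_measurable_continuous_onI continuous_intros)

lemma integrable_chirp:
  assumes "integrable (\<mu> k) f"
  shows "integrable (\<mu> k) (chirp M f)"
proof (rule Bochner_Integration.integrable_bound[OF assms])
  show "chirp M f \<in> borel_measurable (\<mu> k)"
    using borel_measurable_integrable[OF assms] by simp
qed simp

text \<open>The quadratic phase splits into a factor in x and a factor in \<xi>. Up to factors of
  constant modulus the transform is a chirp followed by the Dunkl transform and a dilation by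
  b.\<close>

lemma lcdt_integral_eq:
  assumes b: "M$1$2 \<noteq> 0"
  shows "lcdt_integral k M f \<xi> = 1 / (\<i> * of_real (M$1$2)) powr of_real (k + 1) *
    exp (\<i> / 2 * of_real (M$2$2 / M$1$2 * \<xi>\<^sup>2)) * dunkl_transform k (chirp M f) (\<xi> / M$1$2)"
proof -
  have "f x * exp (\<i> / 2 * of_real (M$2$2 / M$1$2 * \<xi>\<^sup>2 + M$1$1 / M$1$2 * x\<^sup>2)) * dunkl_kernel k (\<xi> / M$1$2) x
    = exp (\<i> / 2 * of_real (M$2$2 / M$1$2 * \<xi>\<^sup>2)) * (chirp M f x * dunkl_kernel k (\<xi> / M$1$2) x)" for x
    unfolding chirp_def of_real_add distrib_left exp_add by (simp only: mult_ac)
  then show ?thesis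
    unfolding lcdt_integral_def Let_def dunkl_transform_def by (simp only: integral_mult_right_zero mult.assoc)
qed

lemma norm_lcdt_integral:
  assumes b: "M$1$2 \<noteq> 0"
  shows "norm (lcdt_integral k M f \<xi>) = C_kb k (M$1$2) * norm (dunkl_transform k (chirp M f) (\<xi> / M$1$2))"
proof -
  let ?z = "\<i> * complex_of_real (M$1$2)"
  have z: "?z \<noteq> 0" "norm ?z = \<bar>M$1$2\<bar>" using b by (simp_all add: norm_mult)
  have "norm (?z powr of_real (k + 1)) = exp (Re (of_real (k + 1) * Ln ?z))"
    unfolding powr_def using z by (simp only: if_False norm_exp_eq_Re)
  also have "\<dots> = \<bar>M$1$2\<bar> powr (k + 1)"
    using z b by (simp add: powr_def Re_Ln)
  finally have 1: "norm (?z powr of_real (k + 1)) = \<bar>M$1$2\<bar> powr (k + 1)" .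
  have 2: "norm (exp (\<i> / 2 * of_real r)) = 1" for r by (simp add: norm_exp_eq_Re)
  show ?thesis
    unfolding lcdt_integral_eq[OF b] norm_mult norm_divide 1 2 C_kb_def by simp
qed

lemma borel_measurable_lcdt_integral:
  assumes "k > -1" "M$1$2 \<noteq> 0" and [measurable]: "f \<in> borel_measurable borel"
  shows "lcdt_integral k M f \<in> borel_measurable borel"
proof -
  have "(\<lambda>\<xi>. dunkl_transform k (chirp M f) (\<xi> / M$1$2)) \<in> borel_measurable borel"
    using assms by (intro measurable_compose[OF _ borel_measurable_dunkl_transform]) auto
  moreover have "(\<lambda>\<xi>. 1 / (\<i> * of_real (M$1$2)) powr of_real (k + 1) *
      exp (\<i> / 2 * of_real (M$2$2 / M$1$2 * \<xi>\<^sup>2))) \<in> borel_measurable borel"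
    by (intro borel_measurable_continuous_onI continuous_intros) auto
  ultimately show ?thesis
    unfolding lcdt_integral_eq[OF assms(2), abs_def] by (rule borel_measurable_times[rotated])
qed

lemma lcdt_integral_add:
  assumes "k \<ge> - 1 / 2" "M$1$2 \<noteq> 0" "integrable (\<mu> k) f" "integrable (\<mu> k) g"
  shows "lcdt_integral k M (\<lambda>x. f x + g x) \<xi> = lcdt_integral k M f \<xi> + lcdt_integral k M g \<xi>"
proof -
  have "chirp M (\<lambda>x. f x + g x) = (\<lambda>x. chirp M f x + chirp M g x)"
    by (simp add: chirp_def fun_eq_iff distrib_right)
  then show ?thesis
    using assms by (simp add: lcdt_integral_eq dunkl_transform_add integrable_chirp distrib_left)
qed

lemma lcdt_integral_cmult:
  assumes "M$1$2 \<noteq> 0"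
  shows "lcdt_integral k M (\<lambda>x. c * f x) \<xi> = c * lcdt_integral k M f \<xi>"
proof -
  have "chirp M (\<lambda>x. c * f x) = (\<lambda>x. c * chirp M f x)" by (simp add: chirp_def fun_eq_iff)
  then show ?thesis using assms by (simp add: lcdt_integral_eq dunkl_transform_cmult)
qed

lemma lcdt_integral_diff:
  assumes "k \<ge> - 1 / 2" "M$1$2 \<noteq> 0" "integrable (\<mu> k) f" "integrable (\<mu> k) g"
  shows "lcdt_integral k M (\<lambda>x. f x - g x) \<xi> = lcdt_integral k M f \<xi> - lcdt_integral k M g \<xi>"
  using lcdt_integral_add[OF assms(1-3) integrable_mult_right[OF assms(4), of "-1"]]
  by (simp add: lcdt_integral_cmult[OF assms(2), of k "-1", simplified])

text \<open>Chirps do not change moduli. The prefactor gives the q-th power of \<open>C_kb\<close>,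
  the dilation gives |b|^(2k+2), which is \<open>C_kb\<close> to the power -2.\<close>

lemma lcdt_hausdorff_young:
  assumes k: "k \<ge> - 1 / 2" and b: "M$1$2 \<noteq> 0"
    and p: "1 < p" "p \<le> 2" and q: "1 / p + 1 / q = 1"
    and f: "integrable (\<mu> k) f" and A: "Lint (\<mu> k) p f \<le> ennreal A" "A \<ge> 0"
  shows "Lint (\<mu> k) q (lcdt_integral k M f) \<le> ennreal (C_kb k (M$1$2) powr (q - 2) * A powr (q / p))"
proof -
  let ?b = "M$1$2"
  have k1: "k > -1" using k by auto
  have fm[measurable]: "f \<in> borel_measurable borel" using borel_measurable_integrable[OF f] by simp
  have [measurable]: "dunkl_transform k (chirp M f) \<in> borel_measurable borel"
    using k1 by (intro borel_measurable_dunkl_transform chirp_measurable fm)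
  have C: "C_kb k ?b > 0" using b by (simp add: C_kb_def)
  have "Lint (\<mu> k) q (lcdt_integral k M f)
      = (\<integral>\<^sup>+\<xi>. ennreal (C_kb k ?b powr q) * ennreal (norm (dunkl_transform k (chirp M f) (\<xi> / ?b)) powr q) \<partial>\<mu> k)"
    unfolding Lint_def norm_lcdt_integral[OF b] powr_mult
    by (intro nn_integral_cong ennreal_mult') simp
  also have "\<dots> = ennreal (C_kb k ?b powr q) * (\<integral>\<^sup>+\<xi>. ennreal (norm (dunkl_transform k (chirp M f) (\<xi> / ?b)) powr q) \<partial>\<mu> k)"
    by (intro nn_integral_cmult) simp
  also have "(\<integral>\<^sup>+\<xi>. ennreal (norm (dunkl_transform k (chirp M f) (\<xi> / ?b)) powr q) \<partial>\<mu> k)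
      = ennreal (\<bar>?b\<bar> powr (2 * k + 2)) * (\<integral>\<^sup>+\<xi>. ennreal (norm (dunkl_transform k (chirp M f) \<xi>) powr q) \<partial>\<mu> k)"
    by (rule nn_integral_dunkl_scale[OF _ k1 b, of "\<lambda>\<xi>. ennreal (norm (dunkl_transform k (chirp M f) \<xi>) powr q)"]) simp
  also have "(\<integral>\<^sup>+\<xi>. ennreal (norm (dunkl_transform k (chirp M f) \<xi>) powr q) \<partial>\<mu> k) \<le> ennreal (A powr (q / p))"
    using A by (intro hausdorff_young_dunkl[OF k p q] integrable_chirp f) (simp_all add: Lint_def)
  finally have "Lint (\<mu> k) q (lcdt_integral k M f)
      \<le> ennreal (C_kb k ?b powr q) * (ennreal (\<bar>?b\<bar> powr (2 * k + 2)) * ennreal (A powr (q / p)))"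
    by (simp add: mult_left_mono)
  also have "\<dots> = ennreal (C_kb k ?b powr q * (\<bar>?b\<bar> powr (2 * k + 2) * A powr (q / p)))"
    by (subst ennreal_mult'[symmetric], simp, subst ennreal_mult'[symmetric], simp, rule refl)
  also have "C_kb k ?b powr q * (\<bar>?b\<bar> powr (2 * k + 2) * A powr (q / p)) = C_kb k ?b powr (q - 2) * A powr (q / p)"
  proof -
    have "C_kb k ?b = \<bar>?b\<bar> powr (- (k + 1))" unfolding C_kb_def by (rule powr_minus_divide[symmetric])
    then have "\<bar>?b\<bar> powr (2 * k + 2) = C_kb k ?b powr (- 2)"
      by (simp add: powr_powr algebra_simps)
    then have "C_kb k ?b powr q * \<bar>?b\<bar> powr (2 * k + 2) = C_kb k ?b powr (q - 2)"
      using C by (simp add: powr_add[symmetric])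
    then show ?thesis by (simp only: mult.assoc[symmetric])
  qed
  finally show ?thesis .
qed

section \<open>Truncations and the extension to L^p\<close>

definition truncate :: "nat \<Rightarrow> (real \<Rightarrow> complex) \<Rightarrow> real \<Rightarrow> complex" where
  "truncate n f x = (if \<bar>x\<bar> \<le> real n then f x else 0)"

lemma truncate_measurable [measurable]:
  assumes [measurable]: "f \<in> borel_measurable borel"
  shows "truncate n f \<in> borel_measurable borel"
  unfolding truncate_def[abs_def] by measurable

text \<open>On a bounded interval, which has finite measure, |f| \<le> 1 + |f|^p.\<close>

lemma integrable_truncate:
  assumes k: "k > -1" and p: "p \<ge> 1" and f: "f \<in> Lk_space k p"
  shows "integrable (\<mu> k) (truncate n f)"
proof -
  have fm[measurable]: "f \<in> borel_measurable borel" and fin: "Lint (\<mu> k) p f < \<infinity>"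
    using f by (auto simp: Lk_space_iff)
  have "integrable (\<mu> k) (indicator {- real n..real n} :: real \<Rightarrow> real)"
    using emeasure_dunkl_ball[OF k, of "real n"] by (intro integrable_real_indicator) auto
  moreover have "integrable (\<mu> k) (\<lambda>x. norm (f x) powr p)"
    using fin by (intro integrableI_nonneg) (auto simp: Lint_def)
  ultimately have "integrable (\<mu> k) (\<lambda>x. indicator {- real n..real n} x + norm (f x) powr p)"
    by (rule Bochner_Integration.integrable_add)
  then show ?thesis
  proof (rule Bochner_Integration.integrable_bound)
    show "AE x in \<mu> k. norm (truncate n f x) \<le> norm (indicator {- real n..real n} x + norm (f x) powr p)"
    proof (rule AE_I2)
      fix x
      have "norm (f x) \<le> 1 + norm (f x) powr p"
      proof (cases "norm (f x) \<le> 1")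
        case False
        then have "norm (f x) powr 1 \<le> norm (f x) powr p" using p by (intro powr_mono) auto
        then show ?thesis using False by simp
      qed (simp add: add_increasing2)
      then show "norm (truncate n f x) \<le> norm (indicator {- real n..real n} x + norm (f x) powr p)"
        by (auto simp: truncate_def indicator_def)
    qed
  qed simp
qed

lemma Lint_diff_truncate_tendsto:
  assumes p: "p > 0" and f: "f \<in> Lk_space k p"
  shows "(\<lambda>n. Lint (\<mu> k) p (\<lambda>x. f x - truncate n f x)) \<longlonglongrightarrow> 0"
proof -
  have fm[measurable]: "f \<in> borel_measurable borel" and fin: "Lint (\<mu> k) p f < \<infinity>"
    using f by (auto simp: Lk_space_iff)
  have "(\<lambda>n. \<integral>\<^sup>+x. ennreal (norm (f x - truncate n f x) powr p) \<partial>\<mu> k) \<longlonglongrightarrow> (\<integral>\<^sup>+x. 0 \<partial>\<mu> k)"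
  proof (rule nn_integral_dominated_convergence[where w = "\<lambda>x. ennreal (norm (f x) powr p)"])
    show "AE x in \<mu> k. ennreal (norm (f x - truncate n f x) powr p) \<le> ennreal (norm (f x) powr p)" for n
      using p by (intro AE_I2 ennreal_leI) (simp add: truncate_def)
    show "AE x in \<mu> k. (\<lambda>n. ennreal (norm (f x - truncate n f x) powr p)) \<longlonglongrightarrow> 0"
    proof (rule AE_I2)
      fix x :: real
      obtain N where N: "\<bar>x\<bar> \<le> real N" using real_arch_simple by blast
      have "eventually (\<lambda>n. ennreal (norm (f x - truncate n f x) powr p) = 0) sequentially"
        using eventually_ge_at_top[of N] by eventually_elim (use N in \<open>simp add: truncate_def\<close>)
      then show "(\<lambda>n. ennreal (norm (f x - truncate n f x) powr p)) \<longlonglongrightarrow> 0" by (rule tendsto_eventually)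
    qed
  qed (use fin in \<open>auto simp: Lint_def\<close>)
  then show ?thesis by (simp add: Lint_def)
qed

lemma truncate_Lk_space:
  assumes p: "p > 0" and f: "f \<in> Lk_space k p"
  shows "truncate n f \<in> Lk_space k p" "(\<lambda>x. f x - truncate n f x) \<in> Lk_space k p"
proof -
  have fm[measurable]: "f \<in> borel_measurable borel" and fin: "Lint (\<mu> k) p f < \<infinity>"
    using f by (auto simp: Lk_space_iff)
  have "Lint (\<mu> k) p (truncate n f) \<le> Lint (\<mu> k) p f"
    "Lint (\<mu> k) p (\<lambda>x. f x - truncate n f x) \<le> Lint (\<mu> k) p f"
    using p by (auto intro!: Lint_mono simp: truncate_def)
  then show "truncate n f \<in> Lk_space k p" "(\<lambda>x. f x - truncate n f x) \<in> Lk_space k p"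
    using fin unfolding Lk_space_iff by (auto intro: le_less_trans)
qed

lemma truncate_Lk_space_1:
  assumes "k > -1" "p \<ge> 1" "f \<in> Lk_space k p"
  shows "truncate n f \<in> Lk_space k 1"
  using integrable_truncate[OF assms, of n] borel_measurable_integrable[OF integrable_truncate[OF assms, of n]]
  by (simp add: Lk_space_iff Lint_def integrable_iff_bounded)

definition lcdt_limit :: "real \<Rightarrow> real^2^2 \<Rightarrow> real \<Rightarrow> (real \<Rightarrow> complex) \<Rightarrow> (real \<Rightarrow> complex) \<Rightarrow> bool" where
  "lcdt_limit k M q f h \<longleftrightarrow> h \<in> borel_measurable borel \<and>
    (\<lambda>n. Lint (\<mu> k) q (\<lambda>x. lcdt_integral k M (truncate n f) x - h x)) \<longlonglongrightarrow> 0"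

text \<open>The extension is the L^q limit of the transforms of truncations. Truncating in the
  argument alone is linear in f, so the limit inherits linearity almost everywhere. Existence is
  what gives the choice operator in \<open>lcdt\<close> its meaning.\<close>

lemma lcdt_extension_exists:
  assumes k: "k \<ge> - 1 / 2" and b: "M$1$2 \<noteq> 0" and p: "1 < p" "p \<le> 2"
  shows "\<exists>T. is_lcdt_extension k M p T"
proof -
  have k1: "k > -1" using k by auto
  define q where "q = p / (p - 1)"
  have q: "1 / p + 1 / q = 1" using p by (simp add: q_def field_simps)
  have q2: "q \<ge> 2" using dunkl_conjugate_exponent[OF p q] by simp
  define C where "C = C_kb k (M$1$2) powr (q - 2)"
  have C: "C \<ge> 0" by (simp add: C_def)
  let ?L = "Lint (\<mu> k)" and ?D = "lcdt_integral k M"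
  note HY = lcdt_hausdorff_young[OF k b p q, folded C_def]
  have Dm: "?D f \<in> borel_measurable borel" if "f \<in> borel_measurable borel" for f
    by (rule borel_measurable_lcdt_integral[OF k1 b that])
  have fm: "f \<in> borel_measurable borel" if "f \<in> Lk_space k p" for f using that by (simp add: Lk_space_iff)
  have tI: "integrable (\<mu> k) (truncate n f)" if "f \<in> Lk_space k p" for f n
    using p by (intro integrable_truncate[OF k1 _ that]) auto
  \<comment> \<open>Phrased for every integrable u below the tail of f, so that it covers both the
    difference of two truncations (Cauchy property) and the difference of f and a truncation
    (agreement with the integral).\<close>
  have small: "\<exists>N. \<forall>u. integrable (\<mu> k) u \<longrightarrow> (\<forall>x. norm (u x) \<le> norm (f x - truncate N f x)) \<longrightarrow>
      ?L q (?D u) \<le> ennreal e" if f: "f \<in> Lk_space k p" and e: "e > 0" for f e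
  proof -
    \<comment> \<open>Chosen so that \<open>C * a powr (q / p)\<close> is at most e; the
      \<open>C + 1\<close> keeps the quotient defined.\<close>
    define a where "a = (e / (C + 1)) powr (p / q)"
    have a: "a > 0" using e C by (simp add: a_def)
    have "eventually (\<lambda>n. ?L p (\<lambda>x. f x - truncate n f x) < ennreal a) sequentially"
      using a p by (intro order_tendstoD(2)[OF Lint_diff_truncate_tendsto] f) auto
    then obtain N where N: "?L p (\<lambda>x. f x - truncate N f x) < ennreal a"
      unfolding eventually_sequentially by blast
    have "?L q (?D u) \<le> ennreal e" if u: "integrable (\<mu> k) u" "\<And>x. norm (u x) \<le> norm (f x - truncate N f x)" for u
    proof -
      have "?L p u \<le> ?L p (\<lambda>x. f x - truncate N f x)" using p u(2) by (intro Lint_mono) auto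
      then have "?L p u \<le> ennreal a" using N by simp
      then have "?L q (?D u) \<le> ennreal (C * a powr (q / p))" using a by (intro HY u) auto
      also have "C * a powr (q / p) = C * (e / (C + 1))" using e C p q2 by (simp add: a_def powr_powr)
      also have "\<dots> \<le> e" using e C by (simp add: field_simps)
      finally show ?thesis by (simp add: ennreal_leI)
    qed
    then show ?thesis by blast
  qed
  have ex: "\<exists>h. lcdt_limit k M q f h" if f: "f \<in> Lk_space k p" for f
  proof -
    note [measurable] = fm[OF f]
    obtain h where "h \<in> borel_measurable (\<mu> k)"
      "(\<lambda>n. ?L q (\<lambda>x. ?D (truncate n f) x - h x)) \<longlonglongrightarrow> 0"
    proof (rule Lint_complete[of "\<lambda>n. ?D (truncate n f)" "\<mu> k" q])
      fix e :: real assume "e > 0"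
      then obtain N where N: "\<And>u. integrable (\<mu> k) u \<Longrightarrow> (\<And>x. norm (u x) \<le> norm (f x - truncate N f x)) \<Longrightarrow>
          ?L q (?D u) \<le> ennreal e"
        using small[OF f] by blast
      have "?L q (\<lambda>x. ?D (truncate m f) x - ?D (truncate n f) x) \<le> ennreal e" if "m \<ge> N" "n \<ge> N" for m n
      proof -
        have "?L q (?D (\<lambda>x. truncate m f x - truncate n f x)) \<le> ennreal e"
          using that by (intro N Bochner_Integration.integrable_diff tI f) (auto simp: truncate_def)
        moreover have "?D (\<lambda>x. truncate m f x - truncate n f x) = (\<lambda>x. ?D (truncate m f) x - ?D (truncate n f) x)"
          by (intro ext lcdt_integral_diff k b tI f)
        ultimately show ?thesis by simp
      qed
      then show "\<exists>N. \<forall>m\<ge>N. \<forall>n\<ge>N. ?L q (\<lambda>x. ?D (truncate m f) x - ?D (truncate n f) x) \<le> ennreal e" by blast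
    qed (use q2 in \<open>auto intro: Dm\<close>)
    then show ?thesis unfolding lcdt_limit_def by auto
  qed
  define T where "T = (\<lambda>f. SOME h. lcdt_limit k M q f h)"
  have T: "T f \<in> borel_measurable borel" "(\<lambda>n. ?L q (\<lambda>x. ?D (truncate n f) x - T f x)) \<longlonglongrightarrow> 0"
    if "f \<in> Lk_space k p" for f
    using someI_ex[OF ex[OF that]] unfolding T_def lcdt_limit_def by auto
  have T_unique: "AE x in \<mu> k. T f x = h x"
    if f: "f \<in> Lk_space k p" and h: "h \<in> borel_measurable borel"
      and lim: "(\<lambda>n. ?L q (\<lambda>x. ?D (truncate n f) x - h x)) \<longlonglongrightarrow> 0" for f h
    using T[OF f] h lim q2 fm[OF f]
    by (intro Lint_limit_unique[where X = "\<lambda>n. ?D (truncate n f)" and p = q]) (auto intro: Dm)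
  have add: "AE x in \<mu> k. T (\<lambda>y. f y + g y) x = T f x + T g x"
    if f: "f \<in> Lk_space k p" and g: "g \<in> Lk_space k p" for f g
  proof (rule T_unique)
    note [measurable] = fm[OF f] fm[OF g] T(1)[OF f] T(1)[OF g]
    have [measurable]: "?D (truncate n f) \<in> borel_measurable borel" "?D (truncate n g) \<in> borel_measurable borel" for n
      by (auto intro: Dm)
    have "?L p (\<lambda>y. f y + g y) \<le> ennreal (2 powr p) * (?L p f + ?L p g)"
      using p by (intro Lint_add_le) auto
    also have "\<dots> < \<infinity>" using f g by (simp add: Lk_space_iff ennreal_mult_less_top)
    finally show "(\<lambda>y. f y + g y) \<in> Lk_space k p" by (simp add: Lk_space_iff)
    show "(\<lambda>x. T f x + T g x) \<in> borel_measurable borel" by simp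
    have eq: "?D (truncate n (\<lambda>y. f y + g y)) x - (T f x + T g x)
        = (?D (truncate n f) x - T f x) + (?D (truncate n g) x - T g x)" for n x
    proof -
      have "truncate n (\<lambda>y. f y + g y) = (\<lambda>y. truncate n f y + truncate n g y)"
        by (auto simp: truncate_def fun_eq_iff)
      then show ?thesis using lcdt_integral_add[OF k b tI[OF f] tI[OF g]] by simp
    qed
    have "(\<lambda>n. ennreal (2 powr q) * (?L q (\<lambda>x. ?D (truncate n f) x - T f x) + ?L q (\<lambda>x. ?D (truncate n g) x - T g x)))
        \<longlonglongrightarrow> ennreal (2 powr q) * (0 + 0)"
      by (intro ennreal_tendsto_cmult tendsto_add T f g) auto
    then have lim0: "(\<lambda>n. ennreal (2 powr q) * (?L q (\<lambda>x. ?D (truncate n f) x - T f x) + ?L q (\<lambda>x. ?D (truncate n g) x - T g x)))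
        \<longlonglongrightarrow> 0" by simp
    show "(\<lambda>n. ?L q (\<lambda>x. ?D (truncate n (\<lambda>y. f y + g y)) x - (T f x + T g x))) \<longlonglongrightarrow> 0"
      unfolding eq
      by (rule tendsto_sandwich[OF _ _ tendsto_const lim0]) (use q2 in \<open>auto intro!: always_eventually Lint_add_le\<close>)
  qed
  have cmult: "AE x in \<mu> k. T (\<lambda>y. c * f y) x = c * T f x" if f: "f \<in> Lk_space k p" for f c
  proof (rule T_unique)
    note [measurable] = fm[OF f] T(1)[OF f]
    have [measurable]: "?D (truncate n f) \<in> borel_measurable borel" for n by (auto intro: Dm)
    show "(\<lambda>y. c * f y) \<in> Lk_space k p"
      using f by (simp add: Lk_space_iff Lint_cmult ennreal_mult_less_top)
    show "(\<lambda>x. c * T f x) \<in> borel_measurable borel" by simp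
    have eq: "?D (truncate n (\<lambda>y. c * f y)) x - c * T f x = c * (?D (truncate n f) x - T f x)" for n x
    proof -
      have "truncate n (\<lambda>y. c * f y) = (\<lambda>y. c * truncate n f y)" by (auto simp: truncate_def fun_eq_iff)
      then show ?thesis using lcdt_integral_cmult[OF b] by (simp add: right_diff_distrib)
    qed
    have "(\<lambda>n. ennreal (norm c powr q) * ?L q (\<lambda>x. ?D (truncate n f) x - T f x)) \<longlonglongrightarrow> ennreal (norm c powr q) * 0"
      by (intro ennreal_tendsto_cmult T f) auto
    then show "(\<lambda>n. ?L q (\<lambda>x. ?D (truncate n (\<lambda>y. c * f y)) x - c * T f x)) \<longlonglongrightarrow> 0"
      unfolding eq by (subst Lint_cmult) simp_all
  qed
  have L1: "AE x in \<mu> k. T f x = ?D f x" if f: "f \<in> Lk_space k 1 \<inter> Lk_space k p" for f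
  proof (rule T_unique)
    have f1: "integrable (\<mu> k) f" and fp: "f \<in> Lk_space k p" using f by (auto intro: integrable_of_Lk_space_1)
    show "f \<in> Lk_space k p" by fact
    show "?D f \<in> borel_measurable borel" by (intro Dm fm fp)
    show "(\<lambda>n. ?L q (\<lambda>x. ?D (truncate n f) x - ?D f x)) \<longlonglongrightarrow> 0"
    proof (rule order_tendstoI)
      fix a :: ennreal assume "0 < a"
      \<comment> \<open>The target a may be infinite; a smaller positive value is finite and can be
        made real.\<close>
      then obtain e' where e': "0 < e'" "e' < a" using dense by blast
      then have "e' < \<infinity>" using less_top less_trans by fastforce
      define e where "e = enn2real e'"
      have e: "e > 0" "ennreal e < a"
        using e' \<open>e' < \<infinity>\<close> by (simp_all add: e_def enn2real_positive_iff less_top)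
      obtain N where N: "\<And>u. integrable (\<mu> k) u \<Longrightarrow> (\<And>x. norm (u x) \<le> norm (f x - truncate N f x)) \<Longrightarrow>
          ?L q (?D u) \<le> ennreal e"
        using small[OF fp e(1)] by blast
      have "?L q (\<lambda>x. ?D (truncate n f) x - ?D f x) < a" if "n \<ge> N" for n
      proof -
        have "?L q (?D (\<lambda>x. truncate n f x - f x)) \<le> ennreal e"
          using that by (intro N Bochner_Integration.integrable_diff tI fp f1) (auto simp: truncate_def)
        moreover have "?D (\<lambda>x. truncate n f x - f x) = (\<lambda>x. ?D (truncate n f) x - ?D f x)"
          by (intro ext lcdt_integral_diff k b tI fp f1)
        ultimately show ?thesis using e(2) by simp
      qed
      then show "eventually (\<lambda>n. ?L q (\<lambda>x. ?D (truncate n f) x - ?D f x) < a) sequentially"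
        unfolding eventually_sequentially by blast
    qed simp
  qed
  \<comment> \<open>The quasi-triangle inequality compares the limit with a truncation and costs the
    factor 2^q. The specification asks only for some finite bound.\<close>
  have bound: "Lk_norm k q (T f) \<le> ennreal ((2 powr q * C) powr (1 / q)) * Lk_norm k p f" if f: "f \<in> Lk_space k p" for f
  proof -
    note [measurable] = fm[OF f] T(1)[OF f]
    have [measurable]: "?D (truncate n f) \<in> borel_measurable borel" for n by (auto intro: Dm)
    define A where "A = enn2real (?L p f)"
    have A: "?L p f = ennreal A" "A \<ge> 0" using f by (simp_all add: A_def less_top Lk_space_iff)
    have Dle: "?L q (?D (truncate n f)) \<le> ennreal (C * A powr (q / p))" for n
    proof (rule HY[OF tI[OF f] _ A(2)])
      show "?L p (truncate n f) \<le> ennreal A"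
        unfolding A(1)[symmetric] using p by (intro Lint_mono) (auto simp: truncate_def)
    qed
    have "?L q (T f) \<le> ennreal (2 powr q) * (?L q (\<lambda>x. ?D (truncate n f) x - T f x) + ennreal (C * A powr (q / p)))" for n
    proof -
      have "?L q (\<lambda>x. (T f x - ?D (truncate n f) x) + ?D (truncate n f) x)
          \<le> ennreal (2 powr q) * (?L q (\<lambda>x. T f x - ?D (truncate n f) x) + ?L q (?D (truncate n f)))"
        using q2 by (intro Lint_add_le) auto
      also have "\<dots> \<le> ennreal (2 powr q) * (?L q (\<lambda>x. T f x - ?D (truncate n f) x) + ennreal (C * A powr (q / p)))"
        by (intro mult_left_mono add_left_mono Dle) auto
      finally show ?thesis by (simp add: Lint_minus_commute[of _ _ "T f"])
    qed
    moreover have "(\<lambda>n. ennreal (2 powr q) * (?L q (\<lambda>x. ?D (truncate n f) x - T f x) + ennreal (C * A powr (q / p))))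
        \<longlonglongrightarrow> ennreal (2 powr q) * (0 + ennreal (C * A powr (q / p)))"
      by (intro ennreal_tendsto_cmult tendsto_add T f tendsto_const) auto
    ultimately have "?L q (T f) \<le> ennreal (2 powr q) * (0 + ennreal (C * A powr (q / p)))"
      by (intro LIMSEQ_le_const) auto
    also have "\<dots> = ennreal (2 powr q * C * A powr (q / p))"
      by (simp only: add_0_left mult.assoc) (rule ennreal_mult'[symmetric], simp)
    finally have "Lk_norm k q (T f) \<le> ennreal ((2 powr q * C * A powr (q / p)) powr (1 / q))"
      using q2 C by (intro Lk_norm_le T f) auto
    also have "(2 powr q * C * A powr (q / p)) powr (1 / q) = (2 powr q * C) powr (1 / q) * A powr (1 / p)"
      using q2 C by (simp add: powr_mult powr_powr)
    also have "ennreal \<dots> = ennreal ((2 powr q * C) powr (1 / q)) * Lk_norm k p f"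
      unfolding Lk_norm_eq[OF fm[OF f] A] by (rule ennreal_mult') simp
    finally show ?thesis .
  qed
  have "is_lcdt_extension k M p T"
    unfolding is_lcdt_extension_def q_def[symmetric]
    using add cmult L1 bound by (intro conjI ballI allI exI[of _ "(2 powr q * C) powr (1 / q)"]) auto
  then show ?thesis by blast
qed

lemma lcdt_extension_lcdt:
  assumes "k \<ge> - 1 / 2" "M$1$2 \<noteq> 0" "1 < p" "p \<le> 2"
  shows "is_lcdt_extension k M p (lcdt k M p)"
  using lcdt_extension_exists[OF assms] unfolding lcdt_def by (rule someI_ex)

text \<open>All that the specification itself provides: an unspecified constant, together with
  measurability. It is used for continuity and finiteness; the sharp constant is recovered through
  truncations.\<close>

lemma lcdt_Lint_bound:
  assumes k: "k \<ge> - 1 / 2" and b: "M$1$2 \<noteq> 0" and p: "1 < p" "p \<le> 2" and q: "1 / p + 1 / q = 1"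
  obtains B where "B \<ge> 0"
    "\<And>f a. f \<in> Lk_space k p \<Longrightarrow> Lint (\<mu> k) p f = ennreal a \<Longrightarrow> a \<ge> 0 \<Longrightarrow>
      lcdt k M p f \<in> borel_measurable borel \<and>
      Lint (\<mu> k) q (lcdt k M p f) \<le> ennreal (B powr q * a powr (q / p))"
proof -
  have qp: "q \<ge> 2" "q = p / (p - 1)" using dunkl_conjugate_exponent[OF p q] by auto
  obtain B where B: "B \<ge> 0" "\<And>f. f \<in> Lk_space k p \<Longrightarrow> Lk_norm k q (lcdt k M p f) \<le> ennreal B * Lk_norm k p f"
    using lcdt_extension_lcdt[OF k b p] unfolding is_lcdt_extension_def qp(2)[symmetric] by blast
  show thesis
  proof (rule that[OF B(1)])
    fix f a assume f: "f \<in> Lk_space k p" and a: "Lint (\<mu> k) p f = ennreal a" "a \<ge> 0"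
    have fm: "f \<in> borel_measurable borel" using f by (simp add: Lk_space_iff)
    show "lcdt k M p f \<in> borel_measurable borel \<and>
      Lint (\<mu> k) q (lcdt k M p f) \<le> ennreal (B powr q * a powr (q / p))"
      using Lint_le_of_Lk_norm_le[OF B(2)[OF f] B(1) _ fm a] qp(1) by auto
  qed
qed

text \<open>By additivity the error is, almost everywhere, the extension applied to the tail of f;
  boundedness of the extension sends it to 0 with the norm of the tail.\<close>

lemma lcdt_truncate_tendsto:
  assumes k: "k \<ge> - 1 / 2" and b: "M$1$2 \<noteq> 0" and p: "1 < p" "p \<le> 2" and q: "1 / p + 1 / q = 1"
    and f: "f \<in> Lk_space k p"
  shows "(\<lambda>n. Lint (\<mu> k) q (\<lambda>x. lcdt_integral k M (truncate n f) x - lcdt k M p f x)) \<longlonglongrightarrow> 0"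
proof -
  have k1: "k > -1" using k by auto
  have qp: "q \<ge> 2" using dunkl_conjugate_exponent[OF p q] by auto
  let ?L = "Lint (\<mu> k)" and ?T = "lcdt k M p"
  obtain B where B: "B \<ge> 0"
    "\<And>f a. f \<in> Lk_space k p \<Longrightarrow> ?L p f = ennreal a \<Longrightarrow> a \<ge> 0 \<Longrightarrow>
      ?T f \<in> borel_measurable borel \<and> ?L q (?T f) \<le> ennreal (B powr q * a powr (q / p))"
    using lcdt_Lint_bound[OF k b p q] by blast
  have p0: "p > 0" "p \<ge> 1" using p by auto
  have tr: "truncate n f \<in> Lk_space k p" "(\<lambda>x. f x - truncate n f x) \<in> Lk_space k p" for n
    using truncate_Lk_space[OF p0(1) f] by auto
  define a where "a = (\<lambda>n. enn2real (?L p (\<lambda>x. f x - truncate n f x)))"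
  have a: "?L p (\<lambda>x. f x - truncate n f x) = ennreal (a n)" "a n \<ge> 0" for n
    using tr(2)[of n] by (simp_all add: a_def Lk_space_iff less_top)
  have "(\<lambda>n. ennreal (a n)) \<longlonglongrightarrow> ennreal 0"
    using Lint_diff_truncate_tendsto[OF p0(1) f] unfolding a(1) by simp
  then have "a \<longlonglongrightarrow> 0" using a(2) by (subst (asm) tendsto_ennreal_iff) auto
  then have "(\<lambda>n. B powr q * a n powr (q / p)) \<longlonglongrightarrow> B powr q * 0 powr (q / p)"
    using p qp a(2) by (intro tendsto_mult tendsto_const tendsto_powr') auto
  then have lim: "(\<lambda>n. ennreal (B powr q * a n powr (q / p))) \<longlonglongrightarrow> ennreal 0"
    by (intro tendsto_ennrealI) simp
  have le: "?L q (\<lambda>x. lcdt_integral k M (truncate n f) x - ?T f x) \<le> ennreal (B powr q * a n powr (q / p))" for n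
  proof -
    have "AE x in \<mu> k. ?T (\<lambda>y. (f y - truncate n f y) + truncate n f y) x
        = ?T (\<lambda>y. f y - truncate n f y) x + ?T (truncate n f) x"
      using lcdt_extension_lcdt[OF k b p, unfolded is_lcdt_extension_def, THEN conjunct1, rule_format, OF tr(2) tr(1)] .
    moreover have "AE x in \<mu> k. ?T (truncate n f) x = lcdt_integral k M (truncate n f) x"
      using lcdt_extension_lcdt[OF k b p] tr(1) truncate_Lk_space_1[OF k1 p0(2) f]
      unfolding is_lcdt_extension_def by blast
    ultimately have "AE x in \<mu> k. ?T f x - lcdt_integral k M (truncate n f) x = ?T (\<lambda>y. f y - truncate n f y) x"
      by eventually_elim simp
    then have "?L q (\<lambda>x. ?T f x - lcdt_integral k M (truncate n f) x) = ?L q (?T (\<lambda>y. f y - truncate n f y))"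
      by (rule Lint_cong_AE)
    then show ?thesis
      using B(2)[OF tr(2) a] by (simp add: Lint_minus_commute[of _ _ "?T f"])
  qed
  show ?thesis
    by (rule tendsto_sandwich[OF _ _ tendsto_const lim[unfolded ennreal_0]]) (auto intro: always_eventually le)
qed

text \<open>The truncations of \<open>f\<close> lie in \<open>L\<^sup>1\<close>, so Fatou's lemma transfers the Hausdorff--Young inequality
  for the other exponent to the extension.\<close>

lemma lcdt_hausdorff_young_other_exponent:
  assumes k: "k \<ge> - 1 / 2" and b: "M$1$2 \<noteq> 0"
    and p1: "1 < p1" "p1 \<le> 2" "1 / p1 + 1 / q1 = 1" and p2: "1 < p2" "p2 \<le> 2" "1 / p2 + 1 / q2 = 1"
    and f: "f \<in> Lk_space k p1" "f \<in> Lk_space k p2"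
    and A: "Lint (\<mu> k) p1 f = ennreal A" "A \<ge> 0"
  shows "Lint (\<mu> k) q1 (lcdt k M p2 f) \<le> ennreal (C_kb k (M$1$2) powr (q1 - 2) * A powr (q1 / p1))"
\<comment> \<open>The convergence takes place in the exponent q2, the uniform bound in the exponent
  q1.\<close>
proof (rule Lint_tendsto_subseq_le[OF _ _ _ _ lcdt_truncate_tendsto[OF k b p2 f(2)]])
  have k1: "k > -1" using k by auto
  have fm: "f \<in> borel_measurable borel" using f by (simp add: Lk_space_iff)
  show "lcdt_integral k M (truncate n f) \<in> borel_measurable (\<mu> k)" for n
    using borel_measurable_lcdt_integral[OF k1 b truncate_measurable[OF fm]] by simp
  obtain a where "Lint (\<mu> k) p2 f = ennreal a" "a \<ge> 0"
    using f(2) by (cases "Lint (\<mu> k) p2 f") (auto simp: Lk_space_iff)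
  then show "lcdt k M p2 f \<in> borel_measurable (\<mu> k)"
    using f(2) by (metis borel_measurable_dunkl_measure_iff lcdt_Lint_bound[OF k b p2])
  show "q2 > 0" "q1 > 0"
    using dunkl_conjugate_exponent(1)[OF p1] dunkl_conjugate_exponent(1)[OF p2] by auto
  show "Lint (\<mu> k) q1 (lcdt_integral k M (truncate n f)) \<le> ennreal (C_kb k (M$1$2) powr (q1 - 2) * A powr (q1 / p1))" for n
  proof (rule lcdt_hausdorff_young[OF k b p1 _ _ A(2)])
    show "integrable (\<mu> k) (truncate n f)"
      using p1 by (intro integrable_truncate[OF k1 _ f(1)]) auto
    show "Lint (\<mu> k) p1 (truncate n f) \<le> ennreal A"
      unfolding A(1)[symmetric] using p1 by (intro Lint_mono) (auto simp: truncate_def)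
  qed
qed

section \<open>Splitting at a radius and the final inequality\<close>

lemma Lint_split_ball:
  assumes k: "k > -1" and [measurable]: "g \<in> borel_measurable borel" and q: "0 < q2" "q2 < q1" and s: "s > 0" and r: "r > 0"
    and I: "Lint (\<mu> k) q1 g \<le> ennreal I" "I > 0"
    and N: "Lint (\<mu> k) q2 (\<lambda>x. of_real (\<bar>x\<bar> powr s) * g x) = ennreal n" "n \<ge> 0"
  shows "Lint (\<mu> k) q2 g \<le>
    ennreal ((1 / (2 powr (k + 1) * Gamma (k + 2))) powr ((q1 - q2) / q1) * r powr ((2 * k + 2) * (q1 - q2) / q1)
      * I powr (q2 / q1) + r powr (- (s * q2)) * n)"
proof -
  define K where "K = 1 / (2 powr (k + 1) * Gamma (k + 2))"
  have K: "K > 0" using k Gamma_real_pos[of "k + 2"] by (simp add: K_def)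
  define m where "m = K * r powr (2 * k + 2)"
  have m: "m > 0" using K r by (simp add: m_def)
  let ?B = "{-r..r}"
  have ball: "(\<integral>\<^sup>+x. ennreal (norm (g x) powr q2) * indicator ?B x \<partial>\<mu> k) \<le> ennreal (m powr (1 - q2 / q1) * I powr (q2 / q1))"
  proof (rule Lint_Hoelder_on_set[OF _ _ q _ m I])
    show "emeasure (\<mu> k) ?B = ennreal m"
      using emeasure_dunkl_ball[OF k, of r] r by (simp add: m_def K_def)
  qed auto
  have "Lint (\<mu> k) q2 g \<le> (\<integral>\<^sup>+x. ennreal (norm (g x) powr q2) * indicator ?B x
      + ennreal (r powr (- (s * q2))) * ennreal (norm (of_real (\<bar>x\<bar> powr s) * g x) powr q2) \<partial>\<mu> k)"
    unfolding Lint_def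
  proof (rule nn_integral_mono)
    fix x
    show "ennreal (norm (g x) powr q2) \<le> ennreal (norm (g x) powr q2) * indicator ?B x
        + ennreal (r powr (- (s * q2))) * ennreal (norm (of_real (\<bar>x\<bar> powr s) * g x) powr q2)"
    proof (cases "x \<in> ?B")
      case False
      then have x: "r \<le> \<bar>x\<bar>" by auto
      have "r powr (s * q2) \<le> \<bar>x\<bar> powr (s * q2)" using x r s q by (intro powr_mono2) auto
      then have "r powr (- (s * q2)) * r powr (s * q2) \<le> r powr (- (s * q2)) * \<bar>x\<bar> powr (s * q2)"
        by (intro mult_left_mono) auto
      moreover have "r powr (- (s * q2)) * r powr (s * q2) = 1" unfolding powr_add[symmetric] using r by simp
      ultimately have "1 * norm (g x) powr q2 \<le> (r powr (- (s * q2)) * \<bar>x\<bar> powr (s * q2)) * norm (g x) powr q2"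
        by (intro mult_right_mono) auto
      also have "\<dots> = r powr (- (s * q2)) * norm (of_real (\<bar>x\<bar> powr s) * g x) powr q2"
        by (simp add: norm_mult powr_mult powr_powr)
      finally have "ennreal (norm (g x) powr q2) \<le> ennreal (r powr (- (s * q2)) * norm (of_real (\<bar>x\<bar> powr s) * g x) powr q2)"
        by (intro ennreal_leI) simp
      also have "\<dots> = ennreal (r powr (- (s * q2))) * ennreal (norm (of_real (\<bar>x\<bar> powr s) * g x) powr q2)"
        by (rule ennreal_mult') simp
      finally show ?thesis by (rule order_trans) simp
    qed simp
  qed
  also have "\<dots> = (\<integral>\<^sup>+x. ennreal (norm (g x) powr q2) * indicator ?B x \<partial>\<mu> k)
      + ennreal (r powr (- (s * q2))) * Lint (\<mu> k) q2 (\<lambda>x. of_real (\<bar>x\<bar> powr s) * g x)"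
    unfolding Lint_def by (subst nn_integral_add, measurable, subst nn_integral_cmult, measurable)
  also have "\<dots> \<le> ennreal (m powr (1 - q2 / q1) * I powr (q2 / q1)) + ennreal (r powr (- (s * q2))) * ennreal n"
    unfolding N(1) by (intro add_right_mono ball)
  also have "\<dots> = ennreal (m powr (1 - q2 / q1) * I powr (q2 / q1) + r powr (- (s * q2)) * n)"
    using N(2) by (simp add: ennreal_mult')
  \<comment> \<open>The measure of the ball is K r^(2k+2); its power (q1 - q2) / q1 separates the
    ball constant from the power of r to be balanced.\<close>
  also have "m powr (1 - q2 / q1) = K powr ((q1 - q2) / q1) * r powr ((2 * k + 2) * (q1 - q2) / q1)"
  proof -
    have e: "1 - q2 / q1 = (q1 - q2) / q1" using q by (simp add: field_simps)
    show ?thesis unfolding e m_def by (simp add: powr_mult powr_powr)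
  qed
  finally show ?thesis by (simp only: K_def)
qed

theorem theorem3p7:
  fixes k a b c d p1 p2 q1 q2 s :: real
    and M :: "real^2^2"
    and f :: "real \<Rightarrow> complex"
  assumes "k \<ge> - 1 / 2"
    and "M = vector [vector [a, b], vector [c, d]]"
    and "M \<in> SL2"
    and "b \<noteq> 0"
    and "1 < p1" and "p1 < p2" and "p2 \<le> 2"
    and "1 / p1 + 1 / q1 = 1"
    and "1 / p2 + 1 / q2 = 1"
    and "s > 0"
    and "f \<in> Lk_space k p1 \<inter> Lk_space k p2"
  shows "Lk_norm k q2 (lcdt k M p2 f)
    \<le> ennreal (C_const q1 q2 k b)
      * ennpowr (Lk_norm k p1 f)
          (s * q1 * q2 / ((2 * k + 2) * (q1 - q2) + s * q1 * q2))
      * ennpowr (Lk_norm k q2 (\<lambda>x. of_real (\<bar>x\<bar> powr s) * lcdt k M p2 f x))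
          ((2 * k + 2) * (q1 - q2) / ((2 * k + 2) * (q1 - q2) + s * q1 * q2))"
proof -
  have k: "k \<ge> - 1 / 2" and k1: "k > -1" using assms by auto
  have Mb: "M$1$2 = b" using assms(2) by (simp add: vector_2)
  have b: "M$1$2 \<noteq> 0" using assms Mb by simp
  have p1: "1 < p1" "p1 \<le> 2" "1 / p1 + 1 / q1 = 1" and p2: "1 < p2" "p2 \<le> 2" "1 / p2 + 1 / q2 = 1"
    using assms by auto
  have f: "f \<in> Lk_space k p1" "f \<in> Lk_space k p2" using assms by auto
  have s: "s > 0" by fact
  have q: "q1 \<ge> 2" "q2 \<ge> 2" using dunkl_conjugate_exponent(1)[OF p1] dunkl_conjugate_exponent(1)[OF p2] by auto
  have "1 / p2 < 1 / p1" using assms(5,6) by (intro divide_strict_left_mono) auto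
  then have "1 / q1 < 1 / q2" using p1(3) p2(3) by linarith
  then have q12: "q2 < q1" using q by (simp add: field_simps)
  let ?L = "Lint (\<mu> k)"
  define g where "g = lcdt k M p2 f"
  define D where "D = (2 * k + 2) * (q1 - q2) + s * q1 * q2"
  define e1 where "e1 = s * q1 * q2 / D"
  define e2 where "e2 = (2 * k + 2) * (q1 - q2) / D"
  have fm[measurable]: "f \<in> borel_measurable borel" using f by (simp add: Lk_space_iff)
  have D: "D > 0"
  proof -
    have "0 < (2 * k + 2) * (q1 - q2)" using k1 q12 by simp
    moreover have "0 < s * q1 * q2" using q s by simp
    ultimately show ?thesis unfolding D_def by (rule add_pos_pos)
  qed
  obtain B where B: "B \<ge> 0"
    "\<And>a. ?L p2 f = ennreal a \<Longrightarrow> a \<ge> 0 \<Longrightarrow>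
      g \<in> borel_measurable borel \<and> ?L q2 g \<le> ennreal (B powr q2 * a powr (q2 / p2))"
    using lcdt_Lint_bound[OF k b p2] f(2) unfolding g_def by metis
  define A1 A2 where "A1 = enn2real (?L p1 f)" and "A2 = enn2real (?L p2 f)"
  have A1: "?L p1 f = ennreal A1" "A1 \<ge> 0" and A2: "?L p2 f = ennreal A2" "A2 \<ge> 0"
    using f by (simp_all add: A1_def A2_def Lk_space_iff less_top)
  have gm[measurable]: "g \<in> borel_measurable borel" and gle: "?L q2 g \<le> ennreal (B powr q2 * A2 powr (q2 / p2))"
    using B(2)[OF A2] by auto
  have "?L q2 g < \<infinity>" using gle by (rule le_less_trans) simp
  define G where "G = enn2real (?L q2 g)"
  have G: "?L q2 g = ennreal G" "G \<ge> 0" using \<open>?L q2 g < \<infinity>\<close> by (simp_all add: G_def less_top)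
  have LHS: "Lk_norm k q2 g = ennreal (G powr (1 / q2))" by (rule Lk_norm_eq[OF gm G])
  define F where "F = A1 powr (1 / p1)"
  have NF: "Lk_norm k p1 f = ennreal F" unfolding F_def by (rule Lk_norm_eq[OF fm A1])
  define h where "h = (\<lambda>x. of_real (\<bar>x\<bar> powr s) * g x)"
  have hm[measurable]: "h \<in> borel_measurable borel"
    unfolding h_def by (intro borel_measurable_times borel_measurable_of_real gm) auto
  have C: "C_const q1 q2 k b > 0"
  proof -
    have "1 + u powr x * v powr y > 0" for u v x y :: real by (intro add_pos_nonneg) auto
    then show ?thesis unfolding C_const_def powr_gt_zero by (metis less_irrefl)
  qed
  have "Lk_norm k q2 g \<le> ennreal (C_const q1 q2 k b) * ennpowr (Lk_norm k p1 f) e1 * ennpowr (Lk_norm k q2 h) e2"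
  proof -
    \<comment> \<open>In \<open>ennreal\<close>, 0 times infinity is 0. The case of vanishing f is
      therefore treated first, by showing that the left-hand side is 0; afterwards an infinite
      weighted norm does make the right-hand side infinite.\<close>
    consider "A1 = 0" | "A1 > 0" "?L q2 h = \<infinity>" | "A1 > 0" "?L q2 h = 0" | n where "A1 > 0" "?L q2 h = ennreal n" "n > 0"
    proof (cases "?L q2 h")
      case (real r)
      then show thesis using A1(2) that by (cases "A1 = 0"; cases "r = 0") auto
    next
      case top
      then show thesis using A1(2) that by (cases "A1 = 0") auto
    qed
    then show ?thesis
    proof cases
      case 1
      then have "?L p1 f = 0" using A1(1) by simp
      then have "AE x in \<mu> k. f x = 0" by (subst (asm) Lint_eq_0_iff) auto
      then have "?L p2 f = 0" by (subst Lint_eq_0_iff) auto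
      then have "?L q2 g \<le> 0" using gle A2 p2 q by simp
      then have "G = 0" using G by simp
      then show ?thesis unfolding LHS by simp
    next
      case 2
      have "F > 0" using 2 by (simp add: F_def)
      then have "0 < C_const q1 q2 k b * F powr e1" using C by simp
      moreover have "ennpowr (Lk_norm k q2 h) e2 = \<infinity>"
        using 2 by (simp add: Lk_norm_def ennpowr_def Lint_def)
      moreover have "ennreal (C_const q1 q2 k b) * ennpowr (Lk_norm k p1 f) e1 = ennreal (C_const q1 q2 k b * F powr e1)"
        unfolding NF using \<open>F > 0\<close> by (simp add: ennpowr_def ennreal_mult'' )
      ultimately show ?thesis using C \<open>F > 0\<close> by (simp add: ennreal_mult_top)
    next
      case 3
      have "AE x in \<mu> k. h x = 0" using 3(2) by (subst (asm) Lint_eq_0_iff) auto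
      \<comment> \<open>The weight |x|^s vanishes only at the origin, a null set.\<close>
      then have "AE x in \<mu> k. g x = 0"
        using AE_dunkl_neq_0 by eventually_elim (auto simp: h_def)
      then have "?L q2 g = 0" by (subst Lint_eq_0_iff) auto
      then have "G = 0" using G by simp
      then show ?thesis unfolding LHS by simp
    next
      case (4 n)
      have F: "F > 0" using 4 by (simp add: F_def)
      define N where "N = n powr (1 / q2)"
      have N: "N > 0" "N powr q2 = n" using 4 q by (simp_all add: N_def powr_powr)
      have NN: "Lk_norm k q2 h = ennreal N" unfolding N_def using 4 by (intro Lk_norm_eq hm) auto
      define \<alpha> where "\<alpha> = (2 * k + 2) * (q1 - q2) / q1"
      define cc where "cc = (1 / (2 powr (k + 1) * Gamma (k + 2))) powr ((q1 - q2) / q1) * C_kb k b powr ((1 - 2 / q1) * q2)"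
      define I where "I = C_kb k b powr (q1 - 2) * A1 powr (q1 / p1)"
      have Ckb: "C_kb k b > 0" using assms(4) by (simp add: C_kb_def)
      have I: "?L q1 g \<le> ennreal I" "I > 0"
        using lcdt_hausdorff_young_other_exponent[OF k b p1 p2 f A1] 4 Ckb by (simp_all add: g_def I_def Mb)
      \<comment> \<open>Raising the power q1 - 2 of \<open>C_kb\<close> to q2 / q1 gives the
        exponent (1 - 2 / q1) q2 of \<open>C_const\<close>, and the same power turns the mass of f
        into F^q2.\<close>
      have Iq: "I powr (q2 / q1) = C_kb k b powr ((1 - 2 / q1) * q2) * F powr q2"
      proof -
        have "(q1 - 2) * (q2 / q1) = (1 - 2 / q1) * q2" "q1 / p1 * (q2 / q1) = 1 / p1 * q2"
          using q by (simp_all add: field_simps)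
        then show ?thesis by (simp only: I_def F_def powr_mult powr_powr)
      qed
      have "G powr (1 / q2) \<le> (1 + cc) powr (1 / q2) * F powr (s * q2 / (\<alpha> + s * q2)) * N powr (\<alpha> / (\<alpha> + s * q2))"
      proof (rule interpolate_radius)
        show "\<alpha> \<ge> 0" using k1 q q12 by (simp add: \<alpha>_def)
        show "cc \<ge> 0" by (simp add: cc_def)
        fix r :: real assume r: "r > 0"
        have "?L q2 g \<le> ennreal ((1 / (2 powr (k + 1) * Gamma (k + 2))) powr ((q1 - q2) / q1) * r powr ((2 * k + 2) * (q1 - q2) / q1)
          * I powr (q2 / q1) + r powr (- (s * q2)) * n)"
          using q q12 4 by (intro Lint_split_ball k1 gm s r I) (auto simp: h_def)
        also have "(1 / (2 powr (k + 1) * Gamma (k + 2))) powr ((q1 - q2) / q1) * r powr ((2 * k + 2) * (q1 - q2) / q1)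
          * I powr (q2 / q1) + r powr (- (s * q2)) * n = cc * r powr \<alpha> * F powr q2 + r powr (- (s * q2)) * N powr q2"
          unfolding Iq N(2) cc_def \<alpha>_def by (simp only: mult_ac)
        finally show "G \<le> cc * r powr \<alpha> * F powr q2 + r powr (- (s * q2)) * N powr q2"
          unfolding G(1) by (subst (asm) ennreal_le_iff) (auto simp: cc_def)
      qed (use s q F N G in auto)
      moreover have "s * q2 / (\<alpha> + s * q2) = e1" "\<alpha> / (\<alpha> + s * q2) = e2"
      proof -
        \<comment> \<open>Clearing the denominator q1 converts the exponents of the balanced radius
          into those of the statement.\<close>
        have "\<alpha> + s * q2 = D / q1" using q by (simp add: \<alpha>_def D_def field_simps)
        then show "s * q2 / (\<alpha> + s * q2) = e1" "\<alpha> / (\<alpha> + s * q2) = e2"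
          using q D by (simp_all add: e1_def e2_def \<alpha>_def)
      qed
      moreover have "(1 + cc) powr (1 / q2) = C_const q1 q2 k b" by (simp only: C_const_def cc_def)
      ultimately have "ennreal (G powr (1 / q2)) \<le> ennreal (C_const q1 q2 k b * F powr e1 * N powr e2)"
        by (intro ennreal_leI) (simp only:)
      then show ?thesis
        unfolding LHS NF NN using F N C by (simp add: ennpowr_def ennreal_mult')
    qed
  qed
  then show ?thesis unfolding g_def h_def e1_def e2_def D_def .
qed

end
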